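(* Let $n\ge 2$, let $K\subset\mathbb{R}^n$ be an origin-symmetric convex body, let $q\in[1,n]$, and let $L\subset\mathbb{R}^n$ be a proper linear subspace. Then $$\frac{\widetilde C_q(K,S^{n-1}\cap L)}{\widetilde C_q(K,S^{n-1})}\le \min\Big\{\frac{\dim L}{q},\,1\Big\}.$$ Moreover, equality holds if and only if $q=n$ and the cone-volume measure $\widetilde C_n(K,\cdot)$ attains equality in the subspace concentration inequality for $L$, i.e. $\widetilde C_n(K,S^{n-1}\cap L)/\widetilde C_n(K,S^{n-1})=\dim L/n$, which happens precisely when there is a linear subspace $L'$ complementary to $L$ such that $\widetilde C_n(K,\cdot)$ is concentrated on $S^{n-1}\cap(L\cup L')$. In particular, for $q<n$ the inequality is always strict.
   Context: A convex body is a compact convex subset of $\mathbb{R}^n$ with non-empty interior; it is origin-symmetric if $K=-K$. For a convex body $K$ containing the origin in its interior: the support function is $h_K(x)=\max_{y\in K}\langle x,y\rangle$; the radial function is $\rho_K(x)=\max\{\rho>0:\rho x\in K\}$ for $x\ne 0$; for $v\in S^{n-1}$, $H_K(v)=\{x:\langle x,v\rangle=h_K(v)\}$ is the supporting hyperplane with outer normal $v$. For $\eta\subseteq S^{n-1}$ the reverse radial Gauss image is $\alpha_K^*(\eta)=\{u\in S^{n-1}: \rho_K(u)u\in H_K(v)\text{ for some }v\in\eta\}$. For $q\in\mathbb{R}$ and a Borel set $\eta\subseteq S^{n-1}$ the $q$-th dual curvature measure is $\widetilde C_q(K,\eta)=\frac1n\int_{\alpha_K^*(\eta)}\rho_K(u)^q\,d\mathcal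 H^{n-1}(u)$, where $\mathcal H^{k}$ is $k$-dimensional Hausdorff measure. For $q=n$ this is the cone-volume measure $\frac1n\int_{\nu_K^{-1}(\eta)}\langle x,\nu_K(x)\rangle\,d\mathcal H^{n-1}(x)$, where $\nu_K^{-1}(\eta)$ is the set of boundary points of $K$ having an outer unit normal in $\eta$. A measure $\mu$ on $S^{n-1}$ is concentrated on a set $A$ if $\mu(S^{n-1}\setminus A)=0$.
   Formalization: The proper linear subspace L is also assumed to be nonzero: for L = {0} both sides of the inequality are 0, so equality would hold for every q and the claims "equality only if q = n" and "strict for q < n" would fail. *)

theory Defs
  imports "HOL-Analysis.Analysis"
begin

definition convex_body :: "'a::euclidean_space set \<Rightarrow> bool" where
  "convex_body K \<longleftrightarrow> compact K \<and> convex K \<and> interior K \<noteq> {}"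

definition origin_symmetric :: "'a::euclidean_space set \<Rightarrow> bool" where
  "origin_symmetric K \<longleftrightarrow> (\<forall>x. x \<in> K \<longleftrightarrow> - x \<in> K)"

definition support_fun :: "'a::euclidean_space set \<Rightarrow> 'a \<Rightarrow> real" where
  "support_fun K x = (SUP y\<in>K. x \<bullet> y)"

definition radial_fun :: "'a::euclidean_space set \<Rightarrow> 'a \<Rightarrow> real" where
  "radial_fun K x = Sup {r. r > 0 \<and> r *\<^sub>R x \<in> K}"

definition supp_hyperplane :: "'a::euclidean_space set \<Rightarrow> 'a \<Rightarrow> 'a set" where
  "supp_hyperplane K v = {x. x \<bullet> v = support_fun K v}"

definition rev_radial_gauss :: "'a::euclidean_space set \<Rightarrow> 'a set \<Rightarrow> 'a set" where
  "rev_radial_gauss K \<eta> =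
     {u \<in> sphere 0 1. \<exists>v\<in>\<eta>. radial_fun K u *\<^sub>R u \<in> supp_hyperplane K v}"

definition unit_ball_vol :: "real \<Rightarrow> real" where
  "unit_ball_vol s = pi powr (s / 2) / Gamma (s / 2 + 1)"

definition hausdorff_content :: "real \<Rightarrow> real \<Rightarrow> 'a::euclidean_space set \<Rightarrow> ennreal" where
  "hausdorff_content s \<delta> A =
     (INF C \<in> {C :: nat \<Rightarrow> 'a set. A \<subseteq> (\<Union>i. C i) \<and> (\<forall>i. bounded (C i) \<and> diameter (C i) \<le> \<delta>)}.
        (\<Sum>i. ennreal (unit_ball_vol s * (diameter (C i) / 2) powr s)))"

definition hausdorff_outer :: "real \<Rightarrow> 'a::euclidean_space set \<Rightarrow> ennreal" where
  "hausdorff_outer s A = (SUP \<delta>\<in>{0<..}. hausdorff_content s \<delta> A)"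

definition hausdorff_measure :: "real \<Rightarrow> 'a::euclidean_space measure" where
  "hausdorff_measure s = measure_of UNIV (sets borel) (hausdorff_outer s)"

definition dual_curvature_measure :: "real \<Rightarrow> 'a::euclidean_space set \<Rightarrow> 'a set \<Rightarrow> real" where
  "dual_curvature_measure q K \<eta> =
     enn2real (\<integral>\<^sup>+ u. indicator (rev_radial_gauss K \<eta>) u * ennreal (radial_fun K u powr q)
        \<partial>(hausdorff_measure (real DIM('a) - 1) :: 'a measure)) / real DIM('a)"

end

theory Submission
  imports Defs "HOL-Probability.Distribution_Functions"
begin

text \<open>
  In polar coordinates the dual curvature measure of a set of normals is, up to a constant, the
  integral of \<open>|x|\<^sup>q\<^sup>-\<^sup>n\<close> over the part of \<open>K\<close> lying over the corresponding radial directions. This needs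
  Hausdorff measure on the sphere to be a finite positive multiple of the cone measure, which holds
  because both are invariant under rotations.

  Let \<open>\<Phi>(y)\<close> be the integral of \<open>|x|\<^sup>q\<^sup>-\<^sup>n\<close> over the section of \<open>K\<close> by \<open>y + L\<^sup>\<bottom>\<close>, for \<open>y\<close> in \<open>L\<close>. A boundary
  point with a normal in \<open>L\<close> projects to the boundary of the projection of \<open>K\<close> to \<open>L\<close>, so in polar
  coordinates of \<open>L\<close> the weight over the normals in \<open>L\<close> is at most \<open>dim L / q\<close> times the integral of
  \<open>\<Phi>(y / N y)\<close>, where \<open>N\<close> is the gauge of the projection. By Brunn--Minkowski and symmetry (Anderson's
  inequality) applied to the layers of the weight, \<open>\<Phi>(y / N y) \<le> \<Phi>(y)\<close>, and the integral of \<open>\<Phi>\<close> is the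
  total weight. For \<open>q < n\<close> the layers of small radius make the inequality strict.

  For \<open>q = n\<close> equality makes all sections have the same volume as the central one. By the equality
  case of Brunn--Minkowski for a section and its reflection they are translates of the central
  section, so \<open>K\<close> is a direct sum of the section with \<open>L\<^sup>\<bottom>\<close> and a section with a complement \<open>U\<close>, and
  \<open>L' = U\<^sup>\<bottom>\<close>. Conversely, adding the inequalities for \<open>L\<close> and \<open>L'\<close> forces equality in both.
\<close>

section \<open>Lebesgue measure and orthogonal projections\<close>

text \<open>The condition \<open>q \<le> n\<close> makes \<open>norm x powr (q - n)\<close>
  nonincreasing in the norm, hence a mixture of indicators of centred balls; each layer of
  \<open>K\<close> is then again symmetric and convex, as Anderson's inequality requires. The factor
  \<open>dim L / q\<close> is the integral of k r^(k-1) r^(q-k) over (0,1], k = dim L: k - 1 comes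
  from polar coordinates in \<open>L\<close>, and q - k from the homogeneity q - n of the weight and
  the n - k dimensions of a section. The bound by 1, the smaller one when q < dim L, has a separate
  reason: the contact set misses an open part of \<open>K\<close> near the origin.

  Two obstacles shape the development. Subspaces vary inside one type, so the measures on
  \<open>L\<close> and on its complement live on the whole space, each with a normalizing factor;
  these combine to \<open>fubini_const\<close>, which cancels. Hausdorff measure is given by covers,
  and its constant on the sphere stays undetermined because it drops out of every quotient. In the
  equality case the information holds only almost everywhere and has to be carried over to each
  single section.\<close>

lemma nn_integral_lborel_translate:
  fixes f :: "'a::euclidean_space \<Rightarrow> ennreal"
  assumes [measurable]: "f \<in> borel_measurable borel"
  shows "(\<integral>\<^sup>+x. f (x + a) \<partial>lborel) = (\<integral>\<^sup>+x. f x \<partial>lborel)"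
proof -
  have "(\<integral>\<^sup>+x. f x \<partial>lborel) = (\<integral>\<^sup>+x. f x \<partial>distr lborel borel ((+) a))"
    by (simp add: lborel_distr_plus)
  also have "\<dots> = (\<integral>\<^sup>+x. f (x + a) \<partial>lborel)"
    by (subst nn_integral_distr) (simp_all add: add.commute)
  finally show ?thesis by simp
qed

lemma nn_integral_lborel_uminus:
  fixes f :: "'a::euclidean_space \<Rightarrow> ennreal"
  assumes [measurable]: "f \<in> borel_measurable borel"
  shows "(\<integral>\<^sup>+x. f (- x) \<partial>lborel) = (\<integral>\<^sup>+x. f x \<partial>lborel)"
proof -
  have "(\<integral>\<^sup>+x. f x \<partial>lborel)
      = (\<integral>\<^sup>+x. f x \<partial>density (distr lborel borel (\<lambda>x. 0 + (-1) *\<^sub>R x)) (\<lambda>_. \<bar>-1::real\<bar> ^ DIM('a)))"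
    using lborel_affine[of "-1" "0::'a"] by simp
  also have "\<dots> = (\<integral>\<^sup>+x. f (- x) \<partial>lborel)"
    by (simp add: nn_integral_density nn_integral_distr)
  finally show ?thesis by simp
qed

lemma ennreal_mult_inverse_eq:
  assumes "a = ennreal c * b" "c > 0" shows "b = ennreal (1 / c) * a"
proof -
  have "ennreal (1 / c) * a = (ennreal (1 / c) * ennreal c) * b"
    using assms(1) by (simp only: mult.assoc)
  also have "ennreal (1 / c) * ennreal c = 1"
    using assms(2) by (subst ennreal_mult[symmetric]) auto
  finally show ?thesis by simp
qed

lemma nn_integral_lborel_scale:
  fixes f :: "'a::euclidean_space \<Rightarrow> ennreal"
  assumes [measurable]: "f \<in> borel_measurable borel" and s: "s > 0"
  shows "(\<integral>\<^sup>+x. f (s *\<^sub>R x) \<partial>lborel) = ennreal (1 / s ^ DIM('a)) * (\<integral>\<^sup>+x. f x \<partial>lborel)"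
proof -
  have "(\<integral>\<^sup>+x. f x \<partial>lborel)
      = (\<integral>\<^sup>+x. f x \<partial>density (distr lborel borel (\<lambda>x. 0 + s *\<^sub>R x)) (\<lambda>_. \<bar>s\<bar> ^ DIM('a)))"
    using lborel_affine[of s "0::'a"] s by simp
  also have "\<dots> = ennreal (s ^ DIM('a)) * (\<integral>\<^sup>+x. f (s *\<^sub>R x) \<partial>lborel)"
    using s by (simp add: nn_integral_density nn_integral_distr nn_integral_cmult)
  finally have "(\<integral>\<^sup>+x. f x \<partial>lborel) = ennreal (s ^ DIM('a)) * (\<integral>\<^sup>+x. f (s *\<^sub>R x) \<partial>lborel)" .
  then show ?thesis using s by (intro ennreal_mult_inverse_eq) auto
qed

lemma linear_imp_borel_measurable:
  fixes T :: "'a::euclidean_space \<Rightarrow> 'b::euclidean_space"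
  assumes "linear T" shows "T \<in> borel_measurable borel"
  using assms by (intro borel_measurable_continuous_onI linear_continuous_on) (rule linear_conv_bounded_linear[THEN iffD1])

text \<open>Uniqueness of Lebesgue measure among translation-invariant measures, unfolded: both sides
  are compared by Fubini against the indicator of a ball, which \<^term>\<open>T\<close> preserves.\<close>

lemma nn_integral_lborel_orthogonal:
  fixes T :: "'a::euclidean_space \<Rightarrow> 'a"
  assumes T: "orthogonal_transformation T" and f[measurable]: "f \<in> borel_measurable borel"
  shows "(\<integral>\<^sup>+x. f (T x) \<partial>lborel) = (\<integral>\<^sup>+x. f x \<partial>lborel)"
proof -
  have lin: "linear T" and nrm: "\<And>x. norm (T x) = norm x"
    using T orthogonal_transformation by auto
  interpret linear T by fact
  have [measurable]: "T \<in> borel_measurable borel"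
    using lin by (rule linear_imp_borel_measurable)
  obtain T' where T': "\<And>y. T (T' y) = y"
    using orthogonal_transformation_surj[OF T] by (metis surjD)
  define g :: "'a \<Rightarrow> ennreal" where "g = indicator (cball 0 1)"
  have [measurable]: "g \<in> borel_measurable borel" unfolding g_def by (intro borel_measurable_indicator) simp
  have geven: "g (- T x) = g x" for x by (simp add: g_def nrm indicator_def)
  let ?c = "\<integral>\<^sup>+y. g y \<partial>lborel"
  have "(\<integral>\<^sup>+x. f (T x) \<partial>lborel) * ?c = (\<integral>\<^sup>+y. g y * (\<integral>\<^sup>+x. f (T x) \<partial>lborel) \<partial>lborel)"
    by (simp add: nn_integral_multc mult.commute)
  also have "\<dots> = (\<integral>\<^sup>+y. g y * (\<integral>\<^sup>+x. f (T x + y) \<partial>lborel) \<partial>lborel)"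
  proof (rule nn_integral_cong)
    fix y
    have "(\<integral>\<^sup>+x. f (T x + y) \<partial>lborel) = (\<integral>\<^sup>+x. f (T (x + T' y)) \<partial>lborel)"
      by (simp add: add T')
    then show "g y * (\<integral>\<^sup>+x. f (T x) \<partial>lborel) = g y * (\<integral>\<^sup>+x. f (T x + y) \<partial>lborel)"
      using nn_integral_lborel_translate[of "\<lambda>x. f (T x)" "T' y"] by simp
  qed
  also have "\<dots> = (\<integral>\<^sup>+y. (\<integral>\<^sup>+x. g y * f (T x + y) \<partial>lborel) \<partial>lborel)"
    by (simp add: nn_integral_cmult)
  also have "\<dots> = (\<integral>\<^sup>+x. (\<integral>\<^sup>+y. g y * f (T x + y) \<partial>lborel) \<partial>lborel)"
    by (rule lborel_pair.Fubini') measurable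
  also have "\<dots> = (\<integral>\<^sup>+x. (\<integral>\<^sup>+y. g (y - T x) * f y \<partial>lborel) \<partial>lborel)"
  proof (rule nn_integral_cong)
    fix x
    show "(\<integral>\<^sup>+y. g y * f (T x + y) \<partial>lborel) = (\<integral>\<^sup>+y. g (y - T x) * f y \<partial>lborel)"
      using nn_integral_lborel_translate[of "\<lambda>y. g (y - T x) * f y" "T x"]
      by (simp add: add.commute)
  qed
  also have "\<dots> = (\<integral>\<^sup>+y. (\<integral>\<^sup>+x. g (y - T x) * f y \<partial>lborel) \<partial>lborel)"
    by (rule lborel_pair.Fubini') measurable
  also have "\<dots> = (\<integral>\<^sup>+y. (\<integral>\<^sup>+x. g (y - T x) \<partial>lborel) * f y \<partial>lborel)"
    by (simp add: nn_integral_multc)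
  also have "\<dots> = (\<integral>\<^sup>+y. ?c * f y \<partial>lborel)"
  proof (rule nn_integral_cong)
    fix y
    have "(\<integral>\<^sup>+x. g (y - T x) \<partial>lborel) = (\<integral>\<^sup>+x. g (y - T (x + T' y)) \<partial>lborel)"
      using nn_integral_lborel_translate[of "\<lambda>x. g (y - T x)" "T' y"] by simp
    then have "(\<integral>\<^sup>+x. g (y - T x) \<partial>lborel) = ?c"
      by (simp add: add T' geven)
    then show "(\<integral>\<^sup>+x. g (y - T x) \<partial>lborel) * f y = ?c * f y" by simp
  qed
  also have "\<dots> = (\<integral>\<^sup>+x. f x \<partial>lborel) * ?c" by (subst nn_integral_cmult) (simp_all add: mult.commute)
  finally have eq: "(\<integral>\<^sup>+x. f (T x) \<partial>lborel) * ?c = (\<integral>\<^sup>+x. f x \<partial>lborel) * ?c" .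
  have c: "?c = emeasure lborel (cball (0::'a) 1)" by (simp add: g_def)
  have "?c \<noteq> 0" "?c \<noteq> \<infinity>"
    unfolding c using emeasure_lborel_cball_finite[of "0::'a" 1]
    by (auto simp: emeasure_cball unit_ball_vol_pos[THEN less_imp_neq, symmetric])
  then show ?thesis using eq
    by (auto simp: ennreal_mult_cancel_left mult.commute[of _ ?c])
qed

section \<open>Orthogonal projections as a stand-in for subspaces\<close>

definition orth_proj :: "('a::euclidean_space \<Rightarrow> 'a) \<Rightarrow> bool" where
  "orth_proj P \<longleftrightarrow> linear P \<and> (\<forall>x y. P x \<bullet> y = x \<bullet> P y) \<and> (\<forall>x. P (P x) = P x)"

lemma orth_proj_linear: "orth_proj P \<Longrightarrow> linear P"
  and orth_proj_idem: "orth_proj P \<Longrightarrow> P (P x) = P x"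
  and orth_proj_self_adjoint: "orth_proj P \<Longrightarrow> P x \<bullet> y = x \<bullet> P y"
  unfolding orth_proj_def by auto

lemma orth_proj_compl: "orth_proj P \<Longrightarrow> orth_proj (\<lambda>x. x - P x)"
  unfolding orth_proj_def
  by (simp add: linear_diff linear_compose_sub linear_ident inner_diff_left inner_diff_right)

lemma orth_proj_orth: "orth_proj P \<Longrightarrow> P x \<bullet> (y - P y) = 0"
  by (simp add: orth_proj_self_adjoint linear_diff[OF orth_proj_linear] orth_proj_idem)

lemma orth_proj_norm_sq:
  assumes "orth_proj P" shows "(norm x)\<^sup>2 = (norm (P x))\<^sup>2 + (norm (x - P x))\<^sup>2"
  using norm_add_Pythagorean[of "P x" "x - P x"] orth_proj_orth[OF assms]
  by (simp add: orthogonal_def)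

lemma orth_proj_norm_le: "orth_proj P \<Longrightarrow> norm (P x) \<le> norm x"
  using orth_proj_norm_sq[of P x] by (simp add: power2_le_imp_le)

lemma orth_proj_continuous: "orth_proj P \<Longrightarrow> continuous_on A P"
  by (intro linear_continuous_on linear_conv_bounded_linear[THEN iffD1] orth_proj_linear)

lemma orth_proj_borel: "orth_proj P \<Longrightarrow> P \<in> borel_measurable borel"
  by (intro linear_imp_borel_measurable orth_proj_linear)

lemma orth_proj_range: "orth_proj P \<Longrightarrow> range P = {x. P x = x}"
  by (auto simp: orth_proj_idem intro: range_eqI[OF sym])

lemma orth_proj_subspace: "orth_proj P \<Longrightarrow> subspace (range P)"
  by (simp add: linear_subspace_image orth_proj_linear)

lemma subspace_orth_proj:
  fixes L :: "'a::euclidean_space set"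
  assumes "subspace L"
  obtains P where "orth_proj P" "range P = L"
proof -
  obtain B where B: "B \<subseteq> L" "pairwise orthogonal B" "\<And>x. x \<in> B \<Longrightarrow> norm x = 1"
      "independent B" "card B = dim L" "span B = L"
    using orthonormal_basis_subspace[OF assms] by metis
  have fin: "finite B" using B(4) independent_imp_finite by blast
  define P where "P x = (\<Sum>b\<in>B. (x \<bullet> b) *\<^sub>R b)" for x
  have lin: "linear P" unfolding P_def
    by (intro linearI) (simp_all add: inner_add_left scaleR_add_left sum.distrib scaleR_sum_right)
  have Pb: "P b = b" if "b \<in> B" for b
  proof -
    have "P b = (\<Sum>c\<in>B. if c = b then b else 0)" unfolding P_def
      using B(2,3) that by (intro sum.cong)
        (auto simp: pairwise_def orthogonal_def norm_eq_1 inner_commute)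
    then show ?thesis using fin that by simp
  qed
  have PL: "P x \<in> L" for x unfolding P_def
    using B(1) by (intro subspace_sum assms subspace_scale) auto
  have Pid: "P x = x" if "x \<in> L" for x
  proof (rule linear_eq_on_span[OF lin linear_ident, of B])
    show "x \<in> span B" using that B(6) by simp
  qed (simp add: Pb)
  have "P x \<bullet> y = x \<bullet> P y" for x y
    unfolding P_def by (simp add: inner_sum_left inner_sum_right inner_commute mult.commute)
  with lin PL Pid have "orth_proj P" "range P = L"
    unfolding orth_proj_def by (auto, metis rangeI)
  then show ?thesis using that by blast
qed

text \<open>Orthonormal bases of the range and of its complement together form an orthonormal basis
  of the space, and \<open>R\<close> carries the standard basis to it. In these coordinates
  \<open>P\<close> is a coordinate projection, so the diagonal change of variables for Lebesgue
  measure becomes available.\<close>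

lemma orth_proj_aligned:
  fixes P :: "'a::euclidean_space \<Rightarrow> 'a"
  assumes P: "orth_proj P"
  obtains R S where "orthogonal_transformation R" "S \<subseteq> (Basis::'a set)" "card S = dim (range P)"
    "\<And>x. P (R x) = R (\<Sum>b\<in>S. (x \<bullet> b) *\<^sub>R b)"
proof -
  let ?Q = "\<lambda>x. x - P x"
  have Q: "orth_proj ?Q" using P by (rule orth_proj_compl)
  obtain B1 where B1: "B1 \<subseteq> range P" "pairwise orthogonal B1" "\<And>x. x \<in> B1 \<Longrightarrow> norm x = 1"
      "independent B1" "card B1 = dim (range P)" "span B1 = range P"
    using orthonormal_basis_subspace[OF orth_proj_subspace[OF P]] by metis
  obtain B2 where B2: "B2 \<subseteq> range ?Q" "pairwise orthogonal B2" "\<And>x. x \<in> B2 \<Longrightarrow> norm x = 1"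
      "independent B2" "card B2 = dim (range ?Q)" "span B2 = range ?Q"
    using orthonormal_basis_subspace[OF orth_proj_subspace[OF Q]] by metis
  have orth12: "b1 \<bullet> b2 = 0" if "b1 \<in> B1" "b2 \<in> B2" for b1 b2
    using that B1(1) B2(1) orth_proj_orth[OF P] by fastforce
  have norm1: "b \<bullet> b = 1" if "b \<in> B1 \<union> B2" for b using that B1(3) B2(3) norm_eq_1 by auto
  have orth: "pairwise orthogonal (B1 \<union> B2)"
    unfolding pairwise_def orthogonal_def
    using B1(2)[unfolded pairwise_def orthogonal_def] B2(2)[unfolded pairwise_def orthogonal_def] orth12
    by (metis Un_iff inner_commute)
  have nz: "0 \<notin> B1 \<union> B2" using norm1 by fastforce
  have ind: "independent (B1 \<union> B2)"
    using orth nz by (rule pairwise_orthogonal_independent)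
  have fin: "finite B1" "finite B2" using B1(4) B2(4) independent_imp_finite by blast+
  have "span (B1 \<union> B2) = UNIV"
  proof -
    have "x \<in> span (B1 \<union> B2)" for x
    proof -
      have "P x \<in> span B1" "?Q x \<in> span B2" using B1(6) B2(6) by auto
      then have "P x + ?Q x \<in> span (B1 \<union> B2)"
        using span_mono[of B1 "B1 \<union> B2"] span_mono[of B2 "B1 \<union> B2"] by (intro span_add) auto
      then show ?thesis by simp
    qed
    then show ?thesis by auto
  qed
  then have "card (B1 \<union> B2) = DIM('a)"
    using dim_eq_card[OF _ ind, of UNIV] by simp
  then obtain \<phi> where \<phi>: "bij_betw \<phi> (Basis::'a set) (B1 \<union> B2)"
    using finite_same_card_bij[of "Basis::'a set" "B1 \<union> B2"] fin by auto
  define R where "R x = (\<Sum>b\<in>Basis. (x \<bullet> b) *\<^sub>R \<phi> b)" for x :: 'a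
  define S where "S = {b\<in>Basis. \<phi> b \<in> B1}"
  have lin: "linear R" unfolding R_def
    by (intro linearI) (simp_all add: inner_add_left scaleR_add_left sum.distrib scaleR_sum_right)
  have \<phi>in: "\<phi> b \<in> B1 \<union> B2" if "b \<in> Basis" for b using \<phi> that by (auto simp: bij_betw_def)
  have \<phi>inner: "\<phi> b \<bullet> \<phi> c = (if b = c then 1 else 0)" if "b \<in> Basis" "c \<in> Basis" for b c
  proof (cases "b = c")
    case True
    then show ?thesis using norm1[OF \<phi>in[OF that(1)]] by simp
  next
    case False
    then have "\<phi> b \<noteq> \<phi> c" using \<phi> that by (auto simp: bij_betw_def inj_on_def)
    then show ?thesis using orth[unfolded pairwise_def orthogonal_def] \<phi>in that False by simp
  qed
  have "R x \<bullet> R y = x \<bullet> y" for x y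
  proof -
    have "R x \<bullet> R y = (\<Sum>b\<in>Basis. \<Sum>c\<in>Basis. (x \<bullet> b) * (y \<bullet> c) * (\<phi> b \<bullet> \<phi> c))"
      unfolding R_def by (subst sum.swap) (simp add: inner_sum_left inner_sum_right sum_distrib_left ac_simps)
    also have "\<dots> = (\<Sum>b\<in>Basis. \<Sum>c\<in>Basis. if b = c then (x \<bullet> b) * (y \<bullet> c) else 0)"
      by (intro sum.cong) (auto simp: \<phi>inner)
    also have "\<dots> = x \<bullet> y" by (simp add: euclidean_inner[of x y])
    finally show ?thesis .
  qed
  then have orthR: "orthogonal_transformation R"
    using lin by (simp add: orthogonal_transformation_def)
  have PB1: "P b = b" if "b \<in> B1" for b using that B1(1) orth_proj_range[OF P] by auto
  have PB2: "P b = 0" if "b \<in> B2" for b using that B2(1) orth_proj_idem[OF P]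
    by (auto simp: linear_diff[OF orth_proj_linear[OF P]])
  have Rb: "R b = \<phi> b" if "b \<in> Basis" for b
  proof -
    have "R b = (\<Sum>c\<in>Basis. if c = b then \<phi> b else 0)" unfolding R_def
      by (intro sum.cong) (use that in \<open>auto simp: inner_Basis\<close>)
    then show ?thesis using that by simp
  qed
  have "P (R x) = R (\<Sum>b\<in>S. (x \<bullet> b) *\<^sub>R b)" for x
  proof -
    have "P (R x) = (\<Sum>b\<in>Basis. (x \<bullet> b) *\<^sub>R P (\<phi> b))" unfolding R_def
      by (simp add: linear_sum[OF orth_proj_linear[OF P]] linear_scale[OF orth_proj_linear[OF P]])
    also have "\<dots> = (\<Sum>b\<in>S. (x \<bullet> b) *\<^sub>R P (\<phi> b))"
      by (rule sum.mono_neutral_right) (use \<phi>in PB2 in \<open>auto simp: S_def\<close>)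
    also have "\<dots> = (\<Sum>b\<in>S. (x \<bullet> b) *\<^sub>R R b)"
      by (intro sum.cong) (auto simp: S_def PB1 Rb)
    also have "\<dots> = R (\<Sum>b\<in>S. (x \<bullet> b) *\<^sub>R b)"
      by (simp add: linear_sum[OF lin] linear_scale[OF lin])
    finally show ?thesis .
  qed
  moreover have "card S = dim (range P)"
  proof -
    have "bij_betw \<phi> S B1" using \<phi> unfolding S_def bij_betw_def by (auto simp: inj_on_def)
    then show ?thesis using B1(5) bij_betw_same_card by fastforce
  qed
  ultimately show ?thesis using that[of R S] orthR S_def by auto
qed

text \<open>The map is \<open>s\<close> on the range of \<open>P\<close> and the identity on the
  complement, so its determinant is \<open>s ^ dim (range P)\<close>. Conjugation by the
  transformation of \<open>orth_proj_aligned\<close> makes it the diagonal map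
  \<open>D\<close>.\<close>

lemma nn_integral_lborel_partial_scale:
  fixes P :: "'a::euclidean_space \<Rightarrow> 'a"
  assumes P: "orth_proj P" and s: "s > 0" and f[measurable]: "f \<in> borel_measurable borel"
  shows "(\<integral>\<^sup>+x. f (s *\<^sub>R P x + (x - P x)) \<partial>lborel) = ennreal (1 / s ^ dim (range P)) * (\<integral>\<^sup>+x. f x \<partial>lborel)"
proof -
  obtain R S where R: "orthogonal_transformation R" and S: "S \<subseteq> (Basis::'a set)" "card S = dim (range P)"
    and PR: "\<And>x. P (R x) = R (\<Sum>b\<in>S. (x \<bullet> b) *\<^sub>R b)" using orth_proj_aligned[OF P] by metis
  have lin: "linear R" using R by (simp add: orthogonal_transformation_def)
  have [measurable]: "R \<in> borel_measurable borel"
    using lin by (rule linear_imp_borel_measurable)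
  have [measurable]: "P \<in> borel_measurable borel" using P by (rule orth_proj_borel)
  define c where "c b = (if b \<in> S then s else 1)" for b :: 'a
  define D where "D x = 0 + (\<Sum>b\<in>Basis. (c b * (x \<bullet> b)) *\<^sub>R b)" for x :: 'a
  have [measurable]: "D \<in> borel_measurable borel" unfolding D_def by measurable
  have TR: "s *\<^sub>R P (R x) + (R x - P (R x)) = R (D x)" for x
  proof -
    have "D x = (\<Sum>b\<in>Basis. (x \<bullet> b) *\<^sub>R b) + (\<Sum>b\<in>Basis. (if b \<in> S then ((s - 1) * (x \<bullet> b)) *\<^sub>R b else 0))"
      unfolding D_def c_def by (simp add: sum.distrib[symmetric])
        (intro sum.cong, auto simp: algebra_simps)
    also have "(\<Sum>b\<in>Basis. (if b \<in> S then ((s - 1) * (x \<bullet> b)) *\<^sub>R b else 0)) = (\<Sum>b\<in>S. ((s - 1) * (x \<bullet> b)) *\<^sub>R b)"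
      using S(1) by (simp add: sum.inter_restrict[symmetric] Int_absorb1)
    also have "\<dots> = (s - 1) *\<^sub>R (\<Sum>b\<in>S. (x \<bullet> b) *\<^sub>R b)" by (simp add: scaleR_sum_right)
    finally have "D x = x + (s - 1) *\<^sub>R (\<Sum>b\<in>S. (x \<bullet> b) *\<^sub>R b)"
      by (simp add: euclidean_representation)
    then show ?thesis
      by (simp add: PR linear_add[OF lin] linear_diff[OF lin] linear_scale[OF lin] scaleR_diff_left)
  qed
  have det: "(\<Prod>j\<in>Basis. \<bar>c j\<bar>) = s ^ dim (range P)"
  proof -
    have "(\<Prod>j\<in>Basis. \<bar>c j\<bar>) = (\<Prod>j\<in>Basis. if j \<in> S then s else 1)"
      using s by (intro prod.cong) (auto simp: c_def)
    also have "\<dots> = (\<Prod>j\<in>S. s)"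
      using S(1) by (simp add: prod.inter_restrict[symmetric] Int_absorb1)
    finally show ?thesis using S(2) by simp
  qed
  have "(\<integral>\<^sup>+x. f x \<partial>lborel) = (\<integral>\<^sup>+x. f (R x) \<partial>lborel)"
    by (simp add: nn_integral_lborel_orthogonal[OF R f])
  also have "\<dots> = (\<integral>\<^sup>+x. f (R x) \<partial>density (distr lborel borel D) (\<lambda>_. ennreal (\<Prod>j\<in>Basis. \<bar>c j\<bar>)))"
    using lborel_affine_euclidean[of c 0] s unfolding D_def c_def by auto
  also have "\<dots> = ennreal (s ^ dim (range P)) * (\<integral>\<^sup>+x. f (R (D x)) \<partial>lborel)"
    unfolding det by (simp add: nn_integral_density nn_integral_distr nn_integral_cmult)
  also have "(\<integral>\<^sup>+x. f (R (D x)) \<partial>lborel) = (\<integral>\<^sup>+x. f (s *\<^sub>R P x + (x - P x)) \<partial>lborel)"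
    using nn_integral_lborel_orthogonal[OF R, of "\<lambda>x. f (s *\<^sub>R P x + (x - P x))"]
    by (simp add: TR)
  finally show ?thesis using s by (intro ennreal_mult_inverse_eq) auto
qed

text \<open>Lebesgue measure on the range of an orthogonal projection, up to a constant factor: the
  orthogonal directions are averaged over a unit ball.\<close>

definition sub_measure :: "('a::euclidean_space \<Rightarrow> 'a) \<Rightarrow> 'a measure" where
  "sub_measure P = distr (density lborel (indicator {x. norm (x - P x) \<le> 1})) borel P"

lemma sets_sub_measure [simp, measurable_cong]: "sets (sub_measure P) = sets borel"
  and space_sub_measure [simp]: "space (sub_measure P) = UNIV"
  by (simp_all add: sub_measure_def)

lemma nn_integral_sub_measure:
  assumes P: "orth_proj P" and [measurable]: "f \<in> borel_measurable borel"
  shows "(\<integral>\<^sup>+x. f x \<partial>sub_measure P) = (\<integral>\<^sup>+x. f (P x) * indicator {x. norm (x - P x) \<le> 1} x \<partial>lborel)"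
proof -
  have [measurable]: "P \<in> borel_measurable borel" using P by (rule orth_proj_borel)
  show ?thesis
    unfolding sub_measure_def by (simp add: nn_integral_distr nn_integral_density mult.commute)
qed

lemma nn_integral_sub_measure_scale:
  assumes P: "orth_proj P" and [measurable]: "f \<in> borel_measurable borel" and s: "s > 0"
  shows "(\<integral>\<^sup>+x. f (s *\<^sub>R x) \<partial>sub_measure P) = ennreal (1 / s ^ dim (range P)) * (\<integral>\<^sup>+x. f x \<partial>sub_measure P)"
proof -
  have [measurable]: "P \<in> borel_measurable borel" using P by (rule orth_proj_borel)
  note lin = linear_add[OF orth_proj_linear[OF P]] linear_diff[OF orth_proj_linear[OF P]]
    linear_scale[OF orth_proj_linear[OF P]]
  let ?G = "\<lambda>x. f (P x) * indicator {x. norm (x - P x) \<le> 1} x"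
  have "(\<integral>\<^sup>+x. f (s *\<^sub>R x) \<partial>sub_measure P) = (\<integral>\<^sup>+x. ?G (s *\<^sub>R P x + (x - P x)) \<partial>lborel)"
    by (subst nn_integral_sub_measure[OF P])
      (simp_all add: lin orth_proj_idem[OF P] indicator_def)
  also have "\<dots> = ennreal (1 / s ^ dim (range P)) * (\<integral>\<^sup>+x. ?G x \<partial>lborel)"
    by (rule nn_integral_lborel_partial_scale[OF P s]) measurable
  finally show ?thesis by (simp add: nn_integral_sub_measure[OF P])
qed

lemma nn_integral_sub_measure_translate:
  assumes P: "orth_proj P" and [measurable]: "f \<in> borel_measurable borel" and a: "P a = a"
  shows "(\<integral>\<^sup>+x. f (x + a) \<partial>sub_measure P) = (\<integral>\<^sup>+x. f x \<partial>sub_measure P)"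
proof -
  have [measurable]: "P \<in> borel_measurable borel" using P by (rule orth_proj_borel)
  note lin = linear_add[OF orth_proj_linear[OF P]]
  let ?G = "\<lambda>x. f (P x) * indicator {x. norm (x - P x) \<le> 1} x"
  have "(\<integral>\<^sup>+x. f (x + a) \<partial>sub_measure P) = (\<integral>\<^sup>+x. ?G (x + a) \<partial>lborel)"
    by (subst nn_integral_sub_measure[OF P])
      (simp_all add: lin a indicator_def)
  also have "\<dots> = (\<integral>\<^sup>+x. ?G x \<partial>lborel)"
    by (rule nn_integral_lborel_translate) measurable
  finally show ?thesis by (simp add: nn_integral_sub_measure[OF P])
qed

lemma nn_integral_sub_measure_uminus:
  assumes P: "orth_proj P" and [measurable]: "f \<in> borel_measurable borel"
  shows "(\<integral>\<^sup>+x. f (- x) \<partial>sub_measure P) = (\<integral>\<^sup>+x. f x \<partial>sub_measure P)"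
proof -
  have [measurable]: "P \<in> borel_measurable borel" using P by (rule orth_proj_borel)
  note lin = linear_neg[OF orth_proj_linear[OF P]]
  let ?G = "\<lambda>x. f (P x) * indicator {x. norm (x - P x) \<le> 1} x"
  have "norm (P x - x) = norm (x - P x)" for x by (rule norm_minus_commute)
  then have "(\<integral>\<^sup>+x. f (- x) \<partial>sub_measure P) = (\<integral>\<^sup>+x. ?G (- x) \<partial>lborel)"
    by (subst nn_integral_sub_measure[OF P]) (simp_all add: lin indicator_def)
  also have "\<dots> = (\<integral>\<^sup>+x. ?G x \<partial>lborel)"
    by (rule nn_integral_lborel_uminus) measurable
  finally show ?thesis by (simp add: nn_integral_sub_measure[OF P])
qed

lemma AE_sub_measure_range:
  assumes P: "orth_proj P" shows "AE x in sub_measure P. P x = x"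
proof -
  have [measurable]: "P \<in> borel_measurable borel" using P by (rule orth_proj_borel)
  show ?thesis unfolding sub_measure_def
    by (subst AE_distr_iff) (auto simp: orth_proj_idem[OF P])
qed

lemma emeasure_sub_measure_bounded:
  assumes P: "orth_proj P" and A: "bounded A"
  shows "emeasure (sub_measure P) A < \<infinity>"
proof -
  have [measurable]: "P \<in> borel_measurable borel" using P by (rule orth_proj_borel)
  obtain r where r: "A \<subseteq> cball 0 r"
    using A unfolding bounded_iff by (auto simp: subset_eq)
  have "emeasure (sub_measure P) A \<le> emeasure (sub_measure P) (cball 0 r)"
    using r by (intro emeasure_mono) auto
  also have "\<dots> = (\<integral>\<^sup>+x. indicator (cball 0 r) x \<partial>sub_measure P)" by simp
  also have "\<dots> \<le> (\<integral>\<^sup>+x. indicator (cball (0::'a) (r + 1)) x \<partial>lborel)"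
    unfolding nn_integral_sub_measure[OF P borel_measurable_indicator[OF borel_closed[OF closed_cball]]]
  proof (rule nn_integral_mono)
    fix x
    show "indicator (cball 0 r) (P x) * indicator {x. norm (x - P x) \<le> 1} x \<le> (indicator (cball 0 (r + 1)) x :: ennreal)"
      using norm_triangle_ineq[of "P x" "x - P x"] by (auto simp: indicator_def)
  qed
  also have "\<dots> < \<infinity>" using emeasure_lborel_cball_finite[of "0::'a" "r+1"] by simp
  finally show ?thesis .
qed

lemma sigma_finite_sub_measure:
  assumes P: "orth_proj P" shows "sigma_finite_measure (sub_measure P)"
proof
  show "\<exists>A. countable A \<and> A \<subseteq> sets (sub_measure P) \<and> \<Union> A = space (sub_measure P) \<and> (\<forall>a\<in>A. emeasure (sub_measure P) a \<noteq> \<infinity>)"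
  proof (intro exI conjI)
    show "countable (range (\<lambda>n::nat. cball (0::'a) (real n)))" by simp
    show "\<Union> (range (\<lambda>n::nat. cball (0::'a) (real n))) = space (sub_measure P)"
      using real_arch_simple by (auto simp: )
    show "\<forall>a\<in>range (\<lambda>n::nat. cball (0::'a) (real n)). emeasure (sub_measure P) a \<noteq> \<infinity>"
      using emeasure_sub_measure_bounded[OF P] by (auto simp: less_top)
  qed auto
qed

lemma emeasure_lborel_open_pos:
  fixes U :: "'a::euclidean_space set"
  assumes "open U" "U \<noteq> {}" shows "0 < emeasure lborel U"
proof -
  obtain x e where x: "e > 0" "ball x e \<subseteq> U" using assms openE by blast
  have "0 < emeasure lborel (ball x e)"
    using x(1) by (simp add: emeasure_ball ennreal_zero_less_mult_iff)
  also have "\<dots> \<le> emeasure lborel U" using x(2) assms(1) by (intro emeasure_mono) auto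
  finally show ?thesis .
qed

lemma emeasure_sub_measure_open_pos:
  assumes P: "orth_proj P" and U: "open U" "P p = p" "p \<in> U"
  shows "emeasure (sub_measure P) U > 0"
proof -
  have [measurable]: "P \<in> borel_measurable borel" using P by (rule orth_proj_borel)
  have cont: "continuous_on UNIV P" using P by (rule orth_proj_continuous)
  let ?V = "P -` U \<inter> {x. norm (x - P x) < 1}"
  have "open ?V"
    using U(1) by (intro open_Int open_vimage cont open_Collect_less continuous_intros)
  moreover have "p \<in> ?V" using U by simp
  ultimately have "0 < emeasure lborel ?V"
    by (intro emeasure_lborel_open_pos) auto
  also have "\<dots> = (\<integral>\<^sup>+x. indicator ?V x \<partial>lborel)"
    by (subst nn_integral_indicator) (use \<open>open ?V\<close> in auto)
  also have "\<dots> \<le> (\<integral>\<^sup>+x. indicator U (P x) * indicator {x. norm (x - P x) \<le> 1} x \<partial>lborel)"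
    by (intro nn_integral_mono) (auto simp: indicator_def)
  also have "\<dots> = emeasure (sub_measure P) U"
    using U(1) by (subst nn_integral_sub_measure[OF P, symmetric]) auto
  finally show ?thesis .
qed

text \<open>\<open>sub_measure P\<close> carries the volume of the unit ball of the complement as a
  factor, and the measure of the complement carries that of the unit ball of the range. The product
  of the two balls has the product of these factors as its volume.\<close>

definition fubini_const :: "('a::euclidean_space \<Rightarrow> 'a) \<Rightarrow> ennreal" where
  "fubini_const P = emeasure lborel {x. norm (P x) \<le> 1 \<and> norm (x - P x) \<le> 1}"

lemma fubini_const_pos_finite:
  assumes P: "orth_proj P" shows "0 < fubini_const P" "fubini_const P < \<infinity>"
proof -
  have [measurable]: "P \<in> borel_measurable borel" using P by (rule orth_proj_borel)
  have "ball 0 1 \<subseteq> {x. norm (P x) \<le> 1 \<and> norm (x - P x) \<le> 1}"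
  proof
    fix x :: 'a assume "x \<in> ball 0 1"
    then show "x \<in> {x. norm (P x) \<le> 1 \<and> norm (x - P x) \<le> 1}"
      using orth_proj_norm_le[OF P, of x] orth_proj_norm_le[OF orth_proj_compl[OF P], of x] by simp
  qed
  then have "emeasure lborel (ball (0::'a) 1) \<le> fubini_const P"
    unfolding fubini_const_def by (intro emeasure_mono) auto
  then show "0 < fubini_const P" using emeasure_lborel_open_pos[of "ball (0::'a) 1"] by auto
  have "{x. norm (P x) \<le> 1 \<and> norm (x - P x) \<le> 1} \<subseteq> cball 0 2"
  proof safe
    fix x assume "norm (P x) \<le> 1" "norm (x - P x) \<le> 1"
    then show "x \<in> cball 0 2" using norm_triangle_ineq[of "P x" "x - P x"] by simp
  qed
  then have "fubini_const P \<le> emeasure lborel (cball (0::'a) 2)"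
    unfolding fubini_const_def by (intro emeasure_mono) auto
  then show "fubini_const P < \<infinity>" using emeasure_lborel_cball_finite le_less_trans by blast
qed

text \<open>On \<^term>\<open>(x, x')\<close> the map exchanging the components of \<^term>\<open>x - P x\<close> and
  \<^term>\<open>x' - P x'\<close> is orthogonal; this gives Fubini without product measures over a basis.\<close>

lemma nn_integral_sub_measure_fubini:
  fixes P :: "'a::euclidean_space \<Rightarrow> 'a"
  assumes P: "orth_proj P" and [measurable]: "f \<in> borel_measurable borel"
  shows "(\<integral>\<^sup>+y. \<integral>\<^sup>+z. f (y + z) \<partial>sub_measure (\<lambda>x. x - P x) \<partial>sub_measure P)
    = fubini_const P * (\<integral>\<^sup>+x. f x \<partial>lborel)"
proof -
  let ?Q = "\<lambda>x. x - P x"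
  have Q: "orth_proj ?Q" using P by (rule orth_proj_compl)
  interpret P: linear P using P by (rule orth_proj_linear)
  have [measurable]: "P \<in> borel_measurable borel" using P by (rule orth_proj_borel)
  define T :: "'a \<times> 'a \<Rightarrow> 'a \<times> 'a" where
    "T = (\<lambda>z. (P (fst z) + ?Q (snd z), P (snd z) + ?Q (fst z)))"
  have orthT: "orthogonal_transformation T"
    unfolding orthogonal_transformation
  proof
    show "linear T" unfolding T_def
      by (intro linearI) (auto simp: P.add P.diff P.scale algebra_simps)
    show "\<forall>v. norm (T v) = norm v"
    proof
      fix v :: "'a \<times> 'a"
      obtain x y where v: "v = (x, y)" by (cases v)
      have 1: "(norm (P a + ?Q b))\<^sup>2 = (norm (P a))\<^sup>2 + (norm (?Q b))\<^sup>2" for a b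
        using norm_add_Pythagorean[of "P a" "?Q b"] orth_proj_orth[OF P] by (simp add: orthogonal_def)
      show "norm (T v) = norm v"
        using orth_proj_norm_sq[OF P, of x] orth_proj_norm_sq[OF P, of y]
        by (simp only: T_def v norm_Pair 1 fst_conv snd_conv) (simp add: ac_simps)
    qed
  qed
  let ?S = "{x. norm (P x) \<le> 1 \<and> norm (?Q x) \<le> 1}"
  define G :: "'a \<times> 'a \<Rightarrow> ennreal" where "G = (\<lambda>z. f (fst z) * indicator ?S (snd z))"
  have [measurable]: "G \<in> borel_measurable borel"
    unfolding G_def borel_prod[symmetric] by measurable
  have [measurable]: "T \<in> borel_measurable borel"
    using orthT by (intro linear_imp_borel_measurable) (simp add: orthogonal_transformation)
  have GT: "G (T (x, y)) = f (P x + ?Q y) * indicator {x. norm (P x) \<le> 1} y * indicator {x. norm (?Q x) \<le> 1} x" for x y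
    by (simp add: G_def T_def P.add P.diff orth_proj_idem[OF P] indicator_def)
  have [measurable]: "(\<lambda>z. \<integral>\<^sup>+ y. f (z + (y - P y)) * indicator {x. norm (P x) \<le> 1} y \<partial>lborel) \<in> borel_measurable borel"
    by measurable
  have "(\<integral>\<^sup>+y. \<integral>\<^sup>+z. f (y + z) \<partial>sub_measure ?Q \<partial>sub_measure P)
      = (\<integral>\<^sup>+y. \<integral>\<^sup>+z. f (y + (z - P z)) * indicator {x. norm (P x) \<le> 1} z \<partial>lborel \<partial>sub_measure P)"
    by (intro nn_integral_cong) (simp add: nn_integral_sub_measure[OF Q])
  also have "\<dots> = (\<integral>\<^sup>+x. (\<integral>\<^sup>+y. f (P x + ?Q y) * indicator {x. norm (P x) \<le> 1} y \<partial>lborel) * indicator {x. norm (?Q x) \<le> 1} x \<partial>lborel)"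
    by (subst nn_integral_sub_measure[OF P]) simp_all
  also have "\<dots> = (\<integral>\<^sup>+x. (\<integral>\<^sup>+y. G (T (x, y)) \<partial>lborel) \<partial>lborel)"
    unfolding GT by (rule nn_integral_cong, rule nn_integral_multc[symmetric]) measurable
  also have "\<dots> = (\<integral>\<^sup>+z. G (T z) \<partial>(lborel \<Otimes>\<^sub>M lborel))"
    by (rule lborel.nn_integral_fst) (measurable, simp add: borel_prod lborel_prod)
  also have "\<dots> = (\<integral>\<^sup>+z. G z \<partial>lborel)"
    unfolding lborel_prod by (rule nn_integral_lborel_orthogonal[OF orthT]) measurable
  also have "\<dots> = (\<integral>\<^sup>+x. (\<integral>\<^sup>+y. G (x, y) \<partial>lborel) \<partial>lborel)"
    unfolding lborel_prod[symmetric] by (rule lborel.nn_integral_fst[symmetric])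
      (simp add: lborel_prod)
  also have "\<dots> = (\<integral>\<^sup>+x. f x * fubini_const P \<partial>lborel)"
    unfolding G_def fubini_const_def by (intro nn_integral_cong) (simp add: nn_integral_cmult)
  also have "\<dots> = fubini_const P * (\<integral>\<^sup>+x. f x \<partial>lborel)"
    by (subst nn_integral_multc) (simp_all add: mult.commute)
  finally show ?thesis .
qed

section \<open>Generalized polar coordinates\<close>

lemma nn_integral_power_real:
  assumes "0 \<le> a" "p > 0"
  shows "(\<integral>\<^sup>+s. ennreal (p * s powr (p - 1)) * indicator {0<..a} s \<partial>lborel) = ennreal (a powr p)"
proof -
  have "(\<integral>\<^sup>+s. ennreal (p * s powr (p - 1)) * indicator {0<..a} s \<partial>lborel)
      = (\<integral>\<^sup>+s. ennreal (p * s powr (p - 1) * indicator {0..a} s) \<partial>lborel)"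
    by (rule nn_integral_cong) (auto simp: indicator_def)
  also have "\<dots> = ennreal (a powr p)"
  proof -
  have "((\<lambda>s. p * s powr (p - 1)) has_integral (a powr p - 0 powr p)) {0..a}"
  proof (rule fundamental_theorem_of_calculus_interior)
    show "continuous_on {0..a} (\<lambda>s. s powr p)"
      using assms by (intro continuous_on_powr' continuous_intros) auto
    show "((\<lambda>s. s powr p) has_vector_derivative p * s powr (p - 1)) (at s)" if "s \<in> {0<..<a}" for s
      using that unfolding has_real_derivative_iff_has_vector_derivative[symmetric]
      by (auto intro!: derivative_eq_intros)
  qed (use assms in auto)
  then have "((\<lambda>s. p * s powr (p - 1) * indicator {0..a} s) has_integral (a powr p)) UNIV"
    using assms by (subst (asm) has_integral_restrict_UNIV[symmetric])
      (simp add: indicator_def of_bool_def if_distrib cong: if_cong)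
  then show ?thesis
    by (intro nn_integral_has_integral_lborel) (use assms in auto)
  qed
  finally show ?thesis .
qed

lemma nn_integral_inverse_power_real:
  assumes "0 < a" "k > 0"
  shows "(\<integral>\<^sup>+s. ennreal (real k / s ^ (k + 1)) * indicator {a..} s \<partial>lborel) = ennreal (1 / a ^ k)"
proof -
  have "(\<integral>\<^sup>+s. ennreal (real k / s ^ (k + 1)) * indicator {a..} s \<partial>lborel) = ennreal (0 - (- (1 / a ^ k)))"
  proof (rule nn_integral_FTC_atLeast[where F="\<lambda>s. - (1 / s ^ k)"])
    show "DERIV (\<lambda>s. - (1 / s ^ k)) s :> real k / s ^ (k + 1)" if "a \<le> s" for s
      using that assms
      by (auto intro!: derivative_eq_intros simp: field_simps power_add[symmetric] power2_eq_square)
         (cases k, auto)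
    have "((\<lambda>s::real. 1 / s ^ k) \<longlongrightarrow> 0) at_top"
      using assms by (intro tendsto_divide_0[OF tendsto_const] filterlim_at_top_imp_at_infinity filterlim_pow_at_top filterlim_ident)
    then show "((\<lambda>s::real. - (1 / s ^ k)) \<longlongrightarrow> 0) at_top"
      using tendsto_minus by fastforce
  qed (use assms in auto)
  then show ?thesis by simp
qed

text \<open>Both sides of the polar formula are the integral over \<^term>\<open>x\<close> and a dilation factor
  \<^term>\<open>s\<close>; only the scaling behaviour of \<^term>\<open>M\<close> and the homogeneity of \<^term>\<open>N\<close> are needed.\<close>

lemma nn_integral_polar:
  fixes M :: "'a::euclidean_space measure" and N :: "'a \<Rightarrow> real" and F :: "'a \<times> real \<Rightarrow> ennreal"
  assumes sf: "sigma_finite_measure M" and sets: "sets M = sets borel" and k: "k > 0"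
    and scale: "\<And>f s. f \<in> borel_measurable borel \<Longrightarrow> s > 0 \<Longrightarrow>
      (\<integral>\<^sup>+x. f (s *\<^sub>R x) \<partial>M) = ennreal (1 / s ^ k) * (\<integral>\<^sup>+x. f x \<partial>M)"
    and N[measurable]: "N \<in> borel_measurable borel" and hom: "\<And>s x. s > 0 \<Longrightarrow> N (s *\<^sub>R x) = s * N x"
    and pos: "AE x in M. N x > 0"
    and F[measurable]: "F \<in> borel_measurable (borel \<Otimes>\<^sub>M borel)"
  shows "(\<integral>\<^sup>+x. F (x /\<^sub>R N x, N x) \<partial>M)
    = (\<integral>\<^sup>+x. indicator {x. N x \<le> 1} x *
        (\<integral>\<^sup>+r. indicator {0<..} r * ennreal (real k * r ^ (k - 1)) * F (x /\<^sub>R N x, r) \<partial>lborel) \<partial>M)"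
proof -
  interpret M: sigma_finite_measure M by fact
  interpret pair_sigma_finite lborel M ..
  note [measurable_cong] = sets
  define w where "w = (\<lambda>s. ennreal (real k * s ^ (k - 1)) * indicator {0<..} s)"
  have [measurable]: "w \<in> borel_measurable borel" unfolding w_def by measurable
  \<comment> \<open>After the substitution r = \<open>N x * s\<close> the integrand of the right
    side at \<open>x\<close> is, up to a power of \<open>s\<close>, the value at
    \<open>s *\<^sub>R x\<close> of a function whose arguments no longer involve \<open>s\<close>;
    the constraint \<open>N x \<le> 1\<close> turns into \<open>N x \<le> s\<close>.\<close>
  define H where "H = (\<lambda>x s. (if N x \<le> s then 1 else 0) * ennreal (N x ^ k) * F (x /\<^sub>R N x, N x))"
  have Hm: "(\<lambda>(s, x). H x s) \<in> borel_measurable (lborel \<Otimes>\<^sub>M M)"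
    unfolding H_def case_prod_beta by measurable
  have inner: "(\<integral>\<^sup>+r. indicator {0<..} r * ennreal (real k * r ^ (k - 1)) * F (x /\<^sub>R N x, r) \<partial>lborel)
      = (\<integral>\<^sup>+s. w s * (ennreal (N x ^ k) * F (x /\<^sub>R N x, N x * s)) \<partial>lborel)" if "N x > 0" for x
  proof -
    have "(\<integral>\<^sup>+r. indicator {0<..} r * ennreal (real k * r ^ (k - 1)) * F (x /\<^sub>R N x, r) \<partial>lborel)
      = ennreal \<bar>N x\<bar> * (\<integral>\<^sup>+s. indicator {0<..} (0 + N x * s) * ennreal (real k * (0 + N x * s) ^ (k - 1)) * F (x /\<^sub>R N x, 0 + N x * s) \<partial>lborel)"
      using that by (intro nn_integral_real_affine) simp_all
    also have "\<dots> = (\<integral>\<^sup>+s. ennreal \<bar>N x\<bar> * (indicator {0<..} (0 + N x * s) * ennreal (real k * (0 + N x * s) ^ (k - 1)) * F (x /\<^sub>R N x, 0 + N x * s)) \<partial>lborel)"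
      by (intro nn_integral_cmult[symmetric]) measurable
    also have "\<dots> = (\<integral>\<^sup>+s. w s * (ennreal (N x ^ k) * F (x /\<^sub>R N x, N x * s)) \<partial>lborel)"
    proof (rule nn_integral_cong)
      fix s :: real
      show "ennreal \<bar>N x\<bar> * (indicator {0<..} (0 + N x * s) * ennreal (real k * (0 + N x * s) ^ (k - 1)) * F (x /\<^sub>R N x, 0 + N x * s))
        = w s * (ennreal (N x ^ k) * F (x /\<^sub>R N x, N x * s))"
      proof (cases "s > 0")
        case True
        obtain j where j: "k = Suc j" using k by (cases k) auto
        have "N x * (real k * (N x * s) ^ (k - 1)) = (real k * s ^ (k - 1)) * N x ^ k"
          unfolding j by (simp add: power_mult_distrib)
        then have "ennreal (N x) * ennreal (real k * (N x * s) ^ (k - 1)) = ennreal (real k * s ^ (k - 1)) * ennreal (N x ^ k)"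
          using that True by (simp add: ennreal_mult[symmetric])
        then show ?thesis using that True by (simp add: w_def mult.assoc[symmetric])
      next
        case False
        then show ?thesis using that by (simp add: w_def zero_less_mult_iff)
      qed
    qed
    finally show ?thesis .
  qed
  have "(\<integral>\<^sup>+x. indicator {x. N x \<le> 1} x *
        (\<integral>\<^sup>+r. indicator {0<..} r * ennreal (real k * r ^ (k - 1)) * F (x /\<^sub>R N x, r) \<partial>lborel) \<partial>M)
      = (\<integral>\<^sup>+x. (\<integral>\<^sup>+s. indicator {x. N x \<le> 1} x * (w s * (ennreal (N x ^ k) * F (x /\<^sub>R N x, N x * s))) \<partial>lborel) \<partial>M)"
    using pos
  proof (intro nn_integral_cong_AE, elim eventually_mono)
    fix x assume "N x > 0"
    then show "indicator {x. N x \<le> 1} x * (\<integral>\<^sup>+r. indicator {0<..} r * ennreal (real k * r ^ (k - 1)) * F (x /\<^sub>R N x, r) \<partial>lborel)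
      = (\<integral>\<^sup>+s. indicator {x. N x \<le> 1} x * (w s * (ennreal (N x ^ k) * F (x /\<^sub>R N x, N x * s))) \<partial>lborel)"
      by (subst inner) (simp_all add: nn_integral_cmult)
  qed
  also have "\<dots> = (\<integral>\<^sup>+s. (\<integral>\<^sup>+x. indicator {x. N x \<le> 1} x * (w s * (ennreal (N x ^ k) * F (x /\<^sub>R N x, N x * s))) \<partial>M) \<partial>lborel)"
    by (rule Fubini') measurable
  \<comment> \<open>One factor \<open>s ^ k\<close> comes from the dilation of \<open>M\<close>, the
    other from the power of \<open>N\<close> inside \<open>H\<close>; hence the exponent
    \<open>2 * k\<close>.\<close>
  also have "\<dots> = (\<integral>\<^sup>+s. (\<integral>\<^sup>+x. w s * (ennreal (1 / s ^ (2 * k)) * H x s) \<partial>M) \<partial>lborel)"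
  proof (rule nn_integral_cong)
    fix s :: real
    show "(\<integral>\<^sup>+x. indicator {x. N x \<le> 1} x * (w s * (ennreal (N x ^ k) * F (x /\<^sub>R N x, N x * s))) \<partial>M)
      = (\<integral>\<^sup>+x. w s * (ennreal (1 / s ^ (2 * k)) * H x s) \<partial>M)"
    proof (cases "s > 0")
      case True
      have [measurable]: "(\<lambda>x. H x s) \<in> borel_measurable borel"
        unfolding H_def by measurable
      have [measurable]: "(\<lambda>x. H (s *\<^sub>R x) s) \<in> borel_measurable borel" by measurable
      have "(\<integral>\<^sup>+x. indicator {x. N x \<le> 1} x * (w s * (ennreal (N x ^ k) * F (x /\<^sub>R N x, N x * s))) \<partial>M)
         = (\<integral>\<^sup>+x. w s * (ennreal (1 / s ^ k) * H (s *\<^sub>R x) s) \<partial>M)"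
        using pos
      proof (intro nn_integral_cong_AE, elim eventually_mono)
        fix x assume "N x > 0"
        then have "ennreal (1 / s ^ k) * ennreal ((s * N x) ^ k) = ennreal (N x ^ k)"
          using True by (subst ennreal_mult[symmetric]) (auto simp: power_mult_distrib)
        then have "ennreal (1 / s ^ k) * H (s *\<^sub>R x) s = indicator {x. N x \<le> 1} x * (ennreal (N x ^ k) * F (x /\<^sub>R N x, N x * s))"
          using True \<open>N x > 0\<close> by (simp add: H_def hom indicator_def mult.assoc[symmetric] mult.commute[of s] divide_simps)
        then show "indicator {x. N x \<le> 1} x * (w s * (ennreal (N x ^ k) * F (x /\<^sub>R N x, N x * s)))
          = w s * (ennreal (1 / s ^ k) * H (s *\<^sub>R x) s)" by (simp add: ac_simps)
      qed
      also have "\<dots> = w s * (ennreal (1 / s ^ k) * (\<integral>\<^sup>+x. H (s *\<^sub>R x) s \<partial>M))"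
        by (simp add: nn_integral_cmult)
      also have "\<dots> = w s * (ennreal (1 / s ^ k) * (ennreal (1 / s ^ k) * (\<integral>\<^sup>+x. H x s \<partial>M)))"
        using True by (simp add: scale[of "\<lambda>x. H x s"])
      also have "\<dots> = w s * (ennreal (1 / s ^ (2 * k)) * (\<integral>\<^sup>+x. H x s \<partial>M))"
      proof -
        have "ennreal (1 / s ^ k) * ennreal (1 / s ^ k) = ennreal (1 / s ^ (2 * k))"
          using True by (subst ennreal_mult[symmetric]) (auto simp: mult_2 power_add)
        then show ?thesis by (simp only: mult.assoc[symmetric])
      qed
      also have "\<dots> = (\<integral>\<^sup>+x. w s * (ennreal (1 / s ^ (2 * k)) * H x s) \<partial>M)"
        by (simp add: nn_integral_cmult)
      finally show ?thesis .
    qed (simp add: w_def)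
  qed
  also have "\<dots> = (\<integral>\<^sup>+x. (\<integral>\<^sup>+s. w s * (ennreal (1 / s ^ (2 * k)) * H x s) \<partial>lborel) \<partial>M)"
    by (rule Fubini'[symmetric]) (use Hm in \<open>simp add: case_prod_beta\<close>)
  also have "\<dots> = (\<integral>\<^sup>+x. F (x /\<^sub>R N x, N x) \<partial>M)"
    using pos
  proof (intro nn_integral_cong_AE, elim eventually_mono)
    fix x assume x: "N x > 0"
    let ?c = "ennreal (N x ^ k) * F (x /\<^sub>R N x, N x)"
    have "(\<integral>\<^sup>+s. w s * (ennreal (1 / s ^ (2 * k)) * H x s) \<partial>lborel)
       = (\<integral>\<^sup>+s. (ennreal (real k / s ^ (k + 1)) * indicator {N x..} s) * ?c \<partial>lborel)"
    proof (rule nn_integral_cong)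
      fix s :: real
      show "w s * (ennreal (1 / s ^ (2 * k)) * H x s) = (ennreal (real k / s ^ (k + 1)) * indicator {N x..} s) * ?c"
      proof (cases "N x \<le> s")
        case True
        then have s: "s > 0" using x by simp
        obtain j where j: "k = Suc j" using k by (cases k) auto
        have "real k * s ^ (k - 1) * (1 / s ^ (2 * k)) = real k / s ^ (k + 1)"
          using s unfolding j by (simp add: field_simps power_add mult_2 mult_2_right)
        then have "ennreal (real k * s ^ (k - 1)) * ennreal (1 / s ^ (2 * k)) = ennreal (real k / s ^ (k + 1))"
          using s by (subst ennreal_mult[symmetric]) auto
        then show ?thesis using s True by (simp add: w_def H_def mult.assoc[symmetric])
      qed (simp add: H_def)
    qed
    also have "\<dots> = ennreal (1 / N x ^ k) * ?c"
      using nn_integral_inverse_power_real[OF x k] by (subst nn_integral_multc) auto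
    also have "\<dots> = F (x /\<^sub>R N x, N x)"
    proof -
      have "ennreal (1 / N x ^ k) * ennreal (N x ^ k) = 1"
        using x by (subst ennreal_mult[symmetric]) auto
      then show ?thesis by (simp add: mult.assoc[symmetric])
    qed
    finally show "(\<integral>\<^sup>+s. w s * (ennreal (1 / s ^ (2 * k)) * H x s) \<partial>lborel) = F (x /\<^sub>R N x, N x)" .
  qed
  finally show ?thesis by simp
qed

section \<open>The Prekopa--Leindler inequality at midpoints\<close>

text \<open>With \<open>p\<close> the maximum of \<open>A\<close> and \<open>q\<close> the minimum
  of \<open>B\<close>, the translates of \<open>A\<close> by \<open>q\<close> and of
  \<open>B\<close> by \<open>p\<close> share at most the point \<open>p + q\<close>, and both lie in
  the doubled \<open>C\<close>, which contains every sum of a point of \<open>A\<close> and a point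
  of \<open>B\<close>.\<close>

lemma emeasure_half_sum_compact:
  fixes A B C :: "real set"
  assumes A: "compact A" "A \<noteq> {}" and B: "compact B" "B \<noteq> {}" and C: "C \<in> sets borel"
    and AB: "\<And>a b. a \<in> A \<Longrightarrow> b \<in> B \<Longrightarrow> (a + b) / 2 \<in> C"
  shows "emeasure lborel A + emeasure lborel B \<le> 2 * emeasure lborel C"
proof -
  obtain p where p: "p \<in> A" "\<And>a. a \<in> A \<Longrightarrow> a \<le> p" using compact_attains_sup[OF A] by blast
  obtain q where q: "q \<in> B" "\<And>b. b \<in> B \<Longrightarrow> q \<le> b" using compact_attains_inf[OF B] by blast
  have [measurable]: "A \<in> sets borel" "B \<in> sets borel" "C \<in> sets borel"
    using A(1) B(1) C borel_compact by auto
  let ?A = "(\<lambda>x. x + (- q)) -` A" and ?B = "(\<lambda>x. x + (- p)) -` B" and ?C = "(\<lambda>x. (1/2) *\<^sub>R x) -` C"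
  have A'[measurable]: "?A \<in> sets borel" using measurable_sets[of "\<lambda>x. x + (- q)" borel borel A] by simp
  have B'[measurable]: "?B \<in> sets borel" using measurable_sets[of "\<lambda>x. x + (- p)" borel borel B] by simp
  have C'[measurable]: "?C \<in> sets borel" using measurable_sets[of "\<lambda>x. (1/2) *\<^sub>R x" borel borel C] by simp
  have eA: "emeasure lborel ?A = emeasure lborel A"
  proof -
    have "(\<integral>\<^sup>+x. indicator A (x + (- q)) \<partial>lborel) = (\<integral>\<^sup>+x. indicator ?A x \<partial>lborel)"
      by (rule nn_integral_cong) (simp add: indicator_def)
    also have "\<dots> = emeasure lborel ?A" by (rule nn_integral_indicator) (use A' in simp)
    finally have "emeasure lborel ?A = (\<integral>\<^sup>+x. indicator A (x + (- q)) \<partial>lborel)" by simp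
    then show ?thesis using nn_integral_lborel_translate[of "indicator A" "- q"] by simp
  qed
  have eB: "emeasure lborel ?B = emeasure lborel B"
  proof -
    have "(\<integral>\<^sup>+x. indicator B (x + (- p)) \<partial>lborel) = (\<integral>\<^sup>+x. indicator ?B x \<partial>lborel)"
      by (rule nn_integral_cong) (simp add: indicator_def)
    also have "\<dots> = emeasure lborel ?B" by (rule nn_integral_indicator) (use B' in simp)
    finally have "emeasure lborel ?B = (\<integral>\<^sup>+x. indicator B (x + (- p)) \<partial>lborel)" by simp
    then show ?thesis using nn_integral_lborel_translate[of "indicator B" "- p"] by simp
  qed
  have eC: "emeasure lborel ?C = 2 * emeasure lborel C"
  proof -
    have "(\<integral>\<^sup>+x. indicator C ((1/2) *\<^sub>R x) \<partial>lborel) = (\<integral>\<^sup>+x. indicator ?C x \<partial>lborel)"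
      by (rule nn_integral_cong) (simp add: indicator_def)
    also have "\<dots> = emeasure lborel ?C" by (rule nn_integral_indicator) (use C' in simp)
    finally have "emeasure lborel ?C = (\<integral>\<^sup>+x. indicator C ((1/2) *\<^sub>R x) \<partial>lborel)" by simp
    then show ?thesis using nn_integral_lborel_scale[of "indicator C :: real \<Rightarrow> ennreal" "1/2"] by simp
  qed
  have "emeasure lborel A + emeasure lborel B = emeasure lborel (?A - {p + q}) + emeasure lborel ?B"
    using emeasure_Diff_null_set[of "{p + q}" lborel ?A] A' eA eB by (simp add: null_sets_def)
  also have "\<dots> = emeasure lborel ((?A - {p + q}) \<union> ?B)"
  proof (rule plus_emeasure)
    show "(?A - {p + q}) \<inter> ?B = {}"
    proof -
      have "x = p + q" if "x \<in> ?A" "x \<in> ?B" for x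
        using that p(2)[of "x + - q"] q(2)[of "x + - p"] by simp
      then show ?thesis by blast
    qed
  qed (use A' B' in auto)
  also have "\<dots> \<le> emeasure lborel ?C"
  proof (rule emeasure_mono)
    show "(?A - {p + q}) \<union> ?B \<subseteq> ?C"
    proof
      fix x assume "x \<in> (?A - {p + q}) \<union> ?B"
      then consider "x + - q \<in> A" | "x + - p \<in> B" by auto
      then show "x \<in> ?C"
      proof cases
        case 1
        from AB[OF this q(1)] show ?thesis by (simp add: field_simps)
      next
        case 2
        from AB[OF p(1) this] show ?thesis by (simp add: field_simps)
      qed
    qed
  qed (use C' in simp)
  finally show ?thesis by (simp only: eC)
qed

lemma emeasure_half_sum_bounded:
  fixes A B C :: "real set"
  assumes A: "bounded A" "A \<noteq> {}" "A \<in> sets borel" and B: "bounded B" "B \<noteq> {}" "B \<in> sets borel"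
    and C: "C \<in> sets borel" and AB: "\<And>a b. a \<in> A \<Longrightarrow> b \<in> B \<Longrightarrow> (a + b) / 2 \<in> C"
  shows "emeasure lborel A + emeasure lborel B \<le> 2 * emeasure lborel C"
proof (rule ennreal_le_epsilon)
  fix e :: real assume e: "e > 0"
  have approx: "\<exists>K. compact K \<and> K \<noteq> {} \<and> K \<subseteq> A \<and> emeasure lborel A \<le> emeasure lborel K + ennreal (e / 2)"
    if A: "bounded A" "A \<noteq> {}" "A \<in> sets borel" for A :: "real set"
  proof -
    have "A \<in> lmeasurable" using A(1,3) by (intro bounded_set_imp_lmeasurable) auto
    then obtain K where K: "closed K" "K \<subseteq> A" "A - K \<in> lmeasurable" "emeasure lebesgue (A - K) < ennreal (e / 2)"
      using sets_lebesgue_inner_closed[of A "e/2"] e by (auto simp: fmeasurable_def)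
    have "compact K" using K(1,2) A(1) bounded_subset compact_eq_bounded_closed by blast
    note K = \<open>compact K\<close> K(2-)
    obtain a where a: "a \<in> A" using A(2) by blast
    \<comment> \<open>The compact set from inner regularity may be empty; adding a point of
      \<open>A\<close> makes the compact case applicable and does not spoil the bound.\<close>
    let ?K = "insert a K"
    have [measurable]: "K \<in> sets borel" using K(1) by (rule borel_compact)
    have "emeasure lborel A = emeasure lborel (?K \<union> (A - ?K))" using a K(2) by (simp add: Un_absorb1 insert_absorb Un_absorb2)
    also have "\<dots> \<le> emeasure lborel ?K + emeasure lborel (A - ?K)"
      using A(3) by (intro emeasure_subadditive) auto
    also have "emeasure lborel (A - ?K) \<le> emeasure lebesgue (A - K)"
    proof -
      have "A - ?K \<in> sets borel" using A(3) by auto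
      then have "emeasure lborel (A - ?K) = emeasure lebesgue (A - ?K)" by simp
      also have "\<dots> \<le> emeasure lebesgue (A - K)" using K(3) by (intro emeasure_mono) auto
      finally show ?thesis .
    qed
    also have "\<dots> \<le> ennreal (e / 2)"
      using K(4) by simp
    finally have "emeasure lborel A \<le> emeasure lborel ?K + ennreal (e / 2)" by (simp add: add_left_mono)
    moreover have "compact ?K" "?K \<noteq> {}" "?K \<subseteq> A" using K a by auto
    ultimately show ?thesis by blast
  qed
  obtain K where K: "compact K" "K \<noteq> {}" "K \<subseteq> A" "emeasure lborel A \<le> emeasure lborel K + ennreal (e / 2)"
    using approx[OF A] by blast
  obtain J where J: "compact J" "J \<noteq> {}" "J \<subseteq> B" "emeasure lborel B \<le> emeasure lborel J + ennreal (e / 2)"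
    using approx[OF B] by blast
  have "emeasure lborel A + emeasure lborel B
      \<le> (emeasure lborel K + ennreal (e / 2)) + (emeasure lborel J + ennreal (e / 2))"
    using K(4) J(4) by (rule add_mono)
  also have "\<dots> = (emeasure lborel K + emeasure lborel J) + (ennreal (e / 2) + ennreal (e / 2))" by (simp add: ac_simps)
  also have "ennreal (e / 2) + ennreal (e / 2) = ennreal e" using e by (simp flip: ennreal_plus)
  also have "emeasure lborel K + emeasure lborel J \<le> 2 * emeasure lborel C"
    using K J AB by (intro emeasure_half_sum_compact C) auto
  finally show "emeasure lborel A + emeasure lborel B \<le> 2 * emeasure lborel C + ennreal e"
    by (simp add: add_right_mono)
qed

lemma emeasure_half_sum:
  fixes A B C :: "real set"
  assumes A: "A \<noteq> {}" "A \<in> sets borel" and B: "B \<noteq> {}" "B \<in> sets borel"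
    and C: "C \<in> sets borel" and AB: "\<And>a b. a \<in> A \<Longrightarrow> b \<in> B \<Longrightarrow> (a + b) / 2 \<in> C"
  shows "emeasure lborel A + emeasure lborel B \<le> 2 * emeasure lborel C"
proof -
  obtain a b where ab: "a \<in> A" "b \<in> B" using A(1) B(1) by blast
  \<comment> \<open>The radius starts large enough to keep \<open>a\<close> and \<open>b\<close>, so
    all truncations are nonempty.\<close>
  define r where "r n = max \<bar>a\<bar> \<bar>b\<bar> + real n" for n
  have lim: "(\<lambda>n. emeasure lborel (A \<inter> cball 0 (r n))) \<longlonglongrightarrow> emeasure lborel A" if "A \<in> sets borel" for A :: "real set"
  proof -
    have "(\<lambda>n. emeasure lborel (A \<inter> cball 0 (r n))) \<longlonglongrightarrow> emeasure lborel (\<Union>n. A \<inter> cball 0 (r n))"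
      using that by (intro Lim_emeasure_incseq) (auto simp: incseq_def r_def)
    also have "(\<Union>n. A \<inter> cball 0 (r n)) = A"
    proof safe
      fix x assume "x \<in> A"
      obtain n where "\<bar>x\<bar> \<le> real n" using real_arch_simple by blast
      then have "x \<in> cball 0 (r n)" by (simp add: r_def)
      with \<open>x \<in> A\<close> show "x \<in> (\<Union>n. A \<inter> cball 0 (r n))" by blast
    qed
    finally show ?thesis .
  qed
  have "emeasure lborel (A \<inter> cball 0 (r n)) + emeasure lborel (B \<inter> cball 0 (r n)) \<le> 2 * emeasure lborel C" for n
  proof (rule emeasure_half_sum_bounded)
    have "a \<in> cball 0 (r n)" "b \<in> cball 0 (r n)" by (auto simp: r_def)
    then show "A \<inter> cball 0 (r n) \<noteq> {}" "B \<inter> cball 0 (r n) \<noteq> {}" using ab by blast+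
  qed (use A(2) B(2) C AB in auto)
  then show ?thesis
    by (intro LIMSEQ_le_const2[OF tendsto_add[OF lim[OF A(2)] lim[OF B(2)]]]) auto
qed

lemma nn_integral_layer_cake:
  assumes "sigma_finite_measure M" and f[measurable]: "f \<in> borel_measurable M"
  shows "(\<integral>\<^sup>+x. f x \<partial>M) = (\<integral>\<^sup>+t. indicator {0..} t * emeasure M {x\<in>space M. ennreal t < f x} \<partial>lborel)"
proof -
  interpret M: sigma_finite_measure M by fact
  interpret pair_sigma_finite M lborel ..
  have slice: "(\<integral>\<^sup>+t. indicator {0..} t * (if ennreal t < y then 1 else 0) \<partial>lborel) = y" for y :: ennreal
  proof (cases y)
    case (real r)
    have "(\<integral>\<^sup>+t. indicator {0..} t * (if ennreal t < y then 1 else 0) \<partial>lborel) = (\<integral>\<^sup>+t. indicator {0..<r} t \<partial>lborel)"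
      using real by (intro nn_integral_cong) (auto simp: indicator_def ennreal_less_iff)
    then show ?thesis using real by simp
  next
    case top
    have "(\<integral>\<^sup>+t. indicator {0..} t * (if ennreal t < y then 1 else 0) \<partial>lborel) = (\<integral>\<^sup>+t. indicator {0::real..} t \<partial>lborel)"
      using top by (intro nn_integral_cong) (auto simp: indicator_def)
    also have "\<dots> = \<infinity>"
    proof -
      have "ennreal (real n) \<le> emeasure lborel {0::real..}" for n
        using emeasure_mono[of "{0..real n}" "{0..}" lborel] by auto
      then have "of_nat n \<le> emeasure lborel {0::real..}" for n
        by (simp add: ennreal_of_nat_eq_real_of_nat)
      then have "\<not> emeasure lborel {0::real..} < top" using ennreal_Ex_less_of_nat leD by blast
      then have "emeasure lborel {0::real..} = \<infinity>" by (metis infinity_ennreal_def top.not_eq_extremum)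
      then show ?thesis by simp
    qed
    finally show ?thesis using top by simp
  qed
  have "(\<integral>\<^sup>+x. f x \<partial>M) = (\<integral>\<^sup>+x. (\<integral>\<^sup>+t. indicator {0..} t * (if ennreal t < f x then 1 else 0) \<partial>lborel) \<partial>M)"
    by (simp add: slice)
  also have "\<dots> = (\<integral>\<^sup>+t. (\<integral>\<^sup>+x. indicator {0..} t * (if ennreal t < f x then 1 else 0) \<partial>M) \<partial>lborel)"
    by (rule Fubini'[symmetric]) measurable
  also have "\<dots> = (\<integral>\<^sup>+t. indicator {0..} t * emeasure M {x\<in>space M. ennreal t < f x} \<partial>lborel)"
  proof (rule nn_integral_cong)
    fix t :: real
    have "(\<integral>\<^sup>+x. (if ennreal t < f x then 1 else 0) \<partial>M) = (\<integral>\<^sup>+x. indicator {x\<in>space M. ennreal t < f x} x \<partial>M)"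
      by (intro nn_integral_cong) (auto simp: indicator_def)
    then show "(\<integral>\<^sup>+x. indicator {0..} t * (if ennreal t < f x then 1 else 0) \<partial>M) = indicator {0..} t * emeasure M {x\<in>space M. ennreal t < f x}"
      by (subst nn_integral_cmult) (simp_all)
  qed
  finally show ?thesis .
qed

text \<open>For t < 1 the superlevel sets of f and g at t are nonempty and their half sums lie in
  the superlevel set of h, because h^2 exceeds t^2 there. The one-dimensional Brunn--Minkowski bound
  is then integrated over t. Normalizing both suprema to 1 excludes levels at which only one of the
  two sets is empty.\<close>

lemma prekopa_leindler_real_normalized:
  fixes f g h :: "real \<Rightarrow> ennreal"
  assumes [measurable]: "f \<in> borel_measurable borel" "g \<in> borel_measurable borel" "h \<in> borel_measurable borel"
    and f1: "\<And>x. f x \<le> 1" and g1: "\<And>x. g x \<le> 1"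
    and fs: "\<And>t. t < 1 \<Longrightarrow> \<exists>x. t < f x" and gs: "\<And>t. t < 1 \<Longrightarrow> \<exists>x. t < g x"
    and le: "\<And>x y. f x * g y \<le> (h ((x + y) / 2))\<^sup>2"
  shows "(\<integral>\<^sup>+x. f x \<partial>lborel) + (\<integral>\<^sup>+x. g x \<partial>lborel) \<le> 2 * (\<integral>\<^sup>+x. h x \<partial>lborel)"
proof -
  note lc = nn_integral_layer_cake[OF sigma_finite_lborel]
  have "(\<integral>\<^sup>+x. f x \<partial>lborel) + (\<integral>\<^sup>+x. g x \<partial>lborel)
      = (\<integral>\<^sup>+t. indicator {0..} t * emeasure lborel {x\<in>space lborel. ennreal t < f x}
          + indicator {0..} t * emeasure lborel {x\<in>space lborel. ennreal t < g x} \<partial>lborel)"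
    by (subst lc, simp, subst lc, simp, rule nn_integral_add[symmetric]) measurable
  also have "\<dots> \<le> (\<integral>\<^sup>+t. 2 * (indicator {0..} t * emeasure lborel {x\<in>space lborel. ennreal t < h x}) \<partial>lborel)"
  proof (rule nn_integral_mono)
    fix t :: real
    show "indicator {0..} t * emeasure lborel {x\<in>space lborel. ennreal t < f x}
          + indicator {0..} t * emeasure lborel {x\<in>space lborel. ennreal t < g x}
      \<le> 2 * (indicator {0..} t * emeasure lborel {x\<in>space lborel. ennreal t < h x})"
    proof (cases "0 \<le> t \<and> t < 1")
      case True
      have "emeasure lborel {x\<in>space lborel. ennreal t < f x} + emeasure lborel {x\<in>space lborel. ennreal t < g x}
        \<le> 2 * emeasure lborel {x\<in>space lborel. ennreal t < h x}"
      proof (rule emeasure_half_sum)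
        have "ennreal t < 1" using True by (simp add: ennreal_less_one_iff)
        then show "{x\<in>space lborel. ennreal t < f x} \<noteq> {}" "{x\<in>space lborel. ennreal t < g x} \<noteq> {}"
          using fs gs by auto
        fix a b assume "a \<in> {x\<in>space lborel. ennreal t < f x}" "b \<in> {x\<in>space lborel. ennreal t < g x}"
        then have ab: "ennreal t < f a" "ennreal t < g b" by auto
        have "ennreal t * ennreal t < f a * g b"
        proof (cases "t = 0")
          case True
          then show ?thesis using ab by (simp add: ennreal_zero_less_mult_iff)
        next
          case False
          then have "ennreal t * ennreal t < ennreal t * g b"
            using ab \<open>0 \<le> t \<and> t < 1\<close> by (intro ennreal_mult_strict_left_mono) auto
          also have "\<dots> \<le> f a * g b" using ab by (intro mult_right_mono) auto
          finally show ?thesis .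
        qed
        also have "\<dots> \<le> (h ((a + b) / 2))\<^sup>2" by (rule le)
        finally have "ennreal t < h ((a + b) / 2)"
          by (metis mult_mono not_le power2_eq_square zero_le)
        then show "(a + b) / 2 \<in> {x\<in>space lborel. ennreal t < h x}" by simp
      qed measurable
      then show ?thesis using True by simp
    next
      case False
      have "\<not> ennreal t < f x" "\<not> ennreal t < g x" if "t \<ge> 1" for x
        using f1[of x] g1[of x] that by (auto simp: not_less intro: order.trans)
      then show ?thesis using False by (cases "t \<ge> 0") auto
    qed
  qed
  also have "\<dots> = 2 * (\<integral>\<^sup>+x. h x \<partial>lborel)"
    by (subst nn_integral_cmult) (measurable, subst lc[of h], auto)
  finally show ?thesis .
qed

lemma ennreal_am_gm:
  fixes x y z :: ennreal
  assumes "x + y \<le> 2 * z" shows "x * y \<le> z\<^sup>2"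
proof (cases z)
  case (real c)
  have "x + y \<le> ennreal (2 * c)" using assms real by (simp add: ennreal_mult)
  then have "x < \<infinity>" "y < \<infinity>"
    by (auto simp: less_top[symmetric] top_unique)
  then obtain a b where ab: "x = ennreal a" "a \<ge> 0" "y = ennreal b" "b \<ge> 0"
    by (cases x; cases y) auto
  have "a + b \<le> 2 * c" using assms ab real by (simp add: ennreal_mult[symmetric] ennreal_plus[symmetric] del: ennreal_plus flip: ennreal_numeral)
  have "a * b \<le> ((a + b) / 2)\<^sup>2"
    using zero_le_power2[of "a - b"] by (simp add: power2_eq_square field_simps)
  also have "\<dots> \<le> c\<^sup>2" using \<open>a + b \<le> 2 * c\<close> ab by (intro power_mono) auto
  finally show ?thesis using ab real by (simp add: ennreal_mult[symmetric] ennreal_power)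
qed simp

text \<open>Dividing f and g by their suprema a and b, and h by sqrt(a b), preserves the hypothesis
  and leads to the normalized case. Its additive conclusion implies the product form by the
  arithmetic-geometric mean inequality, and the product form is homogeneous, so the scaling can be
  undone.\<close>

lemma prekopa_leindler_real_bounded:
  fixes f g h :: "real \<Rightarrow> ennreal"
  assumes [measurable]: "f \<in> borel_measurable borel" "g \<in> borel_measurable borel" "h \<in> borel_measurable borel"
    and f1: "\<And>x. f x \<le> ennreal c" and g1: "\<And>x. g x \<le> ennreal c"
    and le: "\<And>x y. f x * g y \<le> (h ((x + y) / 2))\<^sup>2"
  shows "(\<integral>\<^sup>+x. f x \<partial>lborel) * (\<integral>\<^sup>+x. g x \<partial>lborel) \<le> (\<integral>\<^sup>+x. h x \<partial>lborel)\<^sup>2"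
proof -
  have "(SUP x. f x) \<le> ennreal c" "(SUP x. g x) \<le> ennreal c" using f1 g1 by (auto intro: SUP_least)
  then obtain a b where a: "(SUP x. f x) = ennreal a" "a \<ge> 0" and b: "(SUP x. g x) = ennreal b" "b \<ge> 0"
    by (cases "SUP x. f x"; cases "SUP x. g x") (auto simp: top_unique)
  have fa: "f x \<le> ennreal a" and gb: "g x \<le> ennreal b" for x
    using a(1) b(1) SUP_upper[of x UNIV f] SUP_upper[of x UNIV g] by auto
  show ?thesis
  proof (cases "a = 0 \<or> b = 0")
    case True
    then have "(\<forall>x. f x = 0) \<or> (\<forall>x. g x = 0)" using fa gb by auto
    then show ?thesis by auto
  next
    case False
    then have ab: "a > 0" "b > 0" using a b by auto
    define c where "c = sqrt (a * b)"
    have c: "c > 0" "c\<^sup>2 = a * b" using ab by (auto simp: c_def)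
    let ?f = "\<lambda>x. ennreal (1 / a) * f x" and ?g = "\<lambda>x. ennreal (1 / b) * g x" and ?h = "\<lambda>x. ennreal (1 / c) * h x"
    have one: "ennreal (1 / s) * ennreal s = 1" "ennreal s * ennreal (1 / s) = 1" if "s > 0" for s
      using that by (simp_all add: ennreal_mult[symmetric])
    have sup: "\<exists>x. t < ennreal (1 / s) * F x" if "t < 1" "s > 0" "(SUP x. F x) = ennreal s" for t s and F :: "real \<Rightarrow> ennreal"
    proof -
      have "ennreal s * t < ennreal s * 1"
        using that by (intro ennreal_mult_strict_left_mono) auto
      then have "ennreal s * t < (SUP x. F x)" using that by simp
      then obtain x where "ennreal s * t < F x" by (auto simp: less_SUP_iff)
      then have "ennreal (1 / s) * (ennreal s * t) < ennreal (1 / s) * F x"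
        using that by (intro ennreal_mult_strict_left_mono) auto
      then show ?thesis using one that by (auto simp: mult.assoc[symmetric])
    qed
    have "(\<integral>\<^sup>+x. ?f x \<partial>lborel) + (\<integral>\<^sup>+x. ?g x \<partial>lborel) \<le> 2 * (\<integral>\<^sup>+x. ?h x \<partial>lborel)"
    proof (rule prekopa_leindler_real_normalized)
      show "?f x \<le> 1" "?g x \<le> 1" for x
        using mult_left_mono[OF fa, of "ennreal (1/a)"] mult_left_mono[OF gb, of "ennreal (1/b)"] one ab by auto
      show "?f x * ?g y \<le> (?h ((x + y) / 2))\<^sup>2" for x y
      proof -
        have "ennreal (1 / a) * ennreal (1 / b) = (ennreal (1 / c))\<^sup>2"
          using ab c by (simp add: ennreal_mult[symmetric] ennreal_power power_divide)
        moreover have "?f x * ?g y = (ennreal (1 / a) * ennreal (1 / b)) * (f x * g y)" by (simp add: ac_simps)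
        ultimately show ?thesis using mult_left_mono[OF le[of x y]] by (simp add: power_mult_distrib)
      qed
    qed (use sup ab a b in auto)
    then have "(\<integral>\<^sup>+x. ?f x \<partial>lborel) * (\<integral>\<^sup>+x. ?g x \<partial>lborel) \<le> (\<integral>\<^sup>+x. ?h x \<partial>lborel)\<^sup>2"
      by (rule ennreal_am_gm)
    then have "ennreal (1 / a) * (\<integral>\<^sup>+x. f x \<partial>lborel) * (ennreal (1 / b) * (\<integral>\<^sup>+x. g x \<partial>lborel)) \<le> (ennreal (1 / c) * (\<integral>\<^sup>+x. h x \<partial>lborel))\<^sup>2"
      by (simp add: nn_integral_cmult)
    then have "(ennreal a * ennreal b) * (ennreal (1 / a) * (\<integral>\<^sup>+x. f x \<partial>lborel) * (ennreal (1 / b) * (\<integral>\<^sup>+x. g x \<partial>lborel)))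
       \<le> (ennreal c)\<^sup>2 * (ennreal (1 / c) * (\<integral>\<^sup>+x. h x \<partial>lborel))\<^sup>2"
      using c ab by (simp add: ennreal_power mult_left_mono ennreal_mult[symmetric])
    also have "(ennreal c)\<^sup>2 * (ennreal (1 / c) * (\<integral>\<^sup>+x. h x \<partial>lborel))\<^sup>2 = (\<integral>\<^sup>+x. h x \<partial>lborel)\<^sup>2"
      using one(2)[OF c(1)] by (simp add: power_mult_distrib[symmetric] mult.assoc[symmetric])
    also have "(ennreal a * ennreal b) * (ennreal (1 / a) * (\<integral>\<^sup>+x. f x \<partial>lborel) * (ennreal (1 / b) * (\<integral>\<^sup>+x. g x \<partial>lborel)))
      = (ennreal a * ennreal (1 / a)) * (ennreal b * ennreal (1 / b)) * ((\<integral>\<^sup>+x. f x \<partial>lborel) * (\<integral>\<^sup>+x. g x \<partial>lborel))"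
      by (simp only: ac_simps)
    finally show ?thesis using one(2)[OF ab(1)] one(2)[OF ab(2)] by simp
  qed
qed

lemma nn_integral_min_SUP:
  assumes [measurable]: "f \<in> borel_measurable M"
  shows "(\<integral>\<^sup>+x. f x \<partial>M) = (SUP k::nat. \<integral>\<^sup>+x. min (f x) (ennreal (real k)) \<partial>M)"
proof -
  have "(SUP k::nat. min y (ennreal (real k))) = y" for y :: ennreal
  proof (rule antisym)
    show "(SUP k::nat. min y (ennreal (real k))) \<le> y" by (rule SUP_least) simp
    show "y \<le> (SUP k::nat. min y (ennreal (real k)))"
    proof (rule ccontr)
      assume "\<not> ?thesis"
      then have lt: "(SUP k::nat. min y (ennreal (real k))) < y" by simp
      then obtain n where n: "(SUP k::nat. min y (ennreal (real k))) < of_nat n"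
        using ennreal_Ex_less_of_nat[OF less_le_trans[OF lt top_greatest]] by blast
      have "min y (ennreal (real n)) \<le> (SUP k::nat. min y (ennreal (real k)))" by (rule SUP_upper) simp
      with n lt show False by (auto simp: min_def ennreal_of_nat_eq_real_of_nat split: if_splits)
    qed
  qed
  then have "(\<integral>\<^sup>+x. f x \<partial>M) = (\<integral>\<^sup>+x. (SUP k::nat. min (f x) (ennreal (real k))) \<partial>M)" by simp
  also have "\<dots> = (SUP k::nat. \<integral>\<^sup>+x. min (f x) (ennreal (real k)) \<partial>M)"
    by (rule nn_integral_monotone_convergence_SUP) (auto simp: incseq_def le_fun_def min_le_iff_disj intro!: min.mono ennreal_leI)
  finally show ?thesis .
qed

text \<open>Truncating f and g only lowers the left side of the hypothesis. Separate levels k and l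
  let monotone convergence act on one factor at a time.\<close>

lemma prekopa_leindler_real:
  fixes f g h :: "real \<Rightarrow> ennreal"
  assumes [measurable]: "f \<in> borel_measurable borel" "g \<in> borel_measurable borel" "h \<in> borel_measurable borel"
    and le: "\<And>x y. f x * g y \<le> (h ((x + y) / 2))\<^sup>2"
  shows "(\<integral>\<^sup>+x. f x \<partial>lborel) * (\<integral>\<^sup>+x. g x \<partial>lborel) \<le> (\<integral>\<^sup>+x. h x \<partial>lborel)\<^sup>2"
proof -
  have kl: "(\<integral>\<^sup>+x. min (f x) (ennreal (real k)) \<partial>lborel) * (\<integral>\<^sup>+x. min (g x) (ennreal (real l)) \<partial>lborel) \<le> (\<integral>\<^sup>+x. h x \<partial>lborel)\<^sup>2"
    (is "?F k * ?G l \<le> ?H") for k l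
  proof (rule prekopa_leindler_real_bounded[where c="real (max k l)"])
    show "min (f x) (ennreal (real k)) * min (g y) (ennreal (real l)) \<le> (h ((x + y) / 2))\<^sup>2" for x y
      using le[of x y] mult_mono[of "min (f x) (ennreal (real k))" "f x" "min (g y) (ennreal (real l))" "g y"]
      by (auto intro: order.trans)
    show "min (f x) (ennreal (real k)) \<le> ennreal (real (max k l))" "min (g x) (ennreal (real l)) \<le> ennreal (real (max k l))" for x
      by (auto simp: min_le_iff_disj intro!: disjI2 ennreal_leI)
  qed measurable
  have "(SUP k. ?F k) * ?G l \<le> ?H" for l
    by (subst SUP_mult_right_ennreal) (auto intro!: SUP_least kl)
  then have "(SUP k. ?F k) * (SUP l. ?G l) \<le> ?H"
    by (subst SUP_mult_left_ennreal) (auto intro!: SUP_least)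
  then show ?thesis
    by (simp add: nn_integral_min_SUP[of f] nn_integral_min_SUP[of g])
qed

section \<open>From the line to several dimensions\<close>

lemma fun_upd_in_extensional: "x \<in> extensional I \<Longrightarrow> x(i := t) \<in> extensional (insert i I)"
  by (auto simp: extensional_def)

text \<open>The integrals over the coordinates in \<open>I\<close>, as functions of the new
  coordinate, again satisfy the midpoint hypothesis; this is the induction hypothesis, and the
  one-dimensional inequality closes the step.\<close>

lemma prekopa_leindler_PiM:
  fixes f g h :: "('i \<Rightarrow> real) \<Rightarrow> ennreal"
  assumes "finite I"
    and "f \<in> borel_measurable (PiM I (\<lambda>_. lborel))" "g \<in> borel_measurable (PiM I (\<lambda>_. lborel))" "h \<in> borel_measurable (PiM I (\<lambda>_. lborel))"
    and "\<And>x y. x \<in> extensional I \<Longrightarrow> y \<in> extensional I \<Longrightarrow> f x * g y \<le> (h (\<lambda>i\<in>I. (x i + y i) / 2))\<^sup>2"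
  shows "(\<integral>\<^sup>+x. f x \<partial>PiM I (\<lambda>_. lborel)) * (\<integral>\<^sup>+x. g x \<partial>PiM I (\<lambda>_. lborel)) \<le> (\<integral>\<^sup>+x. h x \<partial>PiM I (\<lambda>_. lborel))\<^sup>2"
  using assms
proof (induction I arbitrary: f g h rule: finite_induct)
  case empty
  interpret product_sigma_finite "\<lambda>_. lborel :: real measure" ..
  have "f (\<lambda>_. undefined) * g (\<lambda>_. undefined) \<le> (h (\<lambda>_. undefined))\<^sup>2"
    using empty(4)[of "\<lambda>_. undefined" "\<lambda>_. undefined"] by (simp add: restrict_def)
  then show ?case by (simp add: nn_integral_empty)
next
  case (insert i I)
  interpret product_sigma_finite "\<lambda>_. lborel :: real measure" ..
  note [measurable] = insert.prems(1-3)
  interpret finite_product_sigma_finite "\<lambda>_. lborel :: real measure" I by standard fact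
  have ins: "(\<integral>\<^sup>+x. f x \<partial>PiM (insert i I) (\<lambda>_. lborel)) = (\<integral>\<^sup>+t. (\<integral>\<^sup>+x. f (x(i := t)) \<partial>PiM I (\<lambda>_. lborel)) \<partial>lborel)"
    if "f \<in> borel_measurable (PiM (insert i I) (\<lambda>_. lborel))" for f :: "('i \<Rightarrow> real) \<Rightarrow> ennreal"
    by (rule product_nn_integral_insert_rev[OF insert(1,2) that])
  have upd: "(\<lambda>z. f ((snd z)(i := fst z))) \<in> borel_measurable (borel \<Otimes>\<^sub>M PiM I (\<lambda>_. lborel))"
    if [measurable]: "f \<in> borel_measurable (PiM (insert i I) (\<lambda>_. lborel))" for f :: "('i \<Rightarrow> real) \<Rightarrow> ennreal"
    by measurable
  have meas: "(\<lambda>t. \<integral>\<^sup>+x. f (x(i := t)) \<partial>PiM I (\<lambda>_. lborel)) \<in> borel_measurable borel"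
    if "f \<in> borel_measurable (PiM (insert i I) (\<lambda>_. lborel))" for f :: "('i \<Rightarrow> real) \<Rightarrow> ennreal"
    using borel_measurable_nn_integral_fst[OF upd[OF that]] by simp
  have sec: "(\<lambda>x. f (x(i := t))) \<in> borel_measurable (PiM I (\<lambda>_. lborel))"
    if "f \<in> borel_measurable (PiM (insert i I) (\<lambda>_. lborel))" for f :: "('i \<Rightarrow> real) \<Rightarrow> ennreal" and t
    using measurable_compose[OF measurable_Pair1'[of t borel] upd[OF that]] by simp
  note p = insert.prems
  show ?case
    unfolding ins[OF p(1)] ins[OF p(2)] ins[OF p(3)]
  proof (rule prekopa_leindler_real[OF meas[OF p(1)] meas[OF p(2)] meas[OF p(3)]])
    fix s t :: real
    show "(\<integral>\<^sup>+x. f (x(i := s)) \<partial>PiM I (\<lambda>_. lborel)) * (\<integral>\<^sup>+x. g (x(i := t)) \<partial>PiM I (\<lambda>_. lborel))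
      \<le> (\<integral>\<^sup>+x. h (x(i := (s + t) / 2)) \<partial>PiM I (\<lambda>_. lborel))\<^sup>2"
    proof (rule insert.IH[OF sec[OF p(1)] sec[OF p(2)] sec[OF p(3)]])
      fix x y :: "'i \<Rightarrow> real" assume xy: "x \<in> extensional I" "y \<in> extensional I"
      have "(\<lambda>j\<in>insert i I. ((x(i := s)) j + (y(i := t)) j) / 2) = (\<lambda>j\<in>I. (x j + y j) / 2)(i := (s + t) / 2)"
        using insert(2) by (auto simp: fun_eq_iff restrict_def)
      then show "f (x(i := s)) * g (y(i := t)) \<le> (h ((\<lambda>i\<in>I. (x i + y i) / 2)(i := (s + t) / 2)))\<^sup>2"
        using p(4)[of "x(i := s)" "y(i := t)"] xy by (simp only: fun_upd_in_extensional)
    qed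
  qed
qed

theorem prekopa_leindler:
  fixes f g h :: "'a::euclidean_space \<Rightarrow> ennreal"
  assumes [measurable]: "f \<in> borel_measurable borel" "g \<in> borel_measurable borel" "h \<in> borel_measurable borel"
    and le: "\<And>x y. f x * g y \<le> (h ((1/2) *\<^sub>R (x + y)))\<^sup>2"
  shows "(\<integral>\<^sup>+x. f x \<partial>lborel) * (\<integral>\<^sup>+x. g x \<partial>lborel) \<le> (\<integral>\<^sup>+x. h x \<partial>lborel)\<^sup>2"
proof -
  let ?e = "\<lambda>x :: 'a \<Rightarrow> real. \<Sum>b\<in>Basis. x b *\<^sub>R b"
  have e: "?e \<in> borel_measurable (PiM Basis (\<lambda>_. lborel))"
    by measurable
  have int: "(\<integral>\<^sup>+x. f x \<partial>lborel) = (\<integral>\<^sup>+x. f (?e x) \<partial>PiM Basis (\<lambda>_. lborel))"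
    if "f \<in> borel_measurable borel" for f :: "'a \<Rightarrow> ennreal"
    using that e by (subst lborel_eq) (simp add: nn_integral_distr)
  have "f (?e x) * g (?e y) \<le> (h (?e (\<lambda>i\<in>Basis. (x i + y i) / 2)))\<^sup>2" for x y
  proof -
    have "?e (\<lambda>i\<in>Basis. (x i + y i) / 2) = (1/2) *\<^sub>R (?e x + ?e y)"
      by (simp add: sum.distrib[symmetric] scaleR_sum_right scaleR_add_left[symmetric] add_divide_distrib)
    then show ?thesis using le[of "?e x" "?e y"] by simp
  qed
  then show ?thesis
    unfolding int[OF assms(1)] int[OF assms(2)] int[OF assms(3)]
    using e assms(1-3) by (intro prekopa_leindler_PiM) (auto intro: measurable_compose)
qed

text \<open>The slab over the unit ball in \<open>sub_measure\<close> is convex, so its indicator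
  satisfies the midpoint hypothesis by itself and can be multiplied into all three
  functions.\<close>

lemma prekopa_leindler_sub_measure:
  fixes f g h :: "'a::euclidean_space \<Rightarrow> ennreal"
  assumes P: "orth_proj P"
    and [measurable]: "f \<in> borel_measurable borel" "g \<in> borel_measurable borel" "h \<in> borel_measurable borel"
    and le: "\<And>x y. P x = x \<Longrightarrow> P y = y \<Longrightarrow> f x * g y \<le> (h ((1/2) *\<^sub>R (x + y)))\<^sup>2"
  shows "(\<integral>\<^sup>+x. f x \<partial>sub_measure P) * (\<integral>\<^sup>+x. g x \<partial>sub_measure P) \<le> (\<integral>\<^sup>+x. h x \<partial>sub_measure P)\<^sup>2"
proof -
  have [measurable]: "P \<in> borel_measurable borel" using P by (rule orth_proj_borel)
  interpret linear P using P by (rule orth_proj_linear)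
  let ?B = "{x. norm (x - P x) \<le> 1}"
  have B: "(1/2) *\<^sub>R (x + y) \<in> ?B" if "x \<in> ?B" "y \<in> ?B" for x y
  proof -
    have "(1/2) *\<^sub>R (x + y) - P ((1/2) *\<^sub>R (x + y)) = (1/2) *\<^sub>R ((x - P x) + (y - P y))"
      by (simp add: add scale algebra_simps)
    then show ?thesis using that norm_triangle_ineq[of "x - P x" "y - P y"] by simp
  qed
  have "(f (P x) * indicator ?B x) * (g (P y) * indicator ?B y) \<le> (h (P ((1/2) *\<^sub>R (x + y))) * indicator ?B ((1/2) *\<^sub>R (x + y)))\<^sup>2" for x y
    using le[of "P x" "P y"] B[of x y] orth_proj_idem[OF P] by (auto simp: indicator_def add scale)
  then show ?thesis
    unfolding nn_integral_sub_measure[OF P assms(2)] nn_integral_sub_measure[OF P assms(3)] nn_integral_sub_measure[OF P assms(4)]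
    by (intro prekopa_leindler) measurable
qed

section \<open>Convex bodies whose difference body has minimal volume\<close>

lemma emeasure_half_sum_euclidean:
  fixes A B S :: "'a::euclidean_space set"
  assumes [measurable]: "A \<in> sets borel" "B \<in> sets borel" "S \<in> sets borel"
    and AB: "\<And>a b. a \<in> A \<Longrightarrow> b \<in> B \<Longrightarrow> (1/2) *\<^sub>R (a + b) \<in> S"
  shows "emeasure lborel A * emeasure lborel B \<le> (emeasure lborel S)\<^sup>2"
proof -
  have "indicator A x * indicator B y \<le> ((indicator S ((1/2) *\<^sub>R (x + y)))\<^sup>2 :: ennreal)" for x y
    using AB[of x y] by (auto simp: indicator_def)
  then show ?thesis
    using prekopa_leindler[of "indicator A" "indicator B" "indicator S"] by simp
qed

lemma nn_integral_indicator_comp: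
  assumes "f -` X \<in> sets borel"
  shows "(\<integral>\<^sup>+x. indicator X (f x) \<partial>lborel) = emeasure lborel (f -` X)"
proof -
  have "(\<integral>\<^sup>+x. indicator X (f x) \<partial>lborel) = (\<integral>\<^sup>+x. indicator (f -` X) x \<partial>lborel)"
    by (rule nn_integral_cong) (simp add: indicator_def)
  then show ?thesis using assms by simp
qed

text \<open>The copy of \<open>C\<close> shrunk by a factor \<open>t\<close> towards a point
  \<open>p\<close> of \<open>C\<close> in \<open>U\<close> stays in \<open>C\<close> by convexity,
  lies in \<open>U\<close> for small \<open>t\<close>, and has a positive multiple of the volume of
  \<open>C\<close>.\<close>

lemma emeasure_compact_Int_open_pos:
  fixes C :: "'a::euclidean_space set"
  assumes C: "compact C" "convex C" and pos: "emeasure lborel C > 0" and U: "open U" "U \<inter> C \<noteq> {}"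
  shows "emeasure lborel (C \<inter> U) > 0"
proof -
  obtain p e where p: "p \<in> C" "e > 0" "ball p e \<subseteq> U"
    using U by (metis Int_iff all_not_in_conv openE)
  obtain R where R: "\<And>x. x \<in> C \<Longrightarrow> norm (x - p) \<le> R" "R > 0"
  proof -
    have "bounded ((\<lambda>x. x - p) ` C)"
      using C(1) by (intro compact_imp_bounded compact_continuous_image continuous_intros)
    then show ?thesis using that unfolding bounded_pos by auto
  qed
  \<comment> \<open>All of \<open>C\<close> lies within \<open>R\<close> of \<open>p\<close>, so the
    shrunken copy lies within \<open>t * R < e\<close> of \<open>p\<close>.\<close>
  define t where "t = e / (R + e)"
  have t: "0 < t" "t \<le> 1" "t * R < e" using p(2) R(2) by (auto simp: t_def field_simps)
  have [measurable]: "C \<in> sets borel" using C(1) by (rule borel_compact)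
  define f :: "'a \<Rightarrow> ennreal" where "f y = indicator C (y + (1 - 1 / t) *\<^sub>R p)" for y
  have [measurable]: "f \<in> borel_measurable borel" unfolding f_def by measurable
  have "(\<integral>\<^sup>+x. f ((1 / t) *\<^sub>R x) \<partial>lborel) = ennreal (t ^ DIM('a)) * (\<integral>\<^sup>+x. f x \<partial>lborel)"
    using nn_integral_lborel_scale[of f "1/t"] t by (simp add: power_one_over)
  also have "(\<integral>\<^sup>+x. f x \<partial>lborel) = emeasure lborel C"
    unfolding f_def by (subst nn_integral_lborel_translate) simp_all
  finally have "0 < (\<integral>\<^sup>+x. f ((1 / t) *\<^sub>R x) \<partial>lborel)" using t pos by (simp add: ennreal_zero_less_mult_iff)
  also have "\<dots> \<le> (\<integral>\<^sup>+x. indicator (C \<inter> U) x \<partial>lborel)"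
  proof (rule nn_integral_mono)
    fix x :: 'a
    show "f ((1 / t) *\<^sub>R x) \<le> indicator (C \<inter> U) x"
    proof (cases "(1 / t) *\<^sub>R x + (1 - 1 / t) *\<^sub>R p \<in> C")
      case True
      define y where "y = (1 / t) *\<^sub>R x + (1 - 1 / t) *\<^sub>R p"
      have yC: "y \<in> C" using True by (simp only: y_def)
      have x: "x = (1 - t) *\<^sub>R p + t *\<^sub>R y"
        using t by (simp add: y_def scaleR_right_distrib scaleR_left_diff_distrib scaleR_diff_right)
      have "x \<in> C" unfolding x using C(2) p(1) yC t by (auto simp: convex_alt)
      moreover have "x - p = t *\<^sub>R (y - p)" unfolding x by (simp add: algebra_simps)
      then have "norm (x - p) \<le> t * R" using R(1)[OF yC] t by simp
      then have "x \<in> U" using t(3) p(3) by (auto simp: dist_norm norm_minus_commute)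
      ultimately show ?thesis by (simp add: f_def indicator_def)
    qed (simp add: f_def)
  qed
  also have "\<dots> = emeasure lborel (C \<inter> U)" using U(1) by (subst nn_integral_indicator) auto
  finally show ?thesis .
qed

text \<open>For fixed \<open>v\<close> this is the distribution function of the marginal of
  \<open>C\<close> in direction \<open>v\<close>, not normalized to mass 1.\<close>

definition cut_volume :: "'a::euclidean_space set \<Rightarrow> 'a \<Rightarrow> real \<Rightarrow> real" where
  "cut_volume C v \<alpha> = measure lborel (C \<inter> {x. v \<bullet> x \<le> \<alpha>})"

lemma measure_hyperplane_slice:
  assumes "v \<noteq> (0::'a::euclidean_space)" shows "emeasure lborel (C \<inter> {x. v \<bullet> x = \<alpha>}) = 0"
proof -
  have "negligible {x. v \<bullet> x = \<alpha>}" using assms by (rule negligible_hyperplane[OF disjI1])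
  moreover have "{x. v \<bullet> x = \<alpha>} \<in> sets borel" by (intro borel_closed closed_hyperplane)
  ultimately have "emeasure lborel {x. v \<bullet> x = \<alpha>} = 0"
    by (auto simp: negligible_iff_null_sets null_sets_def)
  then show ?thesis
    using emeasure_mono[of "C \<inter> {x. v \<bullet> x = \<alpha>}" "{x. v \<bullet> x = \<alpha>}" lborel] \<open>_ \<in> sets borel\<close> by simp
qed

locale convex_volume =
  fixes C :: "'a::euclidean_space set"
  assumes comp: "compact C" and conv: "convex C" and vol_pos: "measure lborel C > 0"
begin

lemma C_borel [measurable]: "C \<in> sets borel" using comp by (rule borel_compact)

lemma finite_part [simp]: "emeasure lborel (C \<inter> X) < top" "emeasure lborel C < top"
    "emeasure lborel (C \<inter> X) \<noteq> top" "emeasure lborel C \<noteq> top"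
proof -
  have *: "emeasure lborel C < \<infinity>" using emeasure_bounded_finite[OF compact_imp_bounded[OF comp]] .
  moreover have "emeasure lborel (C \<inter> X) \<le> emeasure lborel C" by (rule emeasure_mono) auto
  ultimately show "emeasure lborel (C \<inter> X) < top" "emeasure lborel C < top"
    "emeasure lborel (C \<inter> X) \<noteq> top" "emeasure lborel C \<noteq> top" by (auto simp: less_top)
qed

lemma emeasure_pos: "emeasure lborel C > 0"
  using vol_pos by (simp add: measure_def enn2real_positive_iff)

lemma fmeasurable_part: "X \<in> sets borel \<Longrightarrow> C \<inter> X \<in> fmeasurable lborel" "C \<in> fmeasurable lborel"
  by (auto simp: fmeasurable_def)

text \<open>Makes the marginals of \<open>C\<close> finite Borel measures on the line, so that
  continuity and uniqueness can be read off their distribution functions.\<close>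

definition restr :: "'a measure" where "restr = density lborel (indicator C)"

lemma sets_restr [simp, measurable_cong]: "sets restr = sets borel" and space_restr [simp]: "space restr = UNIV"
  by (simp_all add: restr_def)

lemma emeasure_restr: "X \<in> sets borel \<Longrightarrow> emeasure restr X = emeasure lborel (C \<inter> X)"
  unfolding restr_def by (subst emeasure_density) (auto simp: indicator_inter_arith[symmetric] simp flip: nn_integral_indicator)

lemma finite_restr: "finite_measure restr"
  by (rule finite_measureI) (simp add: emeasure_restr)

lemma measure_restr: "X \<in> sets borel \<Longrightarrow> measure restr X = measure lborel (C \<inter> X)"
  by (simp add: measure_def emeasure_restr)

lemma cdf_restr:
  assumes "f \<in> borel_measurable borel"
  shows "cdf (distr restr borel f) \<alpha> = measure lborel (C \<inter> {x. f x \<le> \<alpha>})"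
    and "finite_borel_measure (distr restr borel f)"
proof -
  interpret finite_measure restr by (rule finite_restr)
  have f[measurable]: "f \<in> measurable restr borel" using assms by simp
  show "finite_borel_measure (distr restr borel f)"
    by (intro finite_borel_measure.intro finite_measure_distr f finite_borel_measure_axioms.intro) simp
  have "f -` {..\<alpha>} \<in> sets borel" using assms by (rule measurable_sets_borel) simp
  then show "cdf (distr restr borel f) \<alpha> = measure lborel (C \<inter> {x. f x \<le> \<alpha>})"
    by (simp add: cdf_def measure_distr measure_restr vimage_def)
qed

lemma half_borel [measurable]: "{x. v \<bullet> x \<le> \<alpha>} \<in> sets borel" "{x. v \<bullet> x \<ge> \<alpha>} \<in> sets borel"
  by (intro borel_closed closed_halfspace_le closed_halfspace_ge)+

lemma cut_mono: "\<alpha> \<le> \<beta> \<Longrightarrow> cut_volume C v \<alpha> \<le> cut_volume C v \<beta>"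
  unfolding cut_volume_def by (rule measure_mono_fmeasurable) (auto intro: fmeasurable_part)

lemma cut_bounds: "0 \<le> cut_volume C v \<alpha>" "cut_volume C v \<alpha> \<le> measure lborel C"
  unfolding cut_volume_def
  by (auto intro!: measure_mono_fmeasurable fmeasurable_part)

lemma cut_complement:
  assumes "v \<noteq> 0"
  shows "measure lborel (C \<inter> {x. v \<bullet> x \<ge> \<alpha>}) = measure lborel C - cut_volume C v \<alpha>"
proof -
  let ?A = "C \<inter> {x. v \<bullet> x \<ge> \<alpha>}" and ?B = "C \<inter> {x. v \<bullet> x \<le> \<alpha>}"
  have "?A \<inter> ?B = C \<inter> {x. v \<bullet> x = \<alpha>}" by auto
  then have 0: "measure lborel (?A \<inter> ?B) = 0"
    using measure_hyperplane_slice[OF assms, of C \<alpha>] by (simp add: measure_def)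
  have "?A \<union> ?B = C" by auto
  moreover have "measure lborel (?A \<union> ?B) = measure lborel ?A + measure lborel ?B - measure lborel (?A \<inter> ?B)"
    by (rule measure_Un3) (auto intro: fmeasurable_part)
  ultimately show ?thesis using 0 by (simp add: cut_volume_def)
qed

text \<open>Mass on both sides gives points of \<open>C\<close> on both sides; the segment between
  them crosses the open slab, and a convex set of positive volume has positive volume near each of
  its points.\<close>

lemma cut_strict:
  assumes "\<alpha> < \<beta>" "0 < cut_volume C v \<alpha>" "cut_volume C v \<beta> < measure lborel C"
  shows "cut_volume C v \<alpha> < cut_volume C v \<beta>"
proof -
  obtain x where x: "x \<in> C" "v \<bullet> x \<le> \<alpha>"
  proof (rule ccontr)
    assume "\<not> thesis"
    then have "C \<inter> {x. v \<bullet> x \<le> \<alpha>} = {}" using that by force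
    then show False using assms(2) by (simp add: cut_volume_def)
  qed
  obtain y where y: "y \<in> C" "v \<bullet> y > \<beta>"
  proof (rule ccontr)
    assume "\<not> thesis"
    then have "C \<inter> {x. v \<bullet> x \<le> \<beta>} = C" using that by force
    then show False using assms(3) by (simp add: cut_volume_def)
  qed
  define t where "t = ((\<alpha> + \<beta>) / 2 - v \<bullet> x) / (v \<bullet> y - v \<bullet> x)"
  have "v \<bullet> y - v \<bullet> x \<noteq> 0" using x y assms(1) by simp
  then have "t * (v \<bullet> y - v \<bullet> x) = (\<alpha> + \<beta>) / 2 - v \<bullet> x" by (simp add: t_def)
  then have t: "v \<bullet> x + t * (v \<bullet> y - v \<bullet> x) = (\<alpha> + \<beta>) / 2" by simp
  have "0 \<le> t" "t \<le> 1" using x y assms(1) by (auto simp: t_def divide_simps)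
  note t = this t
  let ?p = "(1 - t) *\<^sub>R x + t *\<^sub>R y"
  have p: "?p \<in> C" using conv x y t by (auto simp: convex_alt)
  have vp: "v \<bullet> ?p = (\<alpha> + \<beta>) / 2" using t(3) by (simp add: inner_add_right algebra_simps)
  let ?U = "{x. \<alpha> < v \<bullet> x} \<inter> {x. v \<bullet> x < \<beta>}"
  have U: "open ?U" by (intro open_Int open_halfspace_gt open_halfspace_lt)
  have "?p \<in> ?U" unfolding Int_iff mem_Collect_eq vp using assms(1) by simp
  then have "?U \<inter> C \<noteq> {}" using p by blast
  then have "0 < emeasure lborel (C \<inter> ?U)"
    by (intro emeasure_compact_Int_open_pos comp conv emeasure_pos U) auto
  then have "0 < measure lborel (C \<inter> ?U)"
    using finite_part(1)[of ?U] by (simp add: measure_def enn2real_positive_iff less_top)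
  moreover have "measure lborel (C \<inter> {x. v \<bullet> x \<le> \<alpha>}) + measure lborel (C \<inter> ?U) = measure lborel ((C \<inter> {x. v \<bullet> x \<le> \<alpha>}) \<union> (C \<inter> ?U))"
    using U by (intro measure_Un2[symmetric] measure_Union[symmetric]) auto
  moreover have "\<dots> \<le> cut_volume C v \<beta>"
    unfolding cut_volume_def using U assms(1)
    by (intro measure_mono_fmeasurable) (auto intro: fmeasurable_part)
  ultimately show ?thesis by (simp add: cut_volume_def)
qed

text \<open>An atom of the marginal would be a hyperplane slice of positive volume.\<close>

lemma cut_continuous:
  assumes "v \<noteq> 0" shows "isCont (cut_volume C v) \<alpha>"
proof -
  let ?D = "distr restr borel (\<lambda>x. v \<bullet> x)"
  have b: "(\<lambda>x. v \<bullet> x) \<in> borel_measurable borel" by measurable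
  have "measure ?D {\<alpha>} = measure restr {x. v \<bullet> x = \<alpha>}" by (simp add: measure_distr vimage_def)
  also have "\<dots> = 0"
    using measure_hyperplane_slice[OF assms, of C \<alpha>] by (subst measure_restr) (auto simp: measure_def borel_closed closed_hyperplane)
  finally have "isCont (cdf ?D) \<alpha>"
    using finite_borel_measure.isCont_cdf[OF cdf_restr(2)[OF b]] by simp
  moreover have "cdf ?D = cut_volume C v" by (auto simp: fun_eq_iff cdf_restr(1)[OF b] cut_volume_def)
  ultimately show ?thesis by simp
qed

lemma cut_attains:
  assumes v: "v \<noteq> 0" and s: "0 < s" "s < measure lborel C"
  shows "\<exists>\<alpha>. cut_volume C v \<alpha> = s"
proof -
  have "bounded ((\<lambda>x. v \<bullet> x) ` C)"
    using comp by (intro compact_imp_bounded compact_continuous_image continuous_intros)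
  then obtain R where R: "\<And>x. x \<in> C \<Longrightarrow> \<bar>v \<bullet> x\<bar> \<le> R" unfolding bounded_iff by auto
  have "C \<inter> {x. v \<bullet> x \<le> - R - 1} = {}" "C \<inter> {x. v \<bullet> x \<le> R} = C" using R by force+
  then have "cut_volume C v (- R - 1) = 0" "cut_volume C v R = measure lborel C" by (simp_all add: cut_volume_def)
  moreover have "0 \<le> R \<or> C = {}" using R by force
  then have "0 \<le> R" using vol_pos by auto
  ultimately show ?thesis
    using IVT[of "cut_volume C v" "- R - 1" s R] s cut_continuous[OF v] by auto
qed

end

text \<open>For points at distance 2h the hypothesis reads A(x+h) - A(x) \<le> B(x+2h) - B(x+h): on
  a grid of step h each increment of A is bounded by the next increment of B. The sum telescopes to
  A(y) - A(x) \<le> B(y+h) - B(x+h), and h tends to 0.\<close>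

lemma midpoint_separated_increment_le:
  fixes A B :: "real \<Rightarrow> real"
  assumes mid: "\<And>x y. x < z \<Longrightarrow> y < z \<Longrightarrow> A ((x + y) / 2) + B ((x + y) / 2) \<le> A x + B y"
    and cont: "continuous_on {..<z} B" and xy: "x < y" "y < z"
  shows "A y - A x \<le> B y - B x"
proof -
  define h where "h n = (y - x) / real (Suc n)" for n
  have h0: "h \<longlonglongrightarrow> 0" unfolding h_def by (intro lim_const_over_n[THEN LIMSEQ_Suc])
  have hpos: "h n > 0" for n using xy by (simp add: h_def)
  have "(\<lambda>n. y + h n) \<longlonglongrightarrow> y + 0" "(\<lambda>n. x + h n) \<longlonglongrightarrow> x + 0" by (intro tendsto_intros h0)+
  then have lim: "(\<lambda>n. y + h n) \<longlonglongrightarrow> y" "(\<lambda>n. x + h n) \<longlonglongrightarrow> x" by simp_all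
  have iscont: "isCont B w" if "w < z" for w
    using cont that by (simp add: continuous_on_eq_continuous_at)
  have limB: "(\<lambda>n. B (y + h n) - B (x + h n)) \<longlonglongrightarrow> B y - B x"
    using xy by (intro tendsto_diff isCont_tendsto_compose[OF iscont] lim) auto
  have "eventually (\<lambda>n. y + h n < z) sequentially" using order_tendstoD(2)[OF lim(1) xy(2)] .
  then have "eventually (\<lambda>n. A y - A x \<le> B (y + h n) - B (x + h n)) sequentially"
  proof eventually_elim
    case (elim n)
    have step: "A (x + real j * h n) - A x \<le> B (x + real (Suc j) * h n) - B (x + h n)" if "j \<le> Suc n" for j
      using that
    proof (induction j)
      case (Suc j)
      have le: "x + real (Suc (Suc j)) * h n \<le> y + h n"
      proof -
        have "real (Suc (Suc j)) * h n \<le> real (Suc (Suc n)) * h n"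
          using Suc.prems hpos[of n] by (intro mult_right_mono) auto
        also have "\<dots> = (y - x) + h n" by (simp add: h_def field_simps)
        finally show ?thesis by simp
      qed
      have "x + real j * h n < z"
        using le elim hpos[of n] by (simp add: algebra_simps)
      then have "A (((x + real j * h n) + (x + real (Suc (Suc j)) * h n)) / 2) + B (((x + real j * h n) + (x + real (Suc (Suc j)) * h n)) / 2)
          \<le> A (x + real j * h n) + B (x + real (Suc (Suc j)) * h n)"
        using le elim by (intro mid) auto
      moreover have "((x + real j * h n) + (x + real (Suc (Suc j)) * h n)) / 2 = x + real (Suc j) * h n"
        by (simp add: field_simps)
      ultimately have "A (x + real (Suc j) * h n) + B (x + real (Suc j) * h n)
          \<le> A (x + real j * h n) + B (x + real (Suc (Suc j)) * h n)" by (simp only:)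
      then show ?case using Suc.IH[OF Suc_leD[OF Suc.prems]] by linarith
    qed simp
    have "x + real (Suc n) * h n = y" by (simp add: h_def)
    moreover have "x + real (Suc (Suc n)) * h n = y + h n" by (simp add: h_def field_simps)
    ultimately show ?case using step[of "Suc n"] by simp
  qed
  then show ?thesis by (intro tendsto_lowerbound[OF limB]) auto
qed

text \<open>Equality in Brunn--Minkowski for \<^term>\<open>C\<close> and \<^term>\<open>- C\<close>. In each direction cut both
  bodies by half-spaces of volumes \<^term>\<open>s\<close> and \<^term>\<open>t\<close>: Brunn--Minkowski for the pieces bounds the
  quantiles \<^term>\<open>a\<close>, \<^term>\<open>b\<close> of the two bodies by \<open>a(r) + b(r) \<le> a(s) + b(t)\<close> with
  \<open>r\<^sup>2 = s t\<close>, and in logarithmic scale this forces \<open>a - b\<close> to be constant. So every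
  one-dimensional marginal of \<^term>\<open>C\<close> is symmetric, necessarily about the centroid.\<close>

lemma (in convex_volume) marginal_symmetric:
  assumes S: "compact S" "convex S" and S_le: "measure lborel S \<le> measure lborel C"
    and mid: "\<And>x y. x \<in> C \<Longrightarrow> y \<in> C \<Longrightarrow> (1/2) *\<^sub>R (x - y) \<in> S" and v: "v \<noteq> 0"
  obtains \<delta> where "\<And>\<alpha>. cut_volume C v (\<delta> - \<alpha>) = measure lborel C - cut_volume C v \<alpha>"
proof -
  let ?V = "measure lborel C" and ?\<phi> = "cut_volume C v" and ?\<sigma> = "cut_volume S v"
  have [measurable]: "S \<in> sets borel" using S(1) by (rule borel_compact)

  have refl: "measure lborel (uminus ` X) = measure lborel X" "uminus ` X \<in> sets borel" if "X \<in> sets borel" for X :: "'a set"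
  proof -
    have im: "uminus ` X = uminus -` X" by (intro set_eqI iffI) (auto intro: rev_image_eqI)
    show b: "uminus ` X \<in> sets borel" unfolding im using that by (intro measurable_sets_borel[of uminus]) auto
    have "emeasure lborel (uminus ` X) = (\<integral>\<^sup>+x. indicator X (- x) \<partial>lborel)"
      using b unfolding im by (rule nn_integral_indicator_comp[symmetric])
    then show "measure lborel (uminus ` X) = measure lborel X"
      using that nn_integral_lborel_uminus[of "indicator X"] by (simp add: measure_def)
  qed
  have bm: "measure lborel X * measure lborel Y \<le> (measure lborel Z)\<^sup>2"
    if "X \<subseteq> C" "X \<in> sets borel" "Y \<subseteq> C" "Y \<in> sets borel" "Z \<subseteq> S" "Z \<in> sets borel"
      "\<And>x y. x \<in> X \<Longrightarrow> y \<in> Y \<Longrightarrow> (1/2) *\<^sub>R (x - y) \<in> Z" for X Y Z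
  proof -
    have "emeasure lborel X * emeasure lborel (uminus ` Y) \<le> (emeasure lborel Z)\<^sup>2"
      using that refl(2)[OF that(4)] by (intro emeasure_half_sum_euclidean) auto
    moreover have "bounded Z" "bounded X" "bounded Y"
      by (rule bounded_subset[OF compact_imp_bounded[OF S(1)] that(5)],
        rule bounded_subset[OF compact_imp_bounded[OF comp] that(1)],
        rule bounded_subset[OF compact_imp_bounded[OF comp] that(3)])
    then have "bounded Z" "bounded X" "bounded (uminus ` Y)" by simp_all
    then have "emeasure lborel Z \<noteq> top" "emeasure lborel X \<noteq> top" "emeasure lborel (uminus ` Y) \<noteq> top"
      using emeasure_bounded_finite by (metis infinity_ennreal_def order_less_irrefl)+
    ultimately have "measure lborel X * measure lborel (uminus ` Y) \<le> (measure lborel Z)\<^sup>2"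
      by (simp add: emeasure_eq_ennreal_measure ennreal_mult[symmetric] ennreal_power)
    then show ?thesis using refl(1)[OF that(4)] by simp
  qed
  \<comment> \<open>Brunn--Minkowski for the whole bodies gives the reverse of \<open>S_le\<close>,
    so the two volumes agree.\<close>
  have S_ge: "?V \<le> measure lborel S"
  proof -
    have "?V * ?V \<le> (measure lborel S)\<^sup>2" by (rule bm) (use mid in auto)
    then have "?V\<^sup>2 \<le> (measure lborel S)\<^sup>2" by (simp only: power2_eq_square)
    then show ?thesis by (rule power2_le_imp_le) simp
  qed
  interpret S: convex_volume S
    by standard (use S vol_pos S_ge in auto)
  have SV: "measure lborel S = ?V" using S_le S_ge by simp
  \<comment> \<open>Half the difference of a point below level \<alpha> and a point above level
    -\<beta> lies below (\<alpha> + \<beta>)/2; \<open>bm2\<close> is the same for the complementary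
    pieces.\<close>
  have bm1: "?\<phi> \<alpha> * (?V - ?\<phi> (- \<beta>)) \<le> (?\<sigma> ((\<alpha> + \<beta>) / 2))\<^sup>2" for \<alpha> \<beta>
    unfolding cut_complement[OF v, symmetric] unfolding cut_volume_def
    by (rule bm) (use mid in \<open>auto simp: inner_diff_right\<close>)
  have bm2: "(?V - ?\<phi> \<alpha>) * ?\<phi> (- \<beta>) \<le> (?V - ?\<sigma> ((\<alpha> + \<beta>) / 2))\<^sup>2" for \<alpha> \<beta>
  proof -
    have "(?V - ?\<phi> \<alpha>) * ?\<phi> (- \<beta>) \<le> (measure lborel S - ?\<sigma> ((\<alpha> + \<beta>) / 2))\<^sup>2"
      unfolding cut_complement[OF v, symmetric] S.cut_complement[OF v, symmetric] unfolding cut_volume_def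
      by (rule bm) (use mid in \<open>auto simp: inner_diff_right\<close>)
    then show ?thesis by (simp only: SV)
  qed
  \<comment> \<open>\<open>a\<close> is the quantile function of the marginal of \<open>C\<close>,
    and \<open>b\<close> below is that of \<open>- C\<close>.\<close>
  define a where "a s = (SOME \<alpha>. ?\<phi> \<alpha> = s)" for s
  have a: "?\<phi> (a s) = s" if "0 < s" "s < ?V" for s
    unfolding a_def by (rule someI_ex) (use cut_attains[OF v that] in auto)
  have a_less: "?\<phi> l < s" if "l < a s" "0 < s" "s < ?V" for l s
  proof -
    have as: "?\<phi> (a s) = s" using that by (intro a)
    have "?\<phi> l \<le> s" using cut_mono[of l "a s" v] that unfolding as by simp
    moreover have "?\<phi> l \<noteq> s" using cut_strict[of l "a s" v] that unfolding as by linarith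
    ultimately show ?thesis by simp
  qed
  have a_greater: "s < ?\<phi> u" if "a s < u" "0 < s" "s < ?V" for u s
  proof -
    have as: "?\<phi> (a s) = s" using that by (intro a)
    have "s \<le> ?\<phi> u" using cut_mono[of "a s" u v] that unfolding as by simp
    moreover have "?\<phi> u \<noteq> s" using cut_strict[of "a s" u v] that unfolding as by linarith
    ultimately show ?thesis by simp
  qed
  have a_cont: "isCont a s" if s: "0 < s" "s < ?V" for s
    unfolding isCont_def
  proof (rule order_tendstoI)
    have ev: "eventually (\<lambda>r. 0 < r \<and> r < ?V) (at s)"
      using s by (intro eventually_conj order_tendstoD[OF tendsto_ident_at])
    show "eventually (\<lambda>r. l < a r) (at s)" if "l < a s" for l
      using order_tendstoD(1)[OF tendsto_ident_at a_less[OF that s]] ev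
    proof eventually_elim
      case (elim r)
      then have "?\<phi> (a r) = r" by (intro a) auto
      then show ?case using cut_mono[of "a r" l v] elim(1) by linarith
    qed
    show "eventually (\<lambda>r. a r < u) (at s)" if "a s < u" for u
      using order_tendstoD(2)[OF tendsto_ident_at a_greater[OF that s]] ev
    proof eventually_elim
      case (elim r)
      then have "?\<phi> (a r) = r" by (intro a) auto
      then show ?case using cut_mono[of u "a r" v] elim(1) by linarith
    qed
  qed
  define b where "b s = - a (?V - s)" for s
  have b: "?V - ?\<phi> (- b s) = s" if "0 < s" "s < ?V" for s using a[of "?V - s"] that by (simp add: b_def)
  have b_cont: "isCont b s" if "0 < s" "s < ?V" for s
  proof -
    have "isCont (\<lambda>s. ?V - s) s" by (intro continuous_intros)
    moreover have "isCont a (?V - s)" using that by (intro a_cont) auto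
    ultimately have "isCont (\<lambda>s. a (?V - s)) s" by (rule isCont_o2)
    then show ?thesis unfolding b_def by (rule continuous_minus)
  qed
  \<comment> \<open>At equal volumes the two bounds pinch, so the quantile of \<open>S\<close> is
    the mean of those of \<open>C\<close> and \<open>- C\<close>.\<close>
  have \<sigma>_eq: "?\<sigma> ((a s + b s) / 2) = s" if s: "0 < s" "s < ?V" for s
  proof (rule antisym)
    have "s\<^sup>2 \<le> (?\<sigma> ((a s + b s) / 2))\<^sup>2"
      using bm1[of "a s" "b s"] a[OF s] b[OF s] by (simp add: power2_eq_square)
    then show "s \<le> ?\<sigma> ((a s + b s) / 2)" using S.cut_bounds(1) by (rule power2_le_imp_le)
    have "(?V - s)\<^sup>2 \<le> (?V - ?\<sigma> ((a s + b s) / 2))\<^sup>2"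
      using bm2[of "a s" "b s"] a[OF s] b[OF s] by (simp add: power2_eq_square algebra_simps)
    then have "?V - s \<le> ?V - ?\<sigma> ((a s + b s) / 2)"
      by (rule power2_le_imp_le) (use S.cut_bounds(2) SV in simp)
    then show "?\<sigma> ((a s + b s) / 2) \<le> s" by simp
  qed
  \<comment> \<open>The cut of \<open>S\<close> at level (a s + b t)/2 has at least the geometric
    mean of s and t as its volume, so this level is not below the quantile of \<open>S\<close> at
    that mean.\<close>
  have key: "a (sqrt (s * t)) + b (sqrt (s * t)) \<le> a s + b t" if s: "0 < s" "s < ?V" and t: "0 < t" "t < ?V" for s t
  proof (rule ccontr)
    let ?r = "sqrt (s * t)"
    have r: "0 < ?r" "?r < ?V"
    proof -
      have "s * t < ?V * ?V" using s t by (intro mult_strict_mono) auto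
      then have "?r < sqrt (?V * ?V)" by (rule real_sqrt_less_mono)
      then show "?r < ?V" using vol_pos by simp
    qed (use s t in simp)
    assume "\<not> ?thesis"
    then have lt: "(a s + b t) / 2 < (a ?r + b ?r) / 2" by simp
    have "?r\<^sup>2 \<le> (?\<sigma> ((a s + b t) / 2))\<^sup>2" using bm1[of "a s" "b t"] a[OF s] b[OF t] s t by simp
    then have le: "?r \<le> ?\<sigma> ((a s + b t) / 2)" using S.cut_bounds(1) by (rule power2_le_imp_le)
    have "?\<sigma> ((a s + b t) / 2) < ?\<sigma> ((a ?r + b ?r) / 2)"
      by (rule S.cut_strict[OF lt]) (use le r \<sigma>_eq[OF r] SV in linarith)+
    then show False using \<sigma>_eq[OF r] le by linarith
  qed
  define z where "z = ln ?V"
  have ez: "exp x < ?V" if "x < z" for x    using that vol_pos exp_less_cancel_iff[of x z] by (simp add: z_def)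
  have sq: "sqrt (exp x * exp y) = exp ((x + y) / 2)" for x y :: real
  proof -
    have "(exp ((x + y) / 2))\<^sup>2 = exp x * exp y"
      unfolding power2_eq_square mult_exp_exp by simp
    then show ?thesis by (rule real_sqrt_unique) simp
  qed
  have c1: "continuous_on {..<z} (\<lambda>x. b (exp x))" "continuous_on {..<z} (\<lambda>x. a (exp x))"
    using isCont_o2[OF isCont_exp b_cont[OF exp_gt_zero ez]] isCont_o2[OF isCont_exp a_cont[OF exp_gt_zero ez]]
    by (simp_all add: continuous_on_eq_continuous_at)
  \<comment> \<open>\<open>key\<close> holds for both orders of the pair, so the increment lemma
    also applies with \<open>a\<close> and \<open>b\<close> exchanged, which gives equality.\<close>
  have inc: "a (exp y) - a (exp x) = b (exp y) - b (exp x)" if "x < y" "y < z" for x y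
  proof (rule antisym)
    show "a (exp y) - a (exp x) \<le> b (exp y) - b (exp x)"
    proof (rule midpoint_separated_increment_le[of z "\<lambda>x. a (exp x)" "\<lambda>x. b (exp x)"])
      fix x y assume "x < z" "y < z"
      then show "a (exp ((x + y) / 2)) + b (exp ((x + y) / 2)) \<le> a (exp x) + b (exp y)"
        using key[OF exp_gt_zero ez exp_gt_zero ez, of x y] unfolding sq by simp
    qed (use that c1 in auto)
    show "b (exp y) - b (exp x) \<le> a (exp y) - a (exp x)"
    proof (rule midpoint_separated_increment_le[of z "\<lambda>x. b (exp x)" "\<lambda>x. a (exp x)"])
      fix x y assume "x < z" "y < z"
      then show "b (exp ((x + y) / 2)) + a (exp ((x + y) / 2)) \<le> b (exp x) + a (exp y)"
        using key[OF exp_gt_zero ez exp_gt_zero ez, of y x] unfolding sq by (simp add: add.commute)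
    qed (use that c1 in auto)
  qed
  \<comment> \<open>Twice the median: since \<open>b\<close> at half the volume is the negative of
    \<open>a\<close> there, this is the constant value of the difference of \<open>a\<close> and
    \<open>b\<close>.\<close>
  define \<delta> where "\<delta> = a (?V / 2) + a (?V / 2)"
  have ab: "a s + a (?V - s) = \<delta>" if s: "0 < s" "s < ?V" for s
  proof -
    have V2: "0 < ?V / 2" "?V / 2 < ?V" using vol_pos by auto
    have lnz: "ln s < z" "ln (?V / 2) < z" using s V2 by (simp_all add: z_def)
    have "a s - b s = a (?V / 2) - b (?V / 2)"
    proof (cases "ln s" "ln (?V / 2)" rule: linorder_cases)
      case less
      show ?thesis using inc[OF less lnz(2)] s V2 by (simp only: exp_ln)
    next
      case equal
      then have "s = ?V / 2" using s V2 by (simp only: ln_inj_iff)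
      then show ?thesis by (rule arg_cong)
    next
      case greater
      show ?thesis using inc[OF greater lnz(1)] s V2 by (simp only: exp_ln)
    qed
    then show ?thesis by (simp add: b_def \<delta>_def)
  qed
  have "?\<phi> (\<delta> - \<alpha>) = ?V - ?\<phi> \<alpha>" for \<alpha>
  proof -
    \<comment> \<open>Where the distribution function is 0 or the full volume, \<open>a\<close> does
      not invert it; these cases follow from quantiles at levels s tending to 0.\<close>
    have lim0: "u \<le> w" if "\<And>s. 0 < s \<Longrightarrow> s < ?V \<Longrightarrow> u - s \<le> w" for u w :: real
    proof (rule field_le_epsilon)
      fix e :: real assume "e > 0"
      define s where "s = min e (?V / 2)"
      have "0 < s" "s < ?V" "s \<le> e" using \<open>e > 0\<close> vol_pos by (auto simp: s_def)
      then show "u \<le> w + e" using that[of s] by linarith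
    qed
    consider "0 < ?\<phi> \<alpha> \<and> ?\<phi> \<alpha> < ?V" | "?\<phi> \<alpha> = 0" | "?\<phi> \<alpha> = ?V"
      using cut_bounds[of v \<alpha>] by (metis order_le_imp_less_or_eq)
    then show ?thesis
    proof cases
      case 1
      let ?s = "?\<phi> \<alpha>"
      have "a ?s = \<alpha>" using a_less[of \<alpha> ?s] a_greater[of ?s \<alpha>] 1 by linarith
      then have "\<delta> - \<alpha> = a (?V - ?s)" using ab[of ?s] 1 by simp
      then show ?thesis using a[of "?V - ?s"] 1 by simp
    next
      case 2
      have "?V - s \<le> ?\<phi> (\<delta> - \<alpha>)" if s: "0 < s" "s < ?V" for s
      proof -
        have "\<alpha> \<le> a s" using cut_mono[of "a s" \<alpha> v] a[OF s] 2 s by linarith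
        then have "a (?V - s) \<le> \<delta> - \<alpha>" using ab[OF s] by simp
        then show ?thesis using cut_mono[of "a (?V - s)" "\<delta> - \<alpha>" v] a[of "?V - s"] s by simp
      qed
      then have "?V \<le> ?\<phi> (\<delta> - \<alpha>)" by (rule lim0)
      then show ?thesis using 2 cut_bounds(2)[of v "\<delta> - \<alpha>"] by simp
    next
      case 3
      have "?\<phi> (\<delta> - \<alpha>) - s \<le> 0" if s: "0 < s" "s < ?V" for s
      proof -
        have s': "0 < ?V - s" "?V - s < ?V" using s by auto
        have "a (?V - s) \<le> \<alpha>" using cut_mono[of \<alpha> "a (?V - s)" v] a[OF s'] 3 s' by linarith
        then have "\<delta> - \<alpha> \<le> a s" using ab[OF s] by simp
        then show ?thesis using cut_mono[of "\<delta> - \<alpha>" "a s" v] a[OF s] by simp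
      qed
      then have "?\<phi> (\<delta> - \<alpha>) \<le> 0" by (rule lim0)
      then show ?thesis using 3 cut_bounds(1)[of v "\<delta> - \<alpha>"] by simp
    qed
  qed
  then show ?thesis using that by blast
qed

text \<open>Symmetry of a marginal fixes its centre as its mean, which is linear in the direction,
  so one point g serves all directions. If a reflected point 2g - x left \<open>C\<close>, a
  half-space separating it from \<open>C\<close> would carry no mass; by symmetry the reflected
  half-space would carry none either, yet it contains x in its interior.\<close>

theorem (in convex_volume) centrally_symmetric:
  assumes S: "compact S" "convex S" and S_le: "measure lborel S \<le> measure lborel C"
    and mid: "\<And>x y. x \<in> C \<Longrightarrow> y \<in> C \<Longrightarrow> (1/2) *\<^sub>R (x - y) \<in> S"
  obtains g where "\<And>x. x \<in> C \<Longrightarrow> 2 *\<^sub>R g - x \<in> C"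
proof -
  let ?V = "measure lborel C"
  interpret fm: finite_measure restr by (rule finite_restr)
  have Vr: "measure restr UNIV = ?V" by (simp add: measure_restr)
  have int_id: "integrable restr (\<lambda>x. x)"
  proof -
    obtain R where R: "\<And>x. x \<in> C \<Longrightarrow> norm x \<le> R"
      using compact_imp_bounded[OF comp] unfolding bounded_iff by auto
    have "AE x in restr. x \<in> C" unfolding restr_def by (subst AE_density) (auto simp: indicator_def)
    then have "AE x in restr. norm x \<le> R" by eventually_elim (rule R)
    then show ?thesis by (intro fm.integrable_const_bound) auto
  qed
  define g where "g = (1 / ?V) *\<^sub>R (\<integral>x. x \<partial>restr)"
  have sym: "cut_volume C v (2 * (v \<bullet> g) - \<alpha>) = ?V - cut_volume C v \<alpha>" if v: "v \<noteq> 0" for v \<alpha>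
  proof -
    obtain \<delta> where \<delta>: "\<And>\<alpha>. cut_volume C v (\<delta> - \<alpha>) = ?V - cut_volume C v \<alpha>"
      using marginal_symmetric[OF S S_le mid v] by blast
    have b1: "(\<lambda>x. v \<bullet> x) \<in> borel_measurable borel" and b2: "(\<lambda>x. \<delta> - v \<bullet> x) \<in> borel_measurable borel" by measurable
    have "cdf (distr restr borel (\<lambda>x. v \<bullet> x)) = cdf (distr restr borel (\<lambda>x. \<delta> - v \<bullet> x))"
    proof
      fix \<alpha>
      have "{x. \<delta> - v \<bullet> x \<le> \<alpha>} = {x. v \<bullet> x \<ge> \<delta> - \<alpha>}" by auto
      then show "cdf (distr restr borel (\<lambda>x. v \<bullet> x)) \<alpha> = cdf (distr restr borel (\<lambda>x. \<delta> - v \<bullet> x)) \<alpha>"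
        unfolding cdf_restr(1)[OF b1] cdf_restr(1)[OF b2]
        using cut_complement[OF v, of "\<delta> - \<alpha>"] \<delta>[of \<alpha>] by (simp add: cut_volume_def)
    qed
    then have eq: "distr restr borel (\<lambda>x. v \<bullet> x) = distr restr borel (\<lambda>x. \<delta> - v \<bullet> x)"
      by (intro cdf_unique' cdf_restr(2) b1 b2)
    have "(\<integral>x. v \<bullet> x \<partial>restr) = (\<integral>y. y \<partial>distr restr borel (\<lambda>x. v \<bullet> x))"
      by (subst integral_distr) auto
    also have "\<dots> = (\<integral>x. \<delta> - v \<bullet> x \<partial>restr)" unfolding eq by (subst integral_distr) auto
    also have "\<dots> = \<delta> * ?V - (\<integral>x. v \<bullet> x \<partial>restr)"
      using int_id by (subst Bochner_Integration.integral_diff) (auto simp: Vr)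
    finally have "2 * (v \<bullet> (\<integral>x. x \<partial>restr)) = \<delta> * ?V"
      using int_id by simp
    then have "2 * (v \<bullet> g) = \<delta>" using vol_pos by (simp add: g_def field_simps)
    then show ?thesis using \<delta> by simp
  qed
  have "2 *\<^sub>R g - x \<in> C" if x: "x \<in> C" for x
  proof (rule ccontr)
    assume n: "2 *\<^sub>R g - x \<notin> C"
    obtain w \<alpha> where w: "w \<bullet> (2 *\<^sub>R g - x) < \<alpha>" "\<And>c. c \<in> C \<Longrightarrow> w \<bullet> c > \<alpha>"
      using separating_hyperplane_closed_point[OF conv compact_imp_closed[OF comp] n] by auto
    have w0: "w \<noteq> 0" using w(1) w(2)[OF x] by auto
    have "C \<inter> {x. w \<bullet> x \<le> \<alpha>} = {}" using w(2) by force
    then have "cut_volume C w \<alpha> = 0" by (simp add: cut_volume_def)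
    then have "cut_volume C w (2 * (w \<bullet> g) - \<alpha>) = ?V" using sym[OF w0, of \<alpha>] by simp
    then have z: "measure lborel (C \<inter> {y. w \<bullet> y \<ge> 2 * (w \<bullet> g) - \<alpha>}) = 0"
      using cut_complement[OF w0] by simp
    let ?U = "{y. w \<bullet> y > 2 * (w \<bullet> g) - \<alpha>}"
    have "x \<in> ?U" using w(1) by (simp add: inner_diff_right)
    then have "0 < emeasure lborel (C \<inter> ?U)"
      using x by (intro emeasure_compact_Int_open_pos comp conv emeasure_pos open_halfspace_gt) auto
    also have "\<dots> \<le> emeasure lborel (C \<inter> {y. w \<bullet> y \<ge> 2 * (w \<bullet> g) - \<alpha>})"
      by (intro emeasure_mono) auto
    also have "\<dots> = 0" using z by (simp add: emeasure_eq_ennreal_measure)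
    finally show False by simp
  qed
  then show ?thesis using that by blast
qed

section \<open>Hausdorff measure is a Borel measure\<close>

lemma diameter_isometry_image:
  assumes "\<And>x y. dist (T x) (T y) = dist x y"
  shows "diameter (T ` S) = diameter S"
proof -
  have "(\<lambda>(x, y). dist x y) ` (T ` S \<times> T ` S) = (\<lambda>(x, y). dist x y) ` (S \<times> S)"
    using assms by (auto simp: image_iff) (metis assms)+
  then show ?thesis by (simp add: diameter_def)
qed

abbreviation hausdorff_term :: "real \<Rightarrow> 'a::euclidean_space set \<Rightarrow> ennreal" where
  "hausdorff_term s C \<equiv> ennreal (unit_ball_vol s * (diameter C / 2) powr s)"

abbreviation fine_covers :: "real \<Rightarrow> 'a::euclidean_space set \<Rightarrow> (nat \<Rightarrow> 'a set) set" where
  "fine_covers \<delta> A \<equiv> {C. A \<subseteq> (\<Union>i. C i) \<and> (\<forall>i. bounded (C i) \<and> diameter (C i) \<le> \<delta>)}"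

lemma hausdorff_content_le:
  "C \<in> fine_covers \<delta> A \<Longrightarrow> hausdorff_content s \<delta> A \<le> (\<Sum>i. hausdorff_term s (C i))"
  unfolding hausdorff_content_def by (rule INF_lower)

lemma hausdorff_content_greatest:
  "(\<And>C. C \<in> fine_covers \<delta> A \<Longrightarrow> x \<le> (\<Sum>i. hausdorff_term s (C i))) \<Longrightarrow> x \<le> hausdorff_content s \<delta> A"
  unfolding hausdorff_content_def by (rule INF_greatest)

lemma hausdorff_content_mono: "A \<subseteq> B \<Longrightarrow> hausdorff_content s \<delta> A \<le> hausdorff_content s \<delta> B"
  by (intro hausdorff_content_greatest hausdorff_content_le) auto

lemma hausdorff_content_antimono: "\<delta> \<le> \<delta>' \<Longrightarrow> hausdorff_content s \<delta>' A \<le> hausdorff_content s \<delta> A"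
  by (intro hausdorff_content_greatest hausdorff_content_le) (auto intro: order.trans)

lemma hausdorff_content_le_outer: "\<delta> > 0 \<Longrightarrow> hausdorff_content s \<delta> A \<le> hausdorff_outer s A"
  unfolding hausdorff_outer_def by (rule SUP_upper) simp

lemma hausdorff_outer_least:
  "(\<And>\<delta>. \<delta> > 0 \<Longrightarrow> hausdorff_content s \<delta> A \<le> x) \<Longrightarrow> hausdorff_outer s A \<le> x"
  unfolding hausdorff_outer_def by (rule SUP_least) simp

lemma hausdorff_outer_mono: "A \<subseteq> B \<Longrightarrow> hausdorff_outer s A \<le> hausdorff_outer s B"
  by (rule hausdorff_outer_least) (meson hausdorff_content_le_outer hausdorff_content_mono order.trans)

lemma hausdorff_outer_empty: "hausdorff_outer s ({} :: 'a::euclidean_space set) = 0"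
proof -
  have "hausdorff_outer s ({} :: 'a set) \<le> 0"
  proof (rule hausdorff_outer_least)
    fix \<delta> :: real assume "\<delta> > 0"
    then have "hausdorff_content s \<delta> ({} :: 'a set) \<le> (\<Sum>i::nat. hausdorff_term s ({} :: 'a set))"
      by (intro hausdorff_content_le) auto
    then show "hausdorff_content s \<delta> ({} :: 'a set) \<le> 0" by simp
  qed
  then show ?thesis by simp
qed

lemma hausdorff_content_subadditive:
  fixes A :: "nat \<Rightarrow> 'a::euclidean_space set"
  shows "hausdorff_content s \<delta> (\<Union>i. A i) \<le> (\<Sum>i. hausdorff_content s \<delta> (A i))"
proof (rule ennreal_le_epsilon)
  fix e :: real assume fin: "(\<Sum>i. hausdorff_content s \<delta> (A i)) < top" and e: "e > 0"
  have "\<exists>C. C \<in> fine_covers \<delta> (A i) \<and> (\<Sum>j. hausdorff_term s (C j)) \<le> hausdorff_content s \<delta> (A i) + ennreal (e * (1/2) ^ Suc i)" for i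
  proof (rule ccontr)
    assume n: "\<not> ?thesis"
    have "hausdorff_content s \<delta> (A i) + ennreal (e * (1/2) ^ Suc i) \<le> hausdorff_content s \<delta> (A i)"
    proof (rule hausdorff_content_greatest)
      fix C assume "C \<in> fine_covers \<delta> (A i)"
      then show "hausdorff_content s \<delta> (A i) + ennreal (e * (1/2) ^ Suc i) \<le> (\<Sum>j. hausdorff_term s (C j))"
        using n linear by blast
    qed
    moreover have "hausdorff_content s \<delta> (A i) < top"
      using fin by (rule ennreal_suminf_lessD)
    moreover have "0 < ennreal (e * (1/2) ^ Suc i)" using e by simp
    ultimately show False
      using ennreal_add_left_cancel_le[of "hausdorff_content s \<delta> (A i)" "ennreal (e * (1/2) ^ Suc i)" 0] by auto
  qed
  then have "\<forall>i. \<exists>C. C \<in> fine_covers \<delta> (A i) \<and> (\<Sum>j. hausdorff_term s (C j)) \<le> hausdorff_content s \<delta> (A i) + ennreal (e * (1/2) ^ Suc i)" by (rule allI)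
  from choice[OF this] obtain C where
    "\<forall>i. C i \<in> fine_covers \<delta> (A i) \<and> (\<Sum>j. hausdorff_term s (C i j)) \<le> hausdorff_content s \<delta> (A i) + ennreal (e * (1/2) ^ Suc i)" ..
  then have C: "\<And>i. C i \<in> fine_covers \<delta> (A i)"
    and le: "\<And>i. (\<Sum>j. hausdorff_term s (C i j)) \<le> hausdorff_content s \<delta> (A i) + ennreal (e * (1/2) ^ Suc i)" by (simp_all only:)
  define D where "D k = case_prod C (prod_decode k)" for k
  have "D \<in> fine_covers \<delta> (\<Union>i. A i)"
  proof (intro CollectI conjI allI subsetI)
    fix x assume "x \<in> (\<Union>i. A i)"
    then obtain i where "x \<in> A i" by blast
    then obtain j where "x \<in> C i j" using C[of i] by blast
    then have "x \<in> D (prod_encode (i, j))" by (simp add: D_def)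
    then show "x \<in> (\<Union>k. D k)" by blast
  qed (use C in \<open>auto simp: D_def split: prod.split\<close>)
  then have "hausdorff_content s \<delta> (\<Union>i. A i) \<le> (\<Sum>k. hausdorff_term s (D k))" by (rule hausdorff_content_le)
  also have "\<dots> = (\<Sum>k. (\<lambda>(i, j). hausdorff_term s (C i j)) (prod_decode k))"
    by (simp add: D_def case_prod_beta)
  also have "\<dots> = (\<Sum>i. \<Sum>j. hausdorff_term s (C i j))"
    by (rule suminf_ennreal_2dimen) simp
  also have "\<dots> \<le> (\<Sum>i. hausdorff_content s \<delta> (A i) + ennreal (e * (1/2) ^ Suc i))"
    by (intro suminf_le le) auto
  also have "\<dots> = (\<Sum>i. hausdorff_content s \<delta> (A i)) + (\<Sum>i. ennreal (e * (1/2) ^ Suc i))"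
    by (rule suminf_add[symmetric]) auto
  also have "(\<Sum>i. ennreal (e * (1/2) ^ Suc i)) = ennreal e"
  proof (rule suminf_ennreal_eq)
    show "(\<lambda>i. e * (1/2) ^ Suc i) sums e" using sums_mult[OF power_half_series, of e] by simp
  qed (use e in auto)
  finally show "hausdorff_content s \<delta> (\<Union>i. A i) \<le> (\<Sum>i. hausdorff_content s \<delta> (A i)) + ennreal e" .
qed

lemma outer_measure_space_hausdorff:
  "outer_measure_space UNIV (hausdorff_outer s :: 'a::euclidean_space set \<Rightarrow> ennreal)"
  unfolding outer_measure_space_def
proof (intro conjI)
  let ?f = "hausdorff_outer s :: 'a set \<Rightarrow> ennreal"
  show "positive UNIV ?f" by (simp add: positive_def hausdorff_outer_empty)
  show "increasing UNIV ?f" by (auto simp: increasing_def intro: hausdorff_outer_mono)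
  show "countably_subadditive UNIV ?f"
    unfolding countably_subadditive_def
  proof (intro allI impI)
    fix A :: "nat \<Rightarrow> 'a set"
    show "hausdorff_outer s (\<Union> (range A)) \<le> (\<Sum>i. hausdorff_outer s (A i))"
    proof (rule hausdorff_outer_least)
      fix \<delta> :: real assume \<delta>: "\<delta> > 0"
      have "hausdorff_content s \<delta> (\<Union> (range A)) \<le> (\<Sum>i. hausdorff_content s \<delta> (A i))"
        by (rule hausdorff_content_subadditive)
      also have "\<dots> \<le> (\<Sum>i. hausdorff_outer s (A i))"
        by (intro suminf_le hausdorff_content_le_outer \<delta>) auto
      finally show "hausdorff_content s \<delta> (\<Union> (range A)) \<le> (\<Sum>i. hausdorff_outer s (A i))" .
    qed
  qed
qed

text \<open>In a cover by sets of diameter below \<open>d\<close> no set meets both \<open>A\<close>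
  and \<open>B\<close>, so the cover splits into one of \<open>A\<close> and one of
  \<open>B\<close>. Additivity on separated sets is the hypothesis of Caratheodory's
  criterion.\<close>

lemma hausdorff_outer_separated:
  fixes A B :: "'a::euclidean_space set"
  assumes d: "d > 0" and sep: "\<And>x y. x \<in> A \<Longrightarrow> y \<in> B \<Longrightarrow> d \<le> dist x y"
  shows "hausdorff_outer s A + hausdorff_outer s B \<le> hausdorff_outer s (A \<union> B)"
proof -
  have fine: "hausdorff_content s \<delta> A + hausdorff_content s \<delta> B \<le> hausdorff_content s \<delta> (A \<union> B)" if \<delta>: "\<delta> < d" for \<delta>
  proof (rule hausdorff_content_greatest)
    fix C assume C: "C \<in> fine_covers \<delta> (A \<union> B)"
    define CA where "CA i = (if C i \<inter> A = {} then {} else C i)" for i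
    define CB where "CB i = (if C i \<inter> B = {} then {} else C i)" for i
    have \<delta>0: "0 \<le> \<delta>" using C diameter_ge_0[of "C 0"] by (auto intro: order.trans)
    have disj: "CA i = {} \<or> CB i = {}" for i
    proof (rule ccontr)
      assume "\<not> ?thesis"
      then obtain x y where xy: "x \<in> C i" "x \<in> A" "y \<in> C i" "y \<in> B" by (auto simp: CA_def CB_def split: if_splits)
      then have "dist x y \<le> diameter (C i)" using C by (intro diameter_bounded_bound) auto
      also have "\<dots> < d" using C \<delta> by (auto intro: le_less_trans)
      finally show False using sep[of x y] xy by simp
    qed
    have "CA \<in> fine_covers \<delta> A" "CB \<in> fine_covers \<delta> B"
    proof -
      have CU: "A \<subseteq> (\<Union>i. C i)" "B \<subseteq> (\<Union>i. C i)" using C by auto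
      have "x \<in> (\<Union>i. CA i)" if "x \<in> A" for x
      proof -
        obtain i where "x \<in> C i" using CU(1) \<open>x \<in> A\<close> by auto
        then have "x \<in> CA i" using that by (auto simp: CA_def)
        then show ?thesis by blast
      qed
      moreover have "x \<in> (\<Union>i. CB i)" if "x \<in> B" for x
      proof -
        obtain i where "x \<in> C i" using CU(2) \<open>x \<in> B\<close> by auto
        then have "x \<in> CB i" using that by (auto simp: CB_def)
        then show ?thesis by blast
      qed
      ultimately show "CA \<in> fine_covers \<delta> A" "CB \<in> fine_covers \<delta> B"
        using C \<delta>0 by (auto simp: CA_def CB_def)
    qed
    then have "hausdorff_content s \<delta> A + hausdorff_content s \<delta> B \<le> (\<Sum>i. hausdorff_term s (CA i)) + (\<Sum>i. hausdorff_term s (CB i))"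
      by (intro add_mono hausdorff_content_le)
    also have "\<dots> = (\<Sum>i. hausdorff_term s (CA i) + hausdorff_term s (CB i))" by (rule suminf_add) auto
    also have "\<dots> \<le> (\<Sum>i. hausdorff_term s (C i))"
    proof (intro suminf_le)
      fix i
      show "hausdorff_term s (CA i) + hausdorff_term s (CB i) \<le> hausdorff_term s (C i)"
      proof (cases "CA i = {}")
        case True
        then show ?thesis by (simp add: CB_def)
      next
        case False
        then have "CB i = {}" using disj[of i] by simp
        then show ?thesis by (simp add: CA_def)
      qed
    qed auto
    finally show "hausdorff_content s \<delta> A + hausdorff_content s \<delta> B \<le> (\<Sum>i. hausdorff_term s (C i))" .
  qed
  have both: "hausdorff_content s \<delta>1 A + hausdorff_content s \<delta>2 B \<le> hausdorff_outer s (A \<union> B)" if "\<delta>1 > 0" "\<delta>2 > 0" for \<delta>1 \<delta>2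
  proof -
    \<comment> \<open>The content grows as the scale shrinks, so one scale below both given ones and
      below \<open>d\<close> serves the two sets at once.\<close>
    define \<delta> where "\<delta> = min (min \<delta>1 \<delta>2) (d / 2)"
    have \<delta>: "0 < \<delta>" "\<delta> < d" "\<delta> \<le> \<delta>1" "\<delta> \<le> \<delta>2" using that d by (auto simp: \<delta>_def)
    have "hausdorff_content s \<delta>1 A + hausdorff_content s \<delta>2 B \<le> hausdorff_content s \<delta> A + hausdorff_content s \<delta> B"
      using \<delta> by (intro add_mono hausdorff_content_antimono)
    also have "\<dots> \<le> hausdorff_content s \<delta> (A \<union> B)" using fine \<delta> by simp
    also have "\<dots> \<le> hausdorff_outer s (A \<union> B)" using \<delta> by (intro hausdorff_content_le_outer)
    finally show ?thesis .
  qed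
  have ne: "{0<..} \<noteq> ({} :: real set)" by (metis empty_iff greaterThan_iff zero_less_one)
  have "hausdorff_outer s A + hausdorff_content s \<delta>2 B \<le> hausdorff_outer s (A \<union> B)" if "\<delta>2 > 0" for \<delta>2
    unfolding hausdorff_outer_def[of s A]
    by (subst ennreal_SUP_add_left[symmetric, OF ne]) (auto intro!: SUP_least both that)
  then show ?thesis
    unfolding hausdorff_outer_def[of s B]
    by (subst add.commute, subst ennreal_SUP_add_left[symmetric, OF ne]) (auto intro!: SUP_least simp: add.commute)
qed

text \<open>Caratheodory's criterion: closed sets are measurable for a metric outer measure. The layers
  \<open>R i\<close> of points at distance between \<open>1/(i+2)\<close> and \<open>1/(i+1)\<close> from the closed set have
  summable measure, because every second layer is separated from the previous ones.\<close>

lemma closed_in_lambda_system: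
  fixes f :: "'a::metric_space set \<Rightarrow> ennreal"
  assumes oms: "outer_measure_space UNIV f" and A: "closed A"
    and sep: "\<And>X Y d. d > 0 \<Longrightarrow> (\<And>x y. x \<in> X \<Longrightarrow> y \<in> Y \<Longrightarrow> d \<le> dist x y) \<Longrightarrow> f X + f Y \<le> f (X \<union> Y)"
  shows "A \<in> lambda_system UNIV UNIV f"
proof -
  have f0: "f {} = 0" and mono: "f X \<le> f Y" if "X \<subseteq> Y" for X Y
    using oms that by (auto simp: outer_measure_space_def positive_def increasing_def)
  note f0 = f0[OF subset_refl]
  have csub: "f (\<Union>i. B i) \<le> (\<Sum>i. f (B i))" for B :: "nat \<Rightarrow> 'a set"
  proof -
    have "f (\<Union>i. disjointed B i) \<le> (\<Sum>i. f (disjointed B i))"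
      using oms disjoint_family_disjointed[of B]
      by (simp add: outer_measure_space_def countably_subadditive_def)
    also have "\<dots> \<le> (\<Sum>i. f (B i))" by (intro suminf_le mono disjointed_subset) auto
    finally show ?thesis by (simp add: UN_disjointed_eq)
  qed
  have sub2: "f (X \<union> Y) \<le> f X + f Y" for X Y
  proof -
    have "f (X \<union> Y) \<le> (\<Sum>i. f (if i = 0 then X else if i = Suc 0 then Y else {}))"
      using csub[of "\<lambda>i. if i = 0 then X else if i = Suc 0 then Y else {}"] by (rule order.trans[OF mono, rotated]) auto
    also have "\<dots> = (\<Sum>i\<in>{0, Suc 0}. f (if i = 0 then X else if i = Suc 0 then Y else {}))"
      by (rule suminf_finite) (auto simp: f0)
    finally show ?thesis by simp
  qed
  have main: "f (X \<inter> A) + f (X - A) \<le> f X" for X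
  proof (cases "f X = top \<or> A = {}")
    case True
    then show ?thesis by (auto simp: f0)
  next
    case False
    then have fin: "f X < top" and ne: "A \<noteq> {}" by (auto simp: less_top)
    define B where "B j = {x\<in>X. infdist x A \<ge> 1 / real (Suc j)}" for j
    define R where "R j = B (Suc j) - B j" for j
    have Bmono: "B j \<subseteq> B (Suc j)" for j
    proof -
      have "1 / real (Suc (Suc j)) \<le> 1 / real (Suc j)" by (intro divide_left_mono) auto
      then show ?thesis by (auto simp: B_def intro: order.trans)
    qed
    have BX: "B j \<subseteq> X" "B j \<subseteq> X - A" for j using ne by (auto simp: B_def)
    have step: "f (B i) + f (R (Suc i)) \<le> f (B (Suc (Suc i)))" for i
    proof -
      let ?d = "1 / real (Suc i) - 1 / real (Suc (Suc i))"
      have "f (B i) + f (R (Suc i)) \<le> f (B i \<union> R (Suc i))"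
      proof (rule sep[of ?d])
        have "1 / real (Suc (Suc i)) < 1 / real (Suc i)" by (intro divide_strict_left_mono) auto
        then show "?d > 0" by simp
        fix x y assume "x \<in> B i" "y \<in> R (Suc i)"
        then have "infdist x A \<ge> 1 / real (Suc i)" "infdist y A < 1 / real (Suc (Suc i))"
          by (auto simp: B_def R_def)
        then show "?d \<le> dist x y" using infdist_triangle[of x A y] by simp
      qed
      also have "\<dots> \<le> f (B (Suc (Suc i)))"
        using Bmono[of i] Bmono[of "Suc i"] by (intro mono) (auto simp: R_def)
      finally show ?thesis .
    qed
    \<comment> \<open>The two consecutive sets on the right absorb the even and the odd layers
      separately.\<close>
    have "(\<Sum>i<N. f (R (Suc i))) \<le> f (B N) + f (B (Suc N))" for N
    proof (induction N)
      case (Suc N)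
      have "(\<Sum>i<Suc N. f (R (Suc i))) \<le> f (B N) + f (B (Suc N)) + f (R (Suc N))"
        using add_right_mono[OF Suc, of "f (R (Suc N))"] by simp
      also have "\<dots> = (f (B N) + f (R (Suc N))) + f (B (Suc N))" by (simp add: ac_simps)
      also have "\<dots> \<le> f (B (Suc (Suc N))) + f (B (Suc N))" by (rule add_right_mono[OF step])
      finally show ?case by (simp add: add.commute)
    qed simp
    then have "(\<Sum>i<N. f (R (Suc i))) \<le> f X + f X" for N
      using add_mono[OF mono[OF BX(1)[of N]] mono[OF BX(1)[of "Suc N"]]] by (meson order.trans)
    then have "(\<Sum>i. f (R (Suc i))) \<le> f X + f X"
      by (intro suminf_le_const) auto
    also have "\<dots> < top" using fin by (simp add: less_top)
    finally have sfin: "(\<Sum>i. f (R (Suc i))) \<noteq> top" by (simp add: less_top)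
    have term_fin: "f (R (Suc i)) \<noteq> top" for i
    proof -
      have "R (Suc i) \<subseteq> X" using BX(1)[of "Suc (Suc i)"] by (auto simp: R_def)
      then show ?thesis using mono[of "R (Suc i)" X] fin by (auto simp: top_unique)
    qed
    define r where "r i = enn2real (f (R (Suc i)))" for i
    have fr: "f (R (Suc i)) = ennreal (r i)" and r0: "r i \<ge> 0" for i
      using term_fin[of i] by (simp_all add: r_def less_top)
    have summ: "summable r"
      using sfin r0 unfolding fr by (rule_tac summable_suminf_not_top) auto
    show ?thesis
    proof (rule ennreal_le_epsilon)
      fix e :: real assume e: "e > 0"
      obtain N where N: "\<And>n. n \<ge> N \<Longrightarrow> norm (\<Sum>i. r (i + n)) < e"
        using suminf_exist_split[OF e summ] by blast
      \<comment> \<open>Closedness of \<open>A\<close> gives every point outside it a positive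
        distance, so the layers exhaust the rest.\<close>
      have "X - A \<subseteq> B (Suc N) \<union> (\<Union>i. R (Suc (i + N)))"
      proof
        fix x assume x: "x \<in> X - A"
        then have "infdist x A > 0" using A ne by (metis DiffE in_closed_iff_infdist_zero infdist_nonneg less_eq_real_def)
        then obtain m where "1 / real (Suc m) < infdist x A" using reals_Archimedean by (auto simp: inverse_eq_divide)
        then have m: "x \<in> B m" using x by (auto simp: B_def)
        show "x \<in> B (Suc N) \<union> (\<Union>i. R (Suc (i + N)))"
        proof (rule ccontr)
          assume n: "x \<notin> B (Suc N) \<union> (\<Union>i. R (Suc (i + N)))"
          have "x \<notin> B (Suc N + k)" for k
          proof (induction k)
            case (Suc k)
            then show ?case using n by (auto simp: R_def add.commute)
          qed (use n in simp)
          moreover have "x \<in> B (m + k)" for k by (induction k) (use m Bmono in auto)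
          ultimately show False by (metis add.commute)
        qed
      qed
      then have "f (X - A) \<le> f (B (Suc N)) + f (\<Union>i. R (Suc (i + N)))"
        using mono sub2 order.trans by blast
      also have "f (\<Union>i. R (Suc (i + N))) \<le> (\<Sum>i. f (R (Suc (i + N))))" by (rule csub)
      also have "\<dots> = ennreal (\<Sum>i. r (i + N))"
        unfolding fr using summ r0 by (intro suminf_ennreal2) (auto simp: summable_iff_shift)
      also have "\<dots> \<le> ennreal e" using N[of N] by (intro ennreal_leI) auto
      finally have 1: "f (X - A) \<le> f (B (Suc N)) + ennreal e" by (simp add: add_left_mono)
      have "f (X \<inter> A) + f (B (Suc N)) \<le> f ((X \<inter> A) \<union> B (Suc N))"
      proof (rule sep[of "1 / real (Suc (Suc N))"])
        fix x y assume "x \<in> X \<inter> A" "y \<in> B (Suc N)"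
        then show "1 / real (Suc (Suc N)) \<le> dist x y"
          using infdist_le[of x A y] by (auto simp: B_def dist_commute)
      qed simp
      also have "\<dots> \<le> f X" using BX(1) by (intro mono) auto
      finally have "f (X \<inter> A) + f (B (Suc N)) \<le> f X" .
      then have 2: "f (X \<inter> A) + f (B (Suc N)) + ennreal e \<le> f X + ennreal e" by (rule add_right_mono)
      have "f (X \<inter> A) + f (X - A) \<le> f (X \<inter> A) + (f (B (Suc N)) + ennreal e)" by (rule add_left_mono[OF 1])
      also have "\<dots> = f (X \<inter> A) + f (B (Suc N)) + ennreal e" by (rule add.assoc[symmetric])
      also note 2
      finally show "f (X \<inter> A) + f (X - A) \<le> f X + ennreal e" .
    qed
  qed
  have "f (A \<inter> X) + f ((UNIV - A) \<inter> X) = f X" for X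
  proof (rule antisym)
    have "A \<inter> X = X \<inter> A" "(UNIV - A) \<inter> X = X - A" by auto
    then show "f (A \<inter> X) + f ((UNIV - A) \<inter> X) \<le> f X" using main[of X] by simp
    have "f X = f ((A \<inter> X) \<union> ((UNIV - A) \<inter> X))" by (rule arg_cong[of _ _ f]) auto
    also have "\<dots> \<le> f (A \<inter> X) + f ((UNIV - A) \<inter> X)" by (rule sub2)
    finally show "f X \<le> f (A \<inter> X) + f ((UNIV - A) \<inter> X)" .
  qed
  then show ?thesis by (simp add: lambda_system_def)
qed

lemma sets_hausdorff_measure [simp, measurable_cong]: "sets (hausdorff_measure s) = sets borel"
  and space_hausdorff_measure [simp]: "space (hausdorff_measure s) = UNIV"
  unfolding hausdorff_measure_def
  by (simp_all add: sigma_algebra.sets_measure_of_eq[OF sets.sigma_algebra_axioms[of borel, simplified]]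
     space_measure_of_conv)

text \<open>\<open>measure_of\<close> returns the set function only if it is countably additive on
  the sigma-algebra, and the zero measure otherwise. Caratheodory's theorem provides additivity on a
  sigma-algebra that contains all closed sets.\<close>

lemma emeasure_hausdorff_measure:
  fixes A :: "'a::euclidean_space set"
  assumes A: "A \<in> sets borel"
  shows "emeasure (hausdorff_measure s) A = hausdorff_outer s A"
proof -
  let ?f = "hausdorff_outer s :: 'a set \<Rightarrow> ennreal"
  interpret sigma_algebra "UNIV :: 'a set" UNIV using sigma_algebra_Pow[of "UNIV :: 'a set"] by simp
  have "measure_space UNIV (lambda_system UNIV UNIV ?f) ?f"
    using caratheodory_lemma[OF outer_measure_space_hausdorff] .
  then have ls: "sigma_algebra UNIV (lambda_system UNIV UNIV ?f)" "countably_additive (lambda_system UNIV UNIV ?f) ?f"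
    by (auto simp: measure_space_def)
  have "sets (borel :: 'a measure) \<subseteq> lambda_system UNIV UNIV ?f"
  proof -
    have "sets (borel :: 'a measure) = sigma_sets UNIV (Collect closed)"
      by (simp add: borel_eq_closed)
    also have "\<dots> \<subseteq> lambda_system UNIV UNIV ?f"
    proof (intro sigma_algebra.sigma_sets_subset[OF ls(1)] subsetI)
      fix A :: "'a set" assume "A \<in> Collect closed"
      then show "A \<in> lambda_system UNIV UNIV ?f"
        by (intro closed_in_lambda_system outer_measure_space_hausdorff) (auto intro: hausdorff_outer_separated)
    qed
    finally show ?thesis .
  qed
  then have "countably_additive (sets borel) ?f"
    using ls(2) unfolding countably_additive_def by (meson order.trans subsetD)
  moreover have "positive (sets borel) ?f" by (simp add: positive_def hausdorff_outer_empty)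
  ultimately show ?thesis
    unfolding hausdorff_measure_def
    using A sets.sigma_algebra_axioms[of "borel :: 'a measure"] by (intro emeasure_measure_of_sigma) simp_all
qed

section \<open>Invariance of Hausdorff measure under isometries\<close>

lemma hausdorff_outer_isometry:
  fixes T :: "'a::euclidean_space \<Rightarrow> 'a"
  assumes iso: "\<And>x y. dist (T x) (T y) = dist x y"
  shows "hausdorff_outer s (T ` A) \<le> hausdorff_outer s A"
proof (rule hausdorff_outer_least)
  fix \<delta> :: real assume \<delta>: "\<delta> > 0"
  have "hausdorff_content s \<delta> (T ` A) \<le> hausdorff_content s \<delta> A"
  proof (rule hausdorff_content_greatest)
    fix C assume C: "C \<in> fine_covers \<delta> A"
    have "bounded (T ` C i)" for i
    proof -
      obtain a e where "\<forall>y\<in>C i. dist a y \<le> e" using C unfolding bounded_def by blast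
      then have "\<forall>y\<in>T ` C i. dist (T a) y \<le> e" using iso by simp
      then show ?thesis unfolding bounded_def by blast
    qed
    then have "(\<lambda>i. T ` C i) \<in> fine_covers \<delta> (T ` A)"
      using C diameter_isometry_image[of T, OF iso] by (auto simp: image_UN[symmetric])
    then have "hausdorff_content s \<delta> (T ` A) \<le> (\<Sum>i. hausdorff_term s (T ` C i))" by (rule hausdorff_content_le)
    then show "hausdorff_content s \<delta> (T ` A) \<le> (\<Sum>i. hausdorff_term s (C i))"
      by (simp add: diameter_isometry_image[of T, OF iso])
  qed
  also have "\<dots> \<le> hausdorff_outer s A" using \<delta> by (rule hausdorff_content_le_outer)
  finally show "hausdorff_content s \<delta> (T ` A) \<le> hausdorff_outer s A" .
qed

lemma hausdorff_outer_orthogonal: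
  fixes T :: "'a::euclidean_space \<Rightarrow> 'a"
  assumes T: "orthogonal_transformation T"
  shows "hausdorff_outer s (T ` A) = hausdorff_outer s A"
proof (rule antisym)
  have iso: "dist (T x) (T y) = dist x y" for x y
    using T orthogonal_transformation_isometry by blast
  show "hausdorff_outer s (T ` A) \<le> hausdorff_outer s A" by (rule hausdorff_outer_isometry[OF iso])
  obtain T' where T': "\<And>y. T (T' y) = y" using orthogonal_transformation_surj[OF T] by (metis surjD)
  have inj: "T' (T x) = x" for x using iso[of "T' (T x)" x] T'[of "T x"] by simp
  have "dist (T' x) (T' y) = dist x y" for x y using iso[of "T' x" "T' y"] T' by simp
  then have "hausdorff_outer s (T' ` T ` A) \<le> hausdorff_outer s (T ` A)" by (rule hausdorff_outer_isometry)
  then show "hausdorff_outer s A \<le> hausdorff_outer s (T ` A)" by (simp add: image_image inj)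
qed

lemma indicator_ball_borel_measurable [measurable, simp]:
  fixes x :: "'a::euclidean_space"
  shows "(indicator (ball x r) :: 'a \<Rightarrow> ennreal) \<in> borel_measurable borel"
    "(indicator (cball x r) :: 'a \<Rightarrow> ennreal) \<in> borel_measurable borel"
    "(indicator (sphere x r) :: 'a \<Rightarrow> ennreal) \<in> borel_measurable borel"
  by (intro borel_measurable_indicator, simp)+

lemma emeasure_ball_not_top [simp]:
  "emeasure lborel (ball c r) \<noteq> top" "emeasure lborel (cball c r) \<noteq> top"
  using emeasure_lborel_ball_finite[of c r] emeasure_lborel_cball_finite[of c r] by auto

section \<open>Uniformly distributed measures are proportional\<close>

text \<open>Christensen's argument: exchange the order of integration in the measure of the pairs
  \<open>(x, y)\<close> in \<open>U \<times> U\<close> at distance less than \<open>1/j\<close>, then apply Fatou's lemma.\<close>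

lemma uniform_measure_open_le:
  fixes M N :: "'a::euclidean_space measure"
  assumes sM: "sets M = sets borel" and sN: "sets N = sets borel"
    and fM: "finite_measure M" and fN: "finite_measure N"
    and MS: "AE x in M. x \<in> S" and NS: "AE x in N. x \<in> S"
    and M: "\<And>x r. x \<in> S \<Longrightarrow> r > 0 \<Longrightarrow> emeasure M (ball x r) = ennreal (g r)"
    and N: "\<And>x r. x \<in> S \<Longrightarrow> r > 0 \<Longrightarrow> emeasure N (ball x r) = ennreal (h r)"
    and pos: "\<And>r. r > 0 \<Longrightarrow> g r > 0" "\<And>r. r > 0 \<Longrightarrow> h r > 0"
    and U: "open U"
  shows "emeasure M U \<le> liminf (\<lambda>j. ennreal (g (1 / real (Suc j)) / h (1 / real (Suc j))) * emeasure N U)"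
proof -
  interpret M: finite_measure M by fact
  interpret N: finite_measure N by fact
  interpret pair_sigma_finite M N ..
  note [measurable_cong] = sM sN
  have [measurable]: "U \<in> sets borel" using U by simp
  define r where "r j = 1 / real (Suc j)" for j
  have r: "r j > 0" for j by (simp add: r_def)
  define K where "K j = (\<lambda>x y. indicator U x * indicator U y * (if dist x y < r j then 1 else 0) :: ennreal)" for j
  have Km: "(\<lambda>(x, y). K j x y) \<in> borel_measurable (M \<Otimes>\<^sub>M N)" for j
    unfolding K_def case_prod_beta by measurable
  have Km1: "K j x \<in> borel_measurable N" "(\<lambda>x. K j x y) \<in> borel_measurable M" for j x y
    unfolding K_def by measurable
  \<comment> \<open>For \<open>x\<close> in \<open>U\<close> this is the share of the ball of radius
    \<open>r j\<close> around \<open>x\<close> that lies in \<open>U\<close>, measured by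
    \<open>N\<close>; it equals 1 as soon as the ball is inside \<open>U\<close>.\<close>
  define u where "u j x = ennreal (1 / h (r j)) * (\<integral>\<^sup>+y. K j x y \<partial>N)" for j x
  have um: "u j \<in> borel_measurable M" for j
    unfolding u_def using N.borel_measurable_nn_integral_fst[OF Km[of j]]
    by (intro borel_measurable_times_ennreal) simp_all
  have "emeasure M U = (\<integral>\<^sup>+x. indicator U x \<partial>M)" using sM U by (subst nn_integral_indicator) auto
  also have "\<dots> \<le> (\<integral>\<^sup>+x. liminf (\<lambda>j. u j x) \<partial>M)"
    using MS
  proof (intro nn_integral_mono_AE, elim eventually_mono)
    fix x assume xS: "x \<in> S"
    show "indicator U x \<le> liminf (\<lambda>j. u j x)"
    proof (cases "x \<in> U")
      case True
      then obtain e where e: "e > 0" "ball x e \<subseteq> U" using U openE by blast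
      have "r \<longlonglongrightarrow> 0" unfolding r_def using LIMSEQ_inverse_real_of_nat by (simp add: inverse_eq_divide)
      then have "eventually (\<lambda>j. r j < e) sequentially" using e(1) by (rule order_tendstoD)
      then have "eventually (\<lambda>j. 1 \<le> u j x) sequentially"
      proof eventually_elim
        case (elim j)
        have "(\<integral>\<^sup>+y. K j x y \<partial>N) = (\<integral>\<^sup>+y. indicator (ball x (r j)) y \<partial>N)"
          using True e(2) elim by (intro nn_integral_cong) (auto simp: K_def indicator_def subset_eq)
        also have "\<dots> = ennreal (h (r j))" using N[OF xS r] sN by (subst nn_integral_indicator) auto
        finally have "u j x = ennreal (1 / h (r j)) * ennreal (h (r j))" by (simp add: u_def)
        also have "\<dots> = 1" using pos(2)[OF r[of j]] by (subst ennreal_mult[symmetric]) auto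
        finally show ?case by simp
      qed
      then have "1 \<le> liminf (\<lambda>j. u j x)" by (rule Liminf_bounded)
      then show ?thesis using True by simp
    qed simp
  qed
  also have "\<dots> \<le> liminf (\<lambda>j. \<integral>\<^sup>+x. u j x \<partial>M)" by (rule nn_integral_liminf[OF um])
  also have "\<dots> \<le> liminf (\<lambda>j. ennreal (g (r j) / h (r j)) * emeasure N U)"
  proof (rule Liminf_mono, rule always_eventually, rule allI)
    fix j
    have "(\<integral>\<^sup>+x. u j x \<partial>M) = ennreal (1 / h (r j)) * (\<integral>\<^sup>+x. (\<integral>\<^sup>+y. K j x y \<partial>N) \<partial>M)"
      unfolding u_def using N.borel_measurable_nn_integral_fst[OF Km[of j]] by (intro nn_integral_cmult) simp
    also have "(\<integral>\<^sup>+x. (\<integral>\<^sup>+y. K j x y \<partial>N) \<partial>M) = (\<integral>\<^sup>+y. (\<integral>\<^sup>+x. K j x y \<partial>M) \<partial>N)"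
      by (rule Fubini'[symmetric, OF Km])
    also have "\<dots> \<le> (\<integral>\<^sup>+y. ennreal (g (r j)) * indicator U y \<partial>N)"
      using NS
    proof (intro nn_integral_mono_AE, elim eventually_mono)
      fix y assume yS: "y \<in> S"
      have "(\<integral>\<^sup>+x. K j x y \<partial>M) \<le> (\<integral>\<^sup>+x. indicator (ball y (r j)) x * indicator U y \<partial>M)"
        by (intro nn_integral_mono) (auto simp: K_def indicator_def dist_commute)
      also have "\<dots> = emeasure M (ball y (r j)) * indicator U y"
      proof -
        have "(indicator (ball y (r j)) :: 'a \<Rightarrow> ennreal) \<in> borel_measurable M" by measurable
        then show ?thesis using sM by (simp add: nn_integral_multc)
      qed
      also have "\<dots> = ennreal (g (r j)) * indicator U y" using M[OF yS r] by simp
      finally show "(\<integral>\<^sup>+x. K j x y \<partial>M) \<le> ennreal (g (r j)) * indicator U y" .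
    qed
    also have "\<dots> = ennreal (g (r j)) * emeasure N U"
      using sN U by (subst nn_integral_cmult_indicator) auto
    finally have "(\<integral>\<^sup>+x. u j x \<partial>M) \<le> ennreal (1 / h (r j)) * (ennreal (g (r j)) * emeasure N U)"
      by (simp add: mult_left_mono)
    also have "\<dots> = ennreal (g (r j) / h (r j)) * emeasure N U"
      using pos[OF r[of j]] by (simp add: mult.assoc[symmetric] ennreal_mult[symmetric])
    finally show "(\<integral>\<^sup>+x. u j x \<partial>M) \<le> ennreal (g (r j) / h (r j)) * emeasure N U" .
  qed
  finally show ?thesis by (simp add: r_def)
qed

text \<open>The ratio c_j of the masses of small balls has to be eliminated. With m and n the total
  masses, the bound of \<open>uniform_measure_open_le\<close> for the exchanged pair on the whole
  space gives c_j \<le> m / y eventually, for each y < n; this is inserted into the bound for the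
  pair itself on \<open>U\<close>, and y tends to n.\<close>

lemma uniform_measures_open_le:
  fixes M N :: "'a::euclidean_space measure"
  assumes sM: "sets M = sets borel" and sN: "sets N = sets borel"
    and fM: "finite_measure M" and fN: "finite_measure N"
    and MS: "AE x in M. x \<in> S" and NS: "AE x in N. x \<in> S"
    and M: "\<And>x r. x \<in> S \<Longrightarrow> r > 0 \<Longrightarrow> emeasure M (ball x r) = ennreal (g r)"
    and N: "\<And>x r. x \<in> S \<Longrightarrow> r > 0 \<Longrightarrow> emeasure N (ball x r) = ennreal (h r)"
    and pos: "\<And>r. r > 0 \<Longrightarrow> g r > 0" "\<And>r. r > 0 \<Longrightarrow> h r > 0"
    and mpos: "measure M UNIV > 0" "measure N UNIV > 0"
    and U: "open U"
  shows "measure M U * measure N UNIV \<le> measure N U * measure M UNIV"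
proof -
  interpret M: finite_measure M by fact
  interpret N: finite_measure N by fact
  define c where "c j = g (1 / real (Suc j)) / h (1 / real (Suc j))" for j
  have c: "c j > 0" for j unfolding c_def using pos by (intro divide_pos_pos) auto
  let ?m = "measure M UNIV" and ?n = "measure N UNIV"
  have le1: "ennreal (measure M U) \<le> liminf (\<lambda>j. ennreal (c j * measure N U))"
    using uniform_measure_open_le[OF sM sN fM fN MS NS M N pos U]
    unfolding c_def[symmetric] M.emeasure_eq_measure N.emeasure_eq_measure
    by (simp only: ennreal_mult''[OF measure_nonneg])
  have le2: "ennreal ?n \<le> liminf (\<lambda>j. ennreal (?m / c j))"
  proof -
    have "?m / c j = h (1 / real (Suc j)) / g (1 / real (Suc j)) * ?m" for j by (simp add: c_def)
    then show ?thesis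
      using uniform_measure_open_le[OF sN sM fN fM NS MS N M pos(2,1) open_UNIV]
      unfolding M.emeasure_eq_measure N.emeasure_eq_measure
      by (simp only: ennreal_mult''[OF measure_nonneg])
  qed
  have bound: "measure M U * y \<le> ?m * measure N U" if y: "0 < y" "y < ?n" for y
  proof -
    have "ennreal y < ennreal ?n" using y by (simp add: ennreal_less_iff)
    then have "eventually (\<lambda>j. ennreal y < ennreal (?m / c j)) sequentially"
      using le2 unfolding le_Liminf_iff by blast
    then have "eventually (\<lambda>j. ennreal (c j * measure N U) \<le> ennreal (?m / y * measure N U)) sequentially"
    proof eventually_elim
      case (elim j)
      then have "y < ?m / c j" using y by (simp add: ennreal_less_iff)
      then have "c j \<le> ?m / y" using c[of j] y by (simp add: field_simps)
      then show ?case by (intro ennreal_leI mult_right_mono) auto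
    qed
    then have "limsup (\<lambda>j. ennreal (c j * measure N U)) \<le> ennreal (?m / y * measure N U)"
      by (rule Limsup_bounded)
    then have "ennreal (measure M U) \<le> ennreal (?m / y * measure N U)"
      using le1 Liminf_le_Limsup[of sequentially "\<lambda>j. ennreal (c j * measure N U)"] by auto
    then have "measure M U \<le> ?m / y * measure N U" using y by (simp add: ennreal_le_iff)
    then show ?thesis using y by (simp add: field_simps)
  qed
  have "measure M U * ?n \<le> ?m * measure N U"
  proof (rule tendsto_upperbound)
    show "((\<lambda>y. measure M U * y) \<longlongrightarrow> measure M U * ?n) (at_left ?n)" by (intro tendsto_intros)
    show "eventually (\<lambda>y. measure M U * y \<le> ?m * measure N U) (at_left ?n)"
      using eventually_at_left_real[OF mpos(2)] by (rule eventually_mono) (use bound in auto)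
  qed simp
  then show ?thesis by (simp add: mult.commute)
qed

theorem uniform_measures_proportional:
  fixes M N :: "'a::euclidean_space measure"
  assumes sM: "sets M = sets borel" and sN: "sets N = sets borel"
    and fM: "finite_measure M" and fN: "finite_measure N"
    and MS: "AE x in M. x \<in> S" and NS: "AE x in N. x \<in> S"
    and M: "\<And>x r. x \<in> S \<Longrightarrow> r > 0 \<Longrightarrow> emeasure M (ball x r) = ennreal (g r)"
    and N: "\<And>x r. x \<in> S \<Longrightarrow> r > 0 \<Longrightarrow> emeasure N (ball x r) = ennreal (h r)"
    and pos: "\<And>r. r > 0 \<Longrightarrow> g r > 0" "\<And>r. r > 0 \<Longrightarrow> h r > 0"
    and mpos: "measure M UNIV > 0" "measure N UNIV > 0"
  shows "M = scale_measure (ennreal (measure M UNIV / measure N UNIV)) N"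
proof -
  interpret M: finite_measure M by fact
  interpret N: finite_measure N by fact
  have eq: "measure M U = measure M UNIV / measure N UNIV * measure N U" if "open U" for U
    using uniform_measures_open_le[OF sM sN fM fN MS NS M N pos mpos that]
      uniform_measures_open_le[OF sN sM fN fM NS MS N M pos(2,1) mpos(2,1) that] mpos
    by (simp add: field_simps)
  show ?thesis
  proof (rule measure_eqI_generator_eq[where E="Collect open" and \<Omega>=UNIV and A="\<lambda>_. UNIV"])
    show "Int_stable (Collect open)" by (auto simp: Int_stable_def)
    show "emeasure M X = emeasure (scale_measure (ennreal (measure M UNIV / measure N UNIV)) N) X" if "X \<in> Collect open" for X
      using that eq[of X] mpos by (simp add: M.emeasure_eq_measure N.emeasure_eq_measure ennreal_mult[symmetric])
  qed (use sM sN in \<open>auto simp: borel_def M.emeasure_eq_measure\<close>)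
qed

section \<open>Hausdorff measure on the sphere\<close>

text \<open>The mass of a part of the sphere is the volume of the cone over it in the unit ball, so
  rotation invariance is inherited from Lebesgue measure. The origin goes to the default value 0 off
  the sphere, which concerns a null set.\<close>

definition cone_measure :: "'a::euclidean_space measure" where
  "cone_measure = distr (density lborel (indicator (cball 0 1))) borel (\<lambda>x. x /\<^sub>R norm x)"

lemma sets_cone_measure [simp, measurable_cong]: "sets cone_measure = sets borel"
  and space_cone_measure [simp]: "space cone_measure = UNIV"
  by (simp_all add: cone_measure_def)

lemma nn_integral_cone_measure:
  assumes [measurable]: "f \<in> borel_measurable borel"
  shows "(\<integral>\<^sup>+u. f u \<partial>cone_measure) = (\<integral>\<^sup>+x. indicator (cball 0 1) x * f (x /\<^sub>R norm x) \<partial>lborel)"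
  unfolding cone_measure_def by (simp add: nn_integral_distr nn_integral_density)

lemma emeasure_cone_measure:
  assumes [measurable]: "A \<in> sets borel"
  shows "emeasure cone_measure A = emeasure lborel {x \<in> cball 0 1. x /\<^sub>R norm x \<in> A}"
proof -
  have "emeasure cone_measure A = (\<integral>\<^sup>+u. indicator A u \<partial>cone_measure)" by simp
  also have "\<dots> = (\<integral>\<^sup>+x. indicator (cball 0 1) x * indicator A (x /\<^sub>R norm x) \<partial>lborel)"
    by (rule nn_integral_cone_measure) simp
  also have "\<dots> = (\<integral>\<^sup>+x. indicator {x \<in> cball 0 1. x /\<^sub>R norm x \<in> A} x \<partial>lborel)"
    by (intro nn_integral_cong) (auto simp: indicator_def)
  also have "\<dots> = emeasure lborel {x \<in> cball 0 1. x /\<^sub>R norm x \<in> A}"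
    by (rule nn_integral_indicator) measurable
  finally show ?thesis .
qed

lemma AE_cone_measure_sphere: "AE u in cone_measure. u \<in> sphere (0::'a::euclidean_space) 1"
proof -
  have "AE x in density lborel (indicator (cball (0::'a) 1)). x \<noteq> (0::'a)"
    using AE_lborel_singleton[of "0::'a"] by (subst AE_density) (auto elim: eventually_mono)
  then have "AE x in density lborel (indicator (cball (0::'a) 1)). x /\<^sub>R norm x \<in> sphere 0 1"
    by eventually_elim simp
  then show ?thesis
    unfolding cone_measure_def by (subst AE_distr_iff) simp_all
qed

lemma finite_cone_measure: "finite_measure (cone_measure :: 'a::euclidean_space measure)"
proof (rule finite_measureI)
  have "emeasure cone_measure (UNIV :: 'a set) = emeasure lborel (cball (0::'a) 1)"
    by (subst emeasure_cone_measure) (auto intro!: arg_cong[where f="emeasure lborel"])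
  then show "emeasure cone_measure (space (cone_measure :: 'a measure)) \<noteq> \<infinity>"
    using emeasure_lborel_cball_finite[of "0::'a" 1] by simp
qed

text \<open>The reflection in the hyperplane orthogonal to x - y exchanges two vectors of equal
  norm.\<close>

lemma orthogonal_transformation_sphere_transitive:
  fixes x y :: "'a::euclidean_space"
  assumes "norm x = norm y"
  obtains T where "orthogonal_transformation T" "T x = y"
proof (cases "x = y")
  case True
  then show ?thesis using that[of "\<lambda>z. z"] orthogonal_transformation_id by blast
next
  case False
  define e where "e = x - y"
  define T where "T z = z - (2 * (z \<bullet> e) / (e \<bullet> e)) *\<^sub>R e" for z
  have e: "e \<bullet> e \<noteq> 0" using False by (simp add: e_def)
  have "linear T" unfolding T_def
    by (intro linearI) (simp_all add: inner_add_left add_divide_distrib scaleR_add_left algebra_simps)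
  moreover have "T v \<bullet> T w = v \<bullet> w" for v w
    using e unfolding T_def by (simp add: inner_diff_left inner_diff_right inner_commute field_simps)
  ultimately have "orthogonal_transformation T" by (simp add: orthogonal_transformation_def)
  moreover have "T x = y"
  proof -
    have "x \<bullet> x = y \<bullet> y" using assms by (simp add: dot_square_norm)
    then have "2 * (x \<bullet> e) = e \<bullet> e" by (simp add: e_def inner_diff_left inner_diff_right inner_commute)
    then show ?thesis using e by (simp add: T_def e_def)
  qed
  ultimately show ?thesis using that by blast
qed

lemma cone_measure_ball_orthogonal:
  fixes T :: "'a::euclidean_space \<Rightarrow> 'a"
  assumes T: "orthogonal_transformation T"
  shows "emeasure cone_measure (ball (T x) r) = emeasure cone_measure (ball x r)"
proof -
  interpret linear T using T by (simp add: orthogonal_transformation)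
  have nT: "norm (T z) = norm z" for z using T by (simp add: orthogonal_transformation)
  have b: "(\<integral>\<^sup>+u. indicator (ball y r) u \<partial>cone_measure) = emeasure cone_measure (ball y r)" for y :: 'a by simp
  have "(\<integral>\<^sup>+u. indicator (ball (T x) r) u \<partial>cone_measure) = (\<integral>\<^sup>+z. indicator (cball 0 1) z * indicator (ball (T x) r) (z /\<^sub>R norm z) \<partial>lborel)"
    by (rule nn_integral_cone_measure) simp
  also have "\<dots> = (\<integral>\<^sup>+z. indicator (cball 0 1) (T z) * indicator (ball (T x) r) (T z /\<^sub>R norm (T z)) \<partial>lborel)"
    by (rule nn_integral_lborel_orthogonal[OF T, symmetric]) measurable
  also have "\<dots> = (\<integral>\<^sup>+z. indicator (cball 0 1) z * indicator (ball x r) (z /\<^sub>R norm z) \<partial>lborel)"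
  proof (rule nn_integral_cong)
    fix z
    have "dist (T x) (T z /\<^sub>R norm (T z)) = norm (T (x - z /\<^sub>R norm z))"
      by (simp add: dist_norm diff scale nT)
    then have "dist (T x) (T z /\<^sub>R norm (T z)) = dist x (z /\<^sub>R norm z)" by (simp add: nT dist_norm)
    then show "indicator (cball 0 1) (T z) * indicator (ball (T x) r) (T z /\<^sub>R norm (T z)) = indicator (cball 0 1) z * (indicator (ball x r) (z /\<^sub>R norm z) :: ennreal)"
      by (simp add: indicator_def nT)
  qed
  also have "\<dots> = (\<integral>\<^sup>+u. indicator (ball x r) u \<partial>cone_measure)"
    by (rule nn_integral_cone_measure[symmetric]) simp
  finally show ?thesis unfolding b .
qed

lemma cone_measure_ball_pos:
  fixes x :: "'a::euclidean_space"
  assumes x: "norm x = 1" and r: "r > 0"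
  shows "emeasure cone_measure (ball x r) > 0"
proof -
  let ?U = "{y. y \<noteq> 0 \<and> norm y < 1 \<and> dist x (y /\<^sub>R norm y) < r}"
  have "continuous_on (- {0}) (\<lambda>y::'a. y /\<^sub>R norm y)" by (intro continuous_intros) auto
  then have "open ((- {0}) \<inter> (\<lambda>y::'a. y /\<^sub>R norm y) -` ball x r)"
    by (rule continuous_open_preimage) auto
  then have "open (((- {0}) \<inter> (\<lambda>y::'a. y /\<^sub>R norm y) -` ball x r) \<inter> ball 0 1)" by (rule open_Int[OF _ open_ball])
  also have "((- {0}) \<inter> (\<lambda>y::'a. y /\<^sub>R norm y) -` ball x r) \<inter> ball 0 1 = ?U" by auto
  finally have U: "open ?U" .
  moreover have "(1/2) *\<^sub>R x \<in> ?U" using x r by auto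
  ultimately have "0 < emeasure lborel ?U" by (intro emeasure_lborel_open_pos) blast+
  also have "\<dots> \<le> emeasure lborel {y \<in> cball 0 1. y /\<^sub>R norm y \<in> ball x r}"
    by (intro emeasure_mono) auto
  finally show ?thesis by (simp add: emeasure_cone_measure)
qed

section \<open>Finiteness and positivity of Hausdorff measure on the sphere\<close>

lemma unit_ball_vol_pos': "s \<ge> 0 \<Longrightarrow> Defs.unit_ball_vol s > 0"
  unfolding Defs.unit_ball_vol_def by (intro divide_pos_pos Gamma_real_pos) auto

text \<open>Bounds the volume of the shell between the radii 1 - e and 1 + e relative to the unit
  ball. The constant is crude; only the first power of \<open>e\<close> matters.\<close>

lemma power_difference_le:
  fixes e :: real
  assumes "0 \<le> e" "e \<le> 1"
  shows "(1 + e) ^ n - (1 - e) ^ n \<le> 2 * e * real n * 2 ^ n"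
proof (induction n)
  case (Suc n)
  have "(1 + e) ^ Suc n - (1 - e) ^ Suc n = (1 + e) * ((1 + e) ^ n - (1 - e) ^ n) + 2 * e * (1 - e) ^ n"
    by (simp add: algebra_simps)
  also have "\<dots> \<le> 2 * (2 * e * real n * 2 ^ n) + 2 * e * 1"
  proof (intro add_mono mult_mono)
    show "(1 - e) ^ n \<le> 1" using assms by (intro power_le_one) auto
    show "0 \<le> (1 + e) ^ n - (1 - e) ^ n" using assms by (simp add: power_mono)
  qed (use Suc assms in auto)
  also have "\<dots> \<le> 2 * (2 * e * real n * 2 ^ n) + 2 * e * (2 * 2 ^ n)"
    using assms by (intro add_mono mult_left_mono) (auto simp: one_le_power intro: order.trans[of _ 2])
  also have "\<dots> = 2 * e * real (Suc n) * 2 ^ Suc n" by (simp add: algebra_simps)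
  finally show ?case .
qed simp

lemma measure_ball_scale:
  fixes x :: "'a::euclidean_space"
  assumes "r \<ge> 0" shows "measure lborel (ball x r) = r ^ DIM('a) * measure lborel (ball (0::'a) 1)"
    "measure lborel (cball x r) = r ^ DIM('a) * measure lborel (ball (0::'a) 1)"
  using assms by (simp_all add: content_ball content_cball)

text \<open>Disjoint balls around the points of a separated set lie in a thin spherical shell.\<close>

lemma card_separated_le:
  fixes T :: "'a::euclidean_space set"
  assumes T: "T \<subseteq> sphere 0 1" "finite T" and e: "0 < e" "e \<le> 1"
    and sep: "\<And>x y. x \<in> T \<Longrightarrow> y \<in> T \<Longrightarrow> x \<noteq> y \<Longrightarrow> e \<le> dist x y"
  shows "real (card T) * e ^ (DIM('a) - 1) \<le> real DIM('a) * 4 ^ DIM('a)"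
proof -
  let ?n = "DIM('a)"
  define \<omega> where "\<omega> = measure lborel (ball (0::'a) 1)"
  have mb: "measure lborel (ball x r) = r ^ ?n * \<omega>" "measure lborel (cball x r) = r ^ ?n * \<omega>" if "r \<ge> 0" for x :: 'a and r
    unfolding \<omega>_def by (rule measure_ball_scale[OF that])+
  have \<omega>: "\<omega> > 0" unfolding \<omega>_def by (simp add: content_ball)
  have "real (card T) * ((e / 2) ^ ?n * \<omega>) = (\<Sum>x\<in>T. measure lborel (ball x (e / 2)))"
    using e by (simp add: mb)
  also have "\<dots> = measure lborel (\<Union>x\<in>T. ball x (e / 2))"
  proof (rule measure_finite_Union[symmetric, OF T(2)])
    show "disjoint_family_on (\<lambda>x. ball x (e / 2)) T"
      unfolding disjoint_family_on_def
    proof (intro ballI impI)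
      fix x y assume "x \<in> T" "y \<in> T" "x \<noteq> y"
      then have "e \<le> dist x y" by (rule sep)
      then show "ball x (e / 2) \<inter> ball y (e / 2) = {}" by (intro disjoint_ballI) simp
    qed
  qed auto
  also have "\<dots> \<le> measure lborel (cball (0::'a) (1 + e / 2) - ball 0 (1 - e / 2))"
  proof (rule measure_mono_fmeasurable)
    show "(\<Union>x\<in>T. ball x (e / 2)) \<subseteq> cball 0 (1 + e / 2) - ball 0 (1 - e / 2)"
    proof
      fix z assume "z \<in> (\<Union>x\<in>T. ball x (e / 2))"
      then obtain x where x: "x \<in> T" "norm (x - z) < e / 2" by (auto simp: dist_norm)
      have "norm x = 1" using x(1) T(1) by auto
      then show "z \<in> cball 0 (1 + e / 2) - ball 0 (1 - e / 2)"
        using x(2) norm_triangle_ineq2[of x z] norm_triangle_ineq2[of z x] by (simp add: norm_minus_commute)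
    qed
    show "cball (0::'a) (1 + e / 2) - ball 0 (1 - e / 2) \<in> fmeasurable lborel"
      by (intro fmeasurable.Diff) (auto simp: fmeasurable_def less_top[symmetric])
  qed (use T(2) in auto)
  also have "\<dots> = measure lborel (cball (0::'a) (1 + e / 2)) - measure lborel (ball (0::'a) (1 - e / 2))"
    using e by (intro measure_Diff) auto
  also have "\<dots> = ((1 + e / 2) ^ ?n - (1 - e / 2) ^ ?n) * \<omega>"
    using e by (simp add: mb left_diff_distrib)
  \<comment> \<open>The shell has volume of order e and each small ball of order e^n, which leaves
    the power n - 1. The factor 4^n collects 2^n from the halved radius and 2^n from the
    shell.\<close>
  also have "\<dots> \<le> (2 * (e / 2) * real ?n * 2 ^ ?n) * \<omega>"
    using e \<omega> by (intro mult_right_mono power_difference_le) auto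
  finally have "real (card T) * (e / 2) ^ ?n \<le> e * real ?n * 2 ^ ?n"
    using \<omega> by (simp add: mult.assoc[symmetric])
  then have "real (card T) * (e / 2) ^ ?n * 2 ^ ?n \<le> e * real ?n * 2 ^ ?n * 2 ^ ?n"
    by (intro mult_right_mono) auto
  moreover have "real (card T) * (e / 2) ^ ?n * 2 ^ ?n = e * (real (card T) * e ^ (?n - 1))"
    by (cases "?n") (auto simp: power_divide)
  moreover have "e * real ?n * 2 ^ ?n * 2 ^ ?n = e * (real ?n * 4 ^ ?n)"
    by (simp add: power_mult_distrib[symmetric] mult.assoc)
  ultimately show ?thesis using e by simp
qed

text \<open>A maximal \<open>e\<close>-separated subset is a net, so balls of radius
  \<open>e\<close> around it cover the sphere. Each ball contributes of order e^(n-1) and their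
  number times e^(n-1) is bounded, so the covering sums stay bounded as \<open>e\<close> tends to
  0.\<close>

lemma hausdorff_outer_sphere_finite:
  assumes n: "DIM('a::euclidean_space) \<ge> 2"
  shows "hausdorff_outer (real DIM('a) - 1) (sphere (0::'a) 1) < \<infinity>"
proof -
  let ?n = "DIM('a)" and ?s = "real DIM('a) - 1" and ?S = "sphere (0::'a) 1"
  let ?v = "Defs.unit_ball_vol ?s"
  have v: "?v > 0" using n by (intro unit_ball_vol_pos') auto
  have "hausdorff_outer ?s ?S \<le> ennreal (?v * (real ?n * 4 ^ ?n))"
  proof (rule hausdorff_outer_least)
    fix \<delta> :: real assume \<delta>: "\<delta> > 0"
    define e where "e = min 1 (\<delta> / 2)"
    have e: "0 < e" "e \<le> 1" "2 * e \<le> \<delta>" using \<delta> by (auto simp: e_def)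
    let ?P = "\<lambda>T. T \<subseteq> ?S \<and> finite T \<and> (\<forall>x\<in>T. \<forall>y\<in>T. x \<noteq> y \<longrightarrow> e \<le> dist x y)"
    \<comment> \<open>The cardinalities of separated sets are bounded by \<open>m\<close>, so a
      separated set of largest cardinality exists.\<close>
    define m where "m = nat \<lceil>real ?n * 4 ^ ?n / e ^ (?n - 1)\<rceil>"
    have "card T \<le> m" if "?P T" for T
    proof -
      have "real (card T) \<le> real ?n * 4 ^ ?n / e ^ (?n - 1)"
        using card_separated_le[of T e] that e by (simp add: field_simps)
      then show ?thesis unfolding m_def by linarith
    qed
    moreover have "?P {}" by simp
    ultimately have "\<exists>T. ?P T \<and> (\<forall>T'. ?P T' \<longrightarrow> card T' \<le> card T)"
      by (intro ex_has_greatest_nat[of ?P "{}" card "Suc m"]) (auto simp: less_Suc_eq_le)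
    then obtain T where T: "?P T" "\<And>T'. ?P T' \<Longrightarrow> card T' \<le> card T" by blast
    have cover: "?S \<subseteq> (\<Union>x\<in>T. cball x e)"
    proof
      fix x assume x: "x \<in> ?S"
      show "x \<in> (\<Union>x\<in>T. cball x e)"
      proof (rule ccontr)
        assume n: "x \<notin> (\<Union>x\<in>T. cball x e)"
        then have "x \<notin> T" using e by auto
        have "?P (insert x T)" using T(1) x n by (auto simp: dist_commute)
        then have "card (insert x T) \<le> card T" by (rule T(2))
        then show False using \<open>x \<notin> T\<close> T(1) by simp
      qed
    qed
    obtain t where t: "bij_betw t {0..<card T} T" using ex_bij_betw_nat_finite T(1) by blast
    define C where "C i = (if i < card T then cball (t i) e else {})" for i
    have diam: "diameter (C i) \<le> 2 * e" for i using e by (simp add: C_def diameter_cball)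
    have "C \<in> fine_covers \<delta> ?S"
    proof (intro CollectI conjI allI)
      show "?S \<subseteq> (\<Union>i. C i)"
      proof
        fix x assume "x \<in> ?S"
        then obtain y where y: "y \<in> T" "x \<in> cball y e" using cover by blast
        then have "y \<in> t ` {0..<card T}" by (simp only: bij_betw_imp_surj_on[OF t])
        then obtain i where "i < card T" "y = t i" by auto
        then have "x \<in> C i" using y by (simp add: C_def)
        then show "x \<in> (\<Union>i. C i)" by blast
      qed
    qed (use diam e in \<open>auto simp: C_def intro: order.trans\<close>)
    then have "hausdorff_content ?s \<delta> ?S \<le> (\<Sum>i. hausdorff_term ?s (C i))" by (rule hausdorff_content_le)
    also have "\<dots> = (\<Sum>i<card T. hausdorff_term ?s (C i))"
      by (rule suminf_finite) (auto simp: C_def)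
    also have "\<dots> \<le> (\<Sum>i<card T. ennreal (?v * e ^ (?n - 1)))"
    proof (intro sum_mono ennreal_leI mult_left_mono)
      fix i
      have "(diameter (C i) / 2) powr ?s \<le> e powr ?s"
        using diam[of i] n by (intro powr_mono2) (auto simp: diameter_ge_0 C_def)
      also have "e powr ?s = e ^ (?n - 1)"
        using e n by (simp add: powr_realpow[symmetric] of_nat_diff)
      finally show "(diameter (C i) / 2) powr ?s \<le> e ^ (?n - 1)" .
    qed (use v in auto)
    also have "\<dots> = ennreal (?v * (real (card T) * e ^ (?n - 1)))"
      using v e by (simp add: ennreal_of_nat_eq_real_of_nat ennreal_mult[symmetric] mult_ac)
    also have "\<dots> \<le> ennreal (?v * (real ?n * 4 ^ ?n))"
      using v T(1) e by (intro ennreal_leI mult_left_mono card_separated_le) auto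
    finally show "hausdorff_content ?s \<delta> ?S \<le> ennreal (?v * (real ?n * 4 ^ ?n))" .
  qed
  then show ?thesis using le_less_trans by fastforce
qed

text \<open>A cone over a piece of the sphere of diameter \<open>d\<close> is covered by about \<open>1/d\<close> balls of
  radius \<open>2d\<close> along one ray.\<close>

lemma cone_cover:
  fixes C :: "'a::euclidean_space set"
  assumes n: "DIM('a) \<ge> 2" and C: "bounded C" "diameter C \<le> 1"
  obtains E where "E \<in> sets borel" "{x \<in> cball 0 1. x \<noteq> 0 \<and> x /\<^sub>R norm x \<in> C} \<subseteq> E"
    "emeasure lborel E \<le> ennreal (2 ^ (DIM('a) + 1) * measure lborel (ball (0::'a) 1) * diameter C ^ (DIM('a) - 1))"
proof (cases "{x \<in> cball 0 1. x \<noteq> 0 \<and> x /\<^sub>R norm x \<in> C} = {}")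
  case True
  then show ?thesis using that[of "{}"] by simp
next
  case False
  let ?n = "DIM('a)" and ?\<omega> = "measure lborel (ball (0::'a) 1)" and ?d = "diameter C"
  obtain x0 where "x0 \<noteq> 0" "x0 /\<^sub>R norm x0 \<in> C" using False by auto
  then obtain u where u: "u \<in> C" "norm u = 1" by (auto intro: that)
  have d0: "?d \<ge> 0" using C(1) by (rule diameter_ge_0)
  show ?thesis
  proof (cases "?d = 0")
    case True
    \<comment> \<open>Diameter 0 gives no step length for the balls; here the cone lies on a line,
      which is a null set in dimension at least 2.\<close>
    have "x \<in> span {u}" if "x \<noteq> 0" "x /\<^sub>R norm x \<in> C" for x
    proof -
      have "dist u (x /\<^sub>R norm x) \<le> 0" using diameter_bounded_bound[OF C(1) u(1) that(2)] True by simp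
      then have "u = x /\<^sub>R norm x" by simp
      then have "x = norm x *\<^sub>R u" using that(1) by simp
      then show ?thesis by (metis insertI1 span_base span_scale)
    qed
    then have sub: "{x \<in> cball 0 1. x \<noteq> 0 \<and> x /\<^sub>R norm x \<in> C} \<subseteq> span {u}" by auto
    have b: "span {u} \<in> sets borel" by (intro borel_closed closed_subspace) simp
    have "dim (span {u}) < ?n" using dim_le_card'[of "{u}"] n by (simp add: dim_span)
    then have "negligible (span {u})" by (intro negligible_lowdim) (simp add: dim_span)
    then have "emeasure lborel (span {u}) = 0" using b by (auto simp: negligible_iff_null_sets null_sets_def)
    then show ?thesis using that[OF b sub] by simp
  next
    case False
    then have d: "0 < ?d" using d0 by simp
    define m where "m = nat \<lfloor>1 / ?d\<rfloor>"
    have m: "real m \<le> 1 / ?d" using d by (simp add: m_def)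
    \<comment> \<open>A point of the cone is within d of the point of the ray at the same radius,
      and this one is within d of a centre, whence the radius 2d. At most 2/d balls of volume
      proportional to (2d)^n give the constant 2^(n+1).\<close>
    define E where "E = (\<Union>j\<in>{..m}. cball ((real j * ?d) *\<^sub>R u) (2 * ?d))"
    have b: "E \<in> sets borel" unfolding E_def by auto
    have sub: "{x \<in> cball 0 1. x \<noteq> 0 \<and> x /\<^sub>R norm x \<in> C} \<subseteq> E"
    proof safe
      fix x :: 'a assume x: "x \<in> cball 0 1" "x \<noteq> 0" "x /\<^sub>R norm x \<in> C"
      let ?r = "norm x" and ?w = "x /\<^sub>R norm x"
      define j where "j = nat \<lfloor>?r / ?d\<rfloor>"
      have jm: "j \<le> m" unfolding j_def m_def using x d by (intro nat_mono floor_mono divide_right_mono) auto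
      have "real j \<le> ?r / ?d" "?r / ?d < real j + 1" unfolding j_def using d by simp_all
      then have "real j * ?d \<le> ?r" "?r < real j * ?d + ?d" using d by (simp_all add: field_simps)
      then have 1: "\<bar>?r - real j * ?d\<bar> \<le> ?d" by simp
      have 2: "norm (?w - u) \<le> ?d" using diameter_bounded_bound[OF C(1) x(3) u(1)] by (simp add: dist_norm)
      have "x - (real j * ?d) *\<^sub>R u = ?r *\<^sub>R (?w - u) + (?r - real j * ?d) *\<^sub>R u"
        using x(2) by (simp add: algebra_simps)
      then have "norm (x - (real j * ?d) *\<^sub>R u) \<le> norm (?r *\<^sub>R (?w - u)) + norm ((?r - real j * ?d) *\<^sub>R u)"
        by (metis norm_triangle_ineq)
      also have "\<dots> \<le> 1 * ?d + ?d"
      proof (rule add_mono)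
        show "norm (?r *\<^sub>R (?w - u)) \<le> 1 * ?d"
          unfolding norm_scaleR using x(1) 2 by (intro mult_mono) auto
        show "norm ((?r - real j * ?d) *\<^sub>R u) \<le> ?d" using 1 u(2) by simp
      qed
      finally have "x \<in> cball ((real j * ?d) *\<^sub>R u) (2 * ?d)" by (simp add: dist_norm norm_minus_commute)
      then show "x \<in> E" unfolding E_def using jm by blast
    qed
    have "emeasure lborel E \<le> (\<Sum>j\<in>{..m}. emeasure lborel (cball ((real j * ?d) *\<^sub>R u) (2 * ?d)))"
      unfolding E_def by (intro emeasure_subadditive_finite) auto
    also have "\<dots> = (\<Sum>j\<in>{..m}. ennreal ((2 * ?d) ^ ?n * ?\<omega>))"
    proof (rule sum.cong)
      fix j
      show "emeasure lborel (cball ((real j * ?d) *\<^sub>R u) (2 * ?d)) = ennreal ((2 * ?d) ^ ?n * ?\<omega>)"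
        using d by (subst emeasure_eq_ennreal_measure) (simp_all only: measure_ball_scale(2)[of "2 * ?d"] emeasure_ball_not_top, simp_all)
    qed simp
    also have "\<dots> = ennreal ((real m + 1) * ((2 * ?d) ^ ?n * ?\<omega>))"
      using d by (subst sum_ennreal) (auto simp: algebra_simps)
    also have "\<dots> \<le> ennreal (2 / ?d * ((2 * ?d) ^ ?n * ?\<omega>))"
    proof (intro ennreal_leI mult_right_mono)
      have "1 \<le> 1 / ?d" using d C(2) by simp
      then show "real m + 1 \<le> 2 / ?d" using m by simp
    qed (use d in auto)
    also have "2 / ?d * ((2 * ?d) ^ ?n * ?\<omega>) = 2 ^ (?n + 1) * ?\<omega> * ?d ^ (?n - 1)"
      using d by (cases ?n) (auto simp: power_mult_distrib)
    finally show ?thesis using that[OF b sub] by simp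
  qed
qed

text \<open>Serves to show that balls centred on the sphere have positive Hausdorff measure, without
  which the comparison of uniformly distributed measures does not apply.\<close>

lemma cone_measure_le_hausdorff:
  assumes n: "DIM('a::euclidean_space) \<ge> 2"
  obtains K where "K < \<infinity>"
    "\<And>A :: 'a set. A \<in> sets borel \<Longrightarrow> A \<subseteq> sphere 0 1 \<Longrightarrow> emeasure cone_measure A \<le> K * hausdorff_outer (real DIM('a) - 1) A"
proof -
  let ?n = "DIM('a)" and ?s = "real DIM('a) - 1" and ?\<omega> = "measure lborel (ball (0::'a) 1)"
  let ?v = "Defs.unit_ball_vol ?s"
  have v: "?v > 0" using n by (intro unit_ball_vol_pos') auto
  \<comment> \<open>The constant of \<open>cone_cover\<close>, times 2^(n-1) because covering sums
    use half the diameter, divided by the normalizing factor of these sums.\<close>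
  define K where "K = 2 ^ (?n + 1) * ?\<omega> * 2 ^ (?n - 1) / ?v"
  have "?\<omega> > 0" by (simp add: content_ball)
  then have Kpos: "K > 0" unfolding K_def using v by (intro divide_pos_pos mult_pos_pos) auto
  then have K0: "K \<ge> 0" by simp
  have "emeasure cone_measure A \<le> ennreal K * hausdorff_outer ?s A" if A: "A \<in> sets borel" "A \<subseteq> sphere 0 1" for A :: "'a set"
  proof -
    have "emeasure cone_measure A \<le> ennreal K * (\<Sum>i. hausdorff_term ?s (C i))" if C: "C \<in> fine_covers 1 A" for C
    proof -
      have "\<forall>i. \<exists>E. E \<in> sets borel \<and> {x \<in> cball 0 1. x \<noteq> 0 \<and> x /\<^sub>R norm x \<in> C i} \<subseteq> E \<and>
        emeasure lborel E \<le> ennreal (2 ^ (?n + 1) * ?\<omega> * diameter (C i) ^ (?n - 1))"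
      proof
        fix i
        have "bounded (C i)" "diameter (C i) \<le> 1" using C by auto
        then show "\<exists>E. E \<in> sets borel \<and> {x \<in> cball 0 1. x \<noteq> 0 \<and> x /\<^sub>R norm x \<in> C i} \<subseteq> E \<and>
          emeasure lborel E \<le> ennreal (2 ^ (?n + 1) * ?\<omega> * diameter (C i) ^ (?n - 1))"
          by (rule cone_cover[OF n]) (intro exI conjI)
      qed
      from choice[OF this] obtain E where E: "\<And>i. E i \<in> sets borel" "\<And>i. {x \<in> cball 0 1. x \<noteq> 0 \<and> x /\<^sub>R norm x \<in> C i} \<subseteq> E i"
        "\<And>i. emeasure lborel (E i) \<le> ennreal (2 ^ (?n + 1) * ?\<omega> * diameter (C i) ^ (?n - 1))" by blast
      have term_eq: "ennreal (2 ^ (?n + 1) * ?\<omega> * diameter (C i) ^ (?n - 1)) = ennreal K * hausdorff_term ?s (C i)" for i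
      proof -
        have d0: "0 \<le> diameter (C i)" using C by (auto intro: diameter_ge_0)
        have "(diameter (C i) / 2) powr ?s = (diameter (C i) / 2) ^ (?n - 1)"
        proof (cases "diameter (C i) = 0")
          case True
          then show ?thesis using n by simp
        next
          case False
          then show ?thesis using d0 n by (simp add: powr_realpow[symmetric] of_nat_diff)
        qed
        then show ?thesis using v d0 K0 by (simp add: ennreal_mult[symmetric] K_def power_divide)
      qed
      have "{x \<in> cball 0 1. x /\<^sub>R norm x \<in> A} \<subseteq> (\<Union>i. E i)"
      proof safe
        fix x :: 'a assume x: "x \<in> cball 0 1" "x /\<^sub>R norm x \<in> A"
        then have "x \<noteq> 0" using A(2) by auto
        moreover obtain i where "x /\<^sub>R norm x \<in> C i" using x(2) C by blast
        ultimately show "x \<in> (\<Union>i. E i)" using x(1) E(2)[of i] by auto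
      qed
      then have "emeasure cone_measure A \<le> emeasure lborel (\<Union>i. E i)"
        unfolding emeasure_cone_measure[OF A(1)] using E(1) by (intro emeasure_mono) auto
      also have "\<dots> \<le> (\<Sum>i. emeasure lborel (E i))"
        using E(1) by (intro emeasure_subadditive_countably) auto
      also have "\<dots> \<le> (\<Sum>i. ennreal K * hausdorff_term ?s (C i))"
        using E(3) unfolding term_eq by (intro suminf_le) auto
      also have "\<dots> = ennreal K * (\<Sum>i. hausdorff_term ?s (C i))" by (rule ennreal_suminf_cmult)
      finally show ?thesis .
    qed
    then have le: "emeasure cone_measure A \<le> ennreal K * (\<Sum>i. hausdorff_term ?s (C i))" if "C \<in> fine_covers 1 A" for C
      using that by blast
    have inv: "ennreal (1 / K) * ennreal K = 1" "ennreal K * ennreal (1 / K) = 1"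
      using Kpos by (simp_all add: ennreal_mult[symmetric])
    have "ennreal (1 / K) * emeasure cone_measure A \<le> hausdorff_content ?s 1 A"
    proof (rule hausdorff_content_greatest)
      fix C assume "C \<in> fine_covers 1 A"
      from mult_left_mono[OF le[OF this], of "ennreal (1 / K)"]
      show "ennreal (1 / K) * emeasure cone_measure A \<le> (\<Sum>i. hausdorff_term ?s (C i))"
        by (simp add: mult.assoc[symmetric] inv)
    qed
    from mult_left_mono[OF this, of "ennreal K"]
    have "emeasure cone_measure A \<le> ennreal K * hausdorff_content ?s 1 A"
      by (simp add: mult.assoc[symmetric] inv)
    also have "\<dots> \<le> ennreal K * hausdorff_outer ?s A"
      by (intro mult_left_mono hausdorff_content_le_outer) auto
    finally show ?thesis .
  qed
  then show ?thesis using that[of "ennreal K"] by simp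
qed

text \<open>Both measures are finite and invariant under orthogonal maps, which carry any point of
  the sphere to any other. So for each radius all balls centred on the sphere have the same positive
  mass, and the two measures are proportional.\<close>

theorem hausdorff_measure_sphere:
  assumes n: "DIM('a::euclidean_space) \<ge> 2"
  obtains \<kappa> where "\<kappa> > 0" "\<And>f :: 'a \<Rightarrow> ennreal. f \<in> borel_measurable borel \<Longrightarrow>
    (\<integral>\<^sup>+u. indicator (sphere 0 1) u * f u \<partial>hausdorff_measure (real DIM('a) - 1)) = ennreal \<kappa> * (\<integral>\<^sup>+u. f u \<partial>cone_measure)"
proof -
  let ?s = "real DIM('a) - 1" and ?S = "sphere (0::'a) 1"
  let ?H = "hausdorff_measure ?s :: 'a measure"
  define M where "M = density ?H (indicator ?S)"
  have sM: "sets M = sets borel" by (simp add: M_def)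
  have eM: "emeasure M A = hausdorff_outer ?s (?S \<inter> A)" if A: "A \<in> sets borel" for A
  proof -
    have "emeasure M A = (\<integral>\<^sup>+u. indicator ?S u * indicator A u \<partial>?H)"
      using A unfolding M_def by (subst emeasure_density) (measurable, simp_all)
    also have "\<dots> = (\<integral>\<^sup>+u. indicator (?S \<inter> A) u \<partial>?H)"
      by (simp only: indicator_inter_arith)
    also have "\<dots> = emeasure ?H (?S \<inter> A)" using A by (intro nn_integral_indicator) auto
    finally show ?thesis using A by (simp add: emeasure_hausdorff_measure)
  qed
  have fM: "finite_measure M"
    using hausdorff_outer_sphere_finite[OF n] by (intro finite_measureI) (simp add: M_def[symmetric] eM sets_eq_imp_space_eq[OF sM] less_top)
  interpret M: finite_measure M by fact
  interpret N: finite_measure "cone_measure :: 'a measure" by (rule finite_cone_measure)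
  obtain K where K: "K < \<infinity>" "\<And>A :: 'a set. A \<in> sets borel \<Longrightarrow> A \<subseteq> ?S \<Longrightarrow> emeasure cone_measure A \<le> K * hausdorff_outer ?s A"
    using cone_measure_le_hausdorff[OF n] by metis
  obtain p :: 'a where p: "norm p = 1" using vector_choose_size[of 1] by auto
  have rotM: "emeasure M (ball x r) = ennreal (measure M (ball p r))" if "x \<in> ?S" for x r
  proof -
    have "norm p = norm x" using that p by simp
    then obtain T where T: "orthogonal_transformation T" "T p = x"
      using orthogonal_transformation_sphere_transitive by blast
    have nT: "norm (T z) = norm z" for z using T(1) by (simp add: orthogonal_transformation)
    have iso: "dist (T y) (T z) = dist y z" for y z using orthogonal_transformation_isometry[THEN iffD1, OF T(1)] by blast
    have "T ` (?S \<inter> ball p r) = ?S \<inter> ball x r"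
    proof safe
      fix y assume y: "y \<in> ?S" "y \<in> ball x r"
      obtain z where "y = T z" using orthogonal_transformation_surj[OF T(1)] by (metis surjD)
      then show "y \<in> T ` (?S \<inter> ball p r)" using y nT iso T(2) by (auto simp: image_iff)
    qed (use nT iso T(2) in auto)
    then have "emeasure M (ball x r) = emeasure M (ball p r)"
      using hausdorff_outer_orthogonal[OF T(1), of ?s "?S \<inter> ball p r"] by (simp add: eM)
    then show ?thesis by (simp add: M.emeasure_eq_measure)
  qed
  have rotN: "emeasure cone_measure (ball x r) = ennreal (measure cone_measure (ball p r))" if "x \<in> ?S" for x r
  proof -
    have "norm p = norm x" using that p by simp
    then obtain T where T: "orthogonal_transformation T" "T p = x"
      using orthogonal_transformation_sphere_transitive by blast
    then show ?thesis using cone_measure_ball_orthogonal[OF T(1), of p r] by (simp add: N.emeasure_eq_measure)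
  qed
  have AEN: "AE x in cone_measure. x \<in> ?S" by (rule AE_cone_measure_sphere)
  have posN: "measure cone_measure (ball p r) > 0" if "r > 0" for r
    using cone_measure_ball_pos[OF p that] by (simp add: N.emeasure_eq_measure)
  have posM: "measure M (ball p r) > 0" if "r > 0" for r
  proof -
    have "0 < emeasure cone_measure (ball p r)" using cone_measure_ball_pos[OF p that] .
    also have "\<dots> = emeasure cone_measure (?S \<inter> ball p r)"
      using AEN by (intro emeasure_eq_AE) auto
    also have "\<dots> \<le> K * emeasure M (ball p r)" using K(2)[of "?S \<inter> ball p r"] by (simp add: eM)
    finally show ?thesis by (auto simp: M.emeasure_eq_measure zero_less_measure_iff intro: ccontr)
  qed
  have tot: "measure M UNIV > 0" "measure (cone_measure :: 'a measure) UNIV > 0"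
    using posM[of 1] posN[of 1] M.finite_measure_mono[of "ball p 1" UNIV] N.finite_measure_mono[of "ball p 1" UNIV] sM
    by auto
  have AEM: "AE x in M. x \<in> ?S" unfolding M_def by (subst AE_density) (auto simp: indicator_def)
  define \<kappa> where "\<kappa> = measure M UNIV / measure (cone_measure :: 'a measure) UNIV"
  have "M = scale_measure (ennreal \<kappa>) cone_measure"
    unfolding \<kappa>_def
    by (rule uniform_measures_proportional[OF sM sets_cone_measure fM finite_cone_measure AEM AEN rotM rotN posM posN tot])
  note M_eq = this
  have "(\<integral>\<^sup>+u. indicator ?S u * f u \<partial>?H) = ennreal \<kappa> * (\<integral>\<^sup>+u. f u \<partial>cone_measure)"
    if f: "f \<in> borel_measurable borel" for f
  proof -
    have "(\<integral>\<^sup>+u. indicator ?S u * f u \<partial>?H) = (\<integral>\<^sup>+u. f u \<partial>M)"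
      unfolding M_def using f by (subst nn_integral_density) auto
    also have "\<dots> = ennreal \<kappa> * (\<integral>\<^sup>+u. f u \<partial>cone_measure)"
      unfolding M_eq using f by (intro nn_integral_scale_measure) auto
    finally show ?thesis .
  qed
  then show ?thesis using that[of \<kappa>] tot by (simp add: \<kappa>_def)
qed

section \<open>Gauge functions and symmetric convex bodies\<close>

definition gauge_fun :: "'a::euclidean_space set \<Rightarrow> 'a \<Rightarrow> real" where
  "gauge_fun A x = Inf {t. t > 0 \<and> x /\<^sub>R t \<in> A}"

text \<open>Unbounded sets are included because one instance is a cylinder; its gauge vanishes at
  points other than the origin. The ball of radius \<rho> keeps the gauge finite and
  Lipschitz.\<close>

locale gauge_set =
  fixes A :: "'a::euclidean_space set" and \<rho> :: real
  assumes closed_A: "closed A" and convex_A: "convex A" and \<rho>_pos: "\<rho> > 0" and ball_A: "cball 0 \<rho> \<subseteq> A"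
begin

lemma zero_in: "0 \<in> A" using ball_A \<rho>_pos by auto

lemma shrink: "x \<in> A \<Longrightarrow> 0 \<le> t \<Longrightarrow> t \<le> 1 \<Longrightarrow> t *\<^sub>R x \<in> A"
  using convexD[OF convex_A zero_in, of x "1 - t" t] by auto

lemma divide_mono: "x /\<^sub>R s \<in> A \<Longrightarrow> 0 < s \<Longrightarrow> s \<le> t \<Longrightarrow> x /\<^sub>R t \<in> A"
  using shrink[of "x /\<^sub>R s" "s / t"] by (simp add: field_simps)

lemma norm_divide_in: "t > 0 \<Longrightarrow> norm x / \<rho> \<le> t \<Longrightarrow> x /\<^sub>R t \<in> A"
  using ball_A \<rho>_pos by (auto simp: field_simps subset_eq)

lemma gauge_nonempty: "{t. t > 0 \<and> x /\<^sub>R t \<in> A} \<noteq> {}"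
proof -
  have "norm x / \<rho> + 1 > 0" using \<rho>_pos by (intro add_nonneg_pos divide_nonneg_pos) auto
  moreover from this have "x /\<^sub>R (norm x / \<rho> + 1) \<in> A" by (intro norm_divide_in) auto
  ultimately show ?thesis by blast
qed

lemma gauge_bdd_below: "bdd_below {t. t > 0 \<and> x /\<^sub>R t \<in> A}"
  by (intro bdd_belowI[of _ 0]) auto

lemma gauge_nonneg: "gauge_fun A x \<ge> 0"
  unfolding gauge_fun_def by (intro cInf_greatest gauge_nonempty) auto

lemma gauge_le_iff:
  assumes t: "t > 0" shows "gauge_fun A x \<le> t \<longleftrightarrow> x /\<^sub>R t \<in> A"
proof
  assume "x /\<^sub>R t \<in> A"
  then show "gauge_fun A x \<le> t" unfolding gauge_fun_def using t by (intro cInf_lower gauge_bdd_below) auto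
next
  assume le: "gauge_fun A x \<le> t"
  have "x /\<^sub>R (t + 1 / real (Suc n)) \<in> A" for n
  proof -
    have "Inf {t. t > 0 \<and> x /\<^sub>R t \<in> A} < t + 1 / real (Suc n)"
      using le by (simp add: gauge_fun_def add_strict_increasing2 order.strict_trans1)
    then obtain s where "s > 0" "x /\<^sub>R s \<in> A" "s < t + 1 / real (Suc n)"
      using gauge_nonempty[of x] by (auto simp: cInf_less_iff[OF gauge_nonempty gauge_bdd_below])
    then show ?thesis using divide_mono[of s x] by simp
  qed
  moreover have "(\<lambda>n. x /\<^sub>R (t + 1 / real (Suc n))) \<longlonglongrightarrow> x /\<^sub>R (t + 0)"
    using t LIMSEQ_inverse_real_of_nat by (intro tendsto_intros) (auto simp: inverse_eq_divide)
  ultimately show "x /\<^sub>R t \<in> A" using closed_A closed_sequentially[of A] by fastforce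
qed

lemma gauge_le_1_iff: "gauge_fun A x \<le> 1 \<longleftrightarrow> x \<in> A"
  using gauge_le_iff[of 1 x] by simp

lemma gauge_zero: "gauge_fun A 0 = 0"
proof -
  have "gauge_fun A 0 \<le> e" if "e > 0" for e using that zero_in by (simp add: gauge_le_iff)
  then have "gauge_fun A 0 \<le> 0" by (meson dense_ge)
  then show ?thesis using gauge_nonneg[of 0] by simp
qed

lemma gauge_scale:
  assumes s: "s > 0" shows "gauge_fun A (s *\<^sub>R x) = s * gauge_fun A x"
proof -
  have le: "gauge_fun A (s *\<^sub>R x) \<le> s * gauge_fun A x" if s: "s > 0" for s x
  proof (rule field_le_epsilon)
    fix e :: real assume e: "e > 0"
    let ?t = "gauge_fun A x + e / s"
    have t: "?t > 0" using gauge_nonneg[of x] e s by (simp add: add_nonneg_pos)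
    have 1: "x /\<^sub>R ?t \<in> A" using gauge_le_iff[OF t, of x] e s by simp
    have 2: "(s *\<^sub>R x) /\<^sub>R (s * ?t) = x /\<^sub>R ?t" using s by simp
    have "gauge_fun A (s *\<^sub>R x) \<le> s * ?t"
      using gauge_le_iff[of "s * ?t" "s *\<^sub>R x"] mult_pos_pos[OF s t] 1 unfolding 2 by blast
    then show "gauge_fun A (s *\<^sub>R x) \<le> s * gauge_fun A x + e" using s by (simp add: algebra_simps)
  qed
  have "gauge_fun A x \<le> (1 / s) * gauge_fun A (s *\<^sub>R x)" using le[of "1/s" "s *\<^sub>R x"] s by simp
  then have "s * gauge_fun A x \<le> gauge_fun A (s *\<^sub>R x)" using s by (simp add: field_simps)
  then show ?thesis using le[OF s, of x] by simp
qed

lemma gauge_le_norm: "gauge_fun A x \<le> norm x / \<rho>"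
proof (cases "x = 0")
  case False
  then have "norm x / \<rho> > 0" using \<rho>_pos by simp
  then show ?thesis using norm_divide_in[of "norm x / \<rho>" x] gauge_le_iff by blast
qed (simp add: gauge_zero)

lemma gauge_subadditive: "gauge_fun A (x + y) \<le> gauge_fun A x + gauge_fun A y"
proof (rule field_le_epsilon)
  fix e :: real assume e: "e > 0"
  let ?s = "gauge_fun A x + e / 2" and ?t = "gauge_fun A y + e / 2"
  have st: "?s > 0" "?t > 0" using gauge_nonneg[of x] gauge_nonneg[of y] e by auto
  have "x /\<^sub>R ?s \<in> A" "y /\<^sub>R ?t \<in> A" using gauge_le_iff[OF st(1), of x] gauge_le_iff[OF st(2), of y] e by simp_all
  then have "(?s / (?s + ?t)) *\<^sub>R (x /\<^sub>R ?s) + (?t / (?s + ?t)) *\<^sub>R (y /\<^sub>R ?t) \<in> A"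
    using st by (intro convexD[OF convex_A]) (auto simp: add_divide_distrib[symmetric])
  also have "(?s / (?s + ?t)) *\<^sub>R (x /\<^sub>R ?s) + (?t / (?s + ?t)) *\<^sub>R (y /\<^sub>R ?t) = (x + y) /\<^sub>R (?s + ?t)"
    using st by (simp add: inverse_eq_divide scaleR_add_right)
  finally have "gauge_fun A (x + y) \<le> ?s + ?t" using gauge_le_iff[of "?s + ?t" "x + y"] st by simp
  then show "gauge_fun A (x + y) \<le> gauge_fun A x + gauge_fun A y + e" by simp
qed

lemma gauge_lipschitz: "\<bar>gauge_fun A x - gauge_fun A y\<bar> \<le> norm (x - y) / \<rho>"
  using gauge_subadditive[of "x - y" y] gauge_subadditive[of "y - x" x]
    gauge_le_norm[of "x - y"] gauge_le_norm[of "y - x"] by (simp add: norm_minus_commute)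

lemma gauge_continuous: "continuous_on UNIV (gauge_fun A)"
proof (rule continuous_onI)
  fix x :: 'a and e :: real assume e: "e > 0"
  show "\<exists>d>0. \<forall>x'\<in>UNIV. dist x' x < d \<longrightarrow> dist (gauge_fun A x') (gauge_fun A x) \<le> e"
  proof (intro exI[of _ "e * \<rho>"] conjI ballI impI)
    fix x' assume "dist x' x < e * \<rho>"
    then have "norm (x' - x) / \<rho> \<le> e" using \<rho>_pos by (simp add: dist_norm field_simps)
    then show "dist (gauge_fun A x') (gauge_fun A x) \<le> e"
      using gauge_lipschitz[of x' x] by (simp add: dist_real_def)
  qed (use e \<rho>_pos in simp)
qed

lemma gauge_borel [measurable]: "gauge_fun A \<in> borel_measurable borel"
  by (rule borel_measurable_continuous_onI[OF gauge_continuous])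

lemma gauge_pos:
  assumes "bounded A" "x \<noteq> 0" shows "gauge_fun A x > 0"
proof -
  obtain R where R: "\<And>a. a \<in> A \<Longrightarrow> norm a \<le> R" "R > 0" using assms(1) unfolding bounded_pos by auto
  have "norm x / R \<le> t" if "t > 0" "x /\<^sub>R t \<in> A" for t
  proof -
    have "norm x / t \<le> R" using R(1)[OF that(2)] that(1) by (simp add: divide_inverse mult.commute)
    then show ?thesis using that(1) R(2) by (simp add: field_simps)
  qed
  then have "norm x / R \<le> gauge_fun A x"
    unfolding gauge_fun_def by (intro cInf_greatest gauge_nonempty) auto
  moreover have "norm x / R > 0" using assms(2) R(2) by simp
  ultimately show ?thesis by simp
qed

end

section \<open>Symmetric convex bodies: gauge, radial function, support function\<close>

locale sym_body =
  fixes K :: "'a::euclidean_space set"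
  assumes compact_K: "compact K" and convex_K: "convex K" and interior_K: "interior K \<noteq> {}"
    and sym_K: "x \<in> K \<Longrightarrow> - x \<in> K"
begin

text \<open>With a ball \<open>K\<close> also contains the reflected ball, and the midpoints of the
  two fill a ball around the origin.\<close>

lemma inner_radius: "\<exists>r>0. cball 0 r \<subseteq> K"
proof -
  obtain x e where x: "e > 0" "cball x e \<subseteq> K" using interior_K mem_interior_cball by blast
  have "cball 0 e \<subseteq> K"
  proof
    fix y :: 'a assume y: "y \<in> cball 0 e"
    then have "x + y \<in> K" "x - y \<in> K" using x(2) by (auto simp: subset_eq dist_norm)
    then have "(1/2) *\<^sub>R (x + y) + (1/2) *\<^sub>R (- (x - y)) \<in> K"
      by (intro convexD[OF convex_K] sym_K) auto
    moreover have "(1/2) *\<^sub>R (x + y) + (1/2) *\<^sub>R (- (x - y)) = y"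
      by (simp add: scaleR_add_right[symmetric] scaleR_2[symmetric])
    ultimately show "y \<in> K" by simp
  qed
  then show ?thesis using x(1) by blast
qed

definition \<rho> where "\<rho> = (SOME r. r > 0 \<and> cball 0 r \<subseteq> K)"

lemma \<rho>: "\<rho> > 0" "cball 0 \<rho> \<subseteq> K"
  using someI_ex[OF inner_radius] unfolding \<rho>_def by auto

lemma closed_K: "closed K" and bounded_K: "bounded K"
  using compact_K compact_imp_closed compact_imp_bounded by auto

sublocale K: gauge_set K \<rho>
  by standard (use \<rho> closed_K convex_K in auto)

lemma K_borel [measurable]: "K \<in> sets borel" using closed_K by simp

lemma gauge_K_pos: "x \<noteq> 0 \<Longrightarrow> gauge_fun K x > 0"
  using bounded_K by (rule K.gauge_pos)

lemma radial_fun_eq: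
  assumes u: "u \<noteq> 0" shows "radial_fun K u = 1 / gauge_fun K u"
proof -
  have "{r. r > 0 \<and> r *\<^sub>R u \<in> K} = {0<..1 / gauge_fun K u}"
  proof (rule set_eqI)
    fix r :: real
    show "r \<in> {r. r > 0 \<and> r *\<^sub>R u \<in> K} \<longleftrightarrow> r \<in> {0<..1 / gauge_fun K u}"
    proof (cases "r > 0")
      case True
      then have "r *\<^sub>R u \<in> K \<longleftrightarrow> gauge_fun K u \<le> 1 / r" using K.gauge_le_iff[of "1/r" u] by (simp add: inverse_eq_divide)
      also have "\<dots> \<longleftrightarrow> r \<le> 1 / gauge_fun K u" using True gauge_K_pos[OF u] by (simp add: field_simps)
      finally show ?thesis using True by simp
    qed simp
  qed
  then show ?thesis unfolding radial_fun_def using gauge_K_pos[OF u] by simp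
qed

lemma radial_fun_borel [measurable]: "radial_fun K \<in> borel_measurable borel"
proof -
  have "radial_fun K = (\<lambda>u. if u = 0 then radial_fun K 0 else 1 / gauge_fun K u)"
    using radial_fun_eq by auto
  also have "\<dots> \<in> borel_measurable borel" by measurable
  finally show ?thesis .
qed

lemma support_ge: "y \<in> K \<Longrightarrow> v \<bullet> y \<le> support_fun K v"
proof -
  have "bdd_above ((\<lambda>y. v \<bullet> y) ` K)"
    using compact_K by (intro bounded_imp_bdd_above compact_imp_bounded compact_continuous_image continuous_intros)
  then show "y \<in> K \<Longrightarrow> v \<bullet> y \<le> support_fun K v"
    unfolding support_fun_def by (rule cSUP_upper[rotated])
qed

lemma support_eqI: "x \<in> K \<Longrightarrow> (\<And>y. y \<in> K \<Longrightarrow> v \<bullet> y \<le> v \<bullet> x) \<Longrightarrow> support_fun K v = v \<bullet> x"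
  unfolding support_fun_def by (intro cSup_eq_maximum) auto

lemma support_pos: "v \<noteq> 0 \<Longrightarrow> support_fun K v > 0"
proof -
  assume v: "v \<noteq> 0"
  have "(\<rho> / norm v) *\<^sub>R v \<in> K" using \<rho> v by (auto simp: subset_eq)
  then have "v \<bullet> ((\<rho> / norm v) *\<^sub>R v) \<le> support_fun K v" by (rule support_ge)
  moreover have "v \<bullet> ((\<rho> / norm v) *\<^sub>R v) > 0" using v \<rho> by simp
  ultimately show ?thesis by simp
qed

text \<open>The maximum of the functional is positive, so moving outward along the ray of a
  maximizer would increase it; a maximizer therefore has gauge 1.\<close>

lemma gauge_1_of_support:
  assumes x: "x \<in> K" and v: "v \<noteq> 0" and sup: "\<And>y. y \<in> K \<Longrightarrow> v \<bullet> y \<le> v \<bullet> x"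
  shows "gauge_fun K x = 1" "x \<noteq> 0"
proof -
  have h: "v \<bullet> x > 0" using support_pos[OF v] support_eqI[OF x sup] by simp
  then show x0: "x \<noteq> 0" by auto
  let ?g = "gauge_fun K x"
  have g: "?g > 0" "?g \<le> 1" using gauge_K_pos[OF x0] x K.gauge_le_1_iff by auto
  have "x /\<^sub>R ?g \<in> K" using K.gauge_le_iff[OF g(1), of x] by simp
  then have "v \<bullet> (x /\<^sub>R ?g) \<le> v \<bullet> x" by (rule sup)
  then have "v \<bullet> x \<le> ?g * (v \<bullet> x)" using g(1) by (simp add: field_simps)
  then show "?g = 1" using h g by simp
qed

section \<open>Measurability of the reverse radial Gauss image\<close>

lemma mem_rev_radial_gauss:
  assumes \<eta>: "\<eta> \<subseteq> sphere 0 1" and x: "x \<noteq> 0"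
  shows "x /\<^sub>R norm x \<in> rev_radial_gauss K \<eta> \<longleftrightarrow> (\<exists>v\<in>\<eta>. \<forall>y\<in>K. v \<bullet> y \<le> v \<bullet> (x /\<^sub>R gauge_fun K x))"
proof -
  let ?u = "x /\<^sub>R norm x" and ?b = "x /\<^sub>R gauge_fun K x"
  have g: "gauge_fun K x > 0" using x by (rule gauge_K_pos)
  have "gauge_fun K ?u = gauge_fun K x / norm x"
    using K.gauge_scale[of "inverse (norm x)" x] x by (simp add: divide_inverse mult.commute)
  then have b: "radial_fun K ?u *\<^sub>R ?u = ?b" using x by (simp add: radial_fun_eq inverse_eq_divide)
  have bK: "?b \<in> K" using K.gauge_le_iff[OF g, of x] by simp
  have "?b \<bullet> v = support_fun K v \<longleftrightarrow> (\<forall>y\<in>K. v \<bullet> y \<le> v \<bullet> ?b)" for v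
    using support_ge[of _ v] support_eqI[OF bK, of v] by (metis inner_commute)
  then show ?thesis
    unfolding rev_radial_gauss_def supp_hyperplane_def mem_Collect_eq b using x by simp
qed

lemma rev_radial_gauss_sphere: "rev_radial_gauss K \<eta> \<subseteq> sphere 0 1"
  by (auto simp: rev_radial_gauss_def)

lemma rev_radial_gauss_Union: "rev_radial_gauss K (\<Union>i\<in>I. \<eta> i) = (\<Union>i\<in>I. rev_radial_gauss K (\<eta> i))"
  by (auto simp: rev_radial_gauss_def)

text \<open>The pairs of a boundary point and a normal in \<open>C\<close> form a compact set
  \<open>D\<close>, from which the image arises by projection and normalization. The Borel sets
  needed later are built from compact images.\<close>

lemma compact_rev_radial_gauss:
  assumes C: "compact C" "C \<subseteq> sphere 0 1"
  shows "compact (rev_radial_gauss K C)"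
proof -
  define D where "D = (K \<times> C) \<inter> (\<Inter>y\<in>K. {p. snd p \<bullet> y \<le> snd p \<bullet> fst p})"
  have "closed (\<Inter>y\<in>K. {p :: 'a \<times> 'a. snd p \<bullet> y \<le> snd p \<bullet> fst p})"
    by (intro closed_INT ballI closed_Collect_le continuous_intros)
  then have "compact D" unfolding D_def using compact_K C(1) by (intro compact_Int_closed compact_Times)
  then have B: "compact (fst ` D)" by (intro compact_continuous_image continuous_intros)
  have D: "gauge_fun K x = 1 \<and> x \<noteq> 0" if "x \<in> fst ` D" for x
  proof -
    from that obtain v where v: "x \<in> K" "v \<in> C" "\<And>y. y \<in> K \<Longrightarrow> v \<bullet> y \<le> v \<bullet> x" by (auto simp: D_def)
    have "v \<noteq> 0" using v(2) C(2) by auto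
    then show ?thesis using gauge_1_of_support[OF v(1) _ v(3)] by blast
  qed
  have "rev_radial_gauss K C = (\<lambda>x. x /\<^sub>R norm x) ` fst ` D"
  proof (intro set_eqI iffI)
    fix u assume u: "u \<in> rev_radial_gauss K C"
    then have n: "norm u = 1" using rev_radial_gauss_sphere[of C] by (auto simp: subset_eq)
    then have u0: "u \<noteq> 0" by auto
    obtain v where v: "v \<in> C" "\<forall>y\<in>K. v \<bullet> y \<le> v \<bullet> (u /\<^sub>R gauge_fun K u)"
      using mem_rev_radial_gauss[OF C(2) u0] u n by auto
    have g: "gauge_fun K u > 0" using u0 by (rule gauge_K_pos)
    have "u /\<^sub>R gauge_fun K u \<in> K" using K.gauge_le_iff[OF g, of u] by simp
    then have "u /\<^sub>R gauge_fun K u \<in> fst ` D" using v by (auto simp: D_def image_iff intro!: bexI[of _ "(u /\<^sub>R gauge_fun K u, v)"])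
    moreover have "u = (u /\<^sub>R gauge_fun K u) /\<^sub>R norm (u /\<^sub>R gauge_fun K u)" using g n by simp
    ultimately show "u \<in> (\<lambda>x. x /\<^sub>R norm x) ` fst ` D" by blast
  next
    fix u assume "u \<in> (\<lambda>x. x /\<^sub>R norm x) ` fst ` D"
    then obtain x where x: "x \<in> fst ` D" "u = x /\<^sub>R norm x" by blast
    then obtain v where v: "x \<in> K" "v \<in> C" "\<And>y. y \<in> K \<Longrightarrow> v \<bullet> y \<le> v \<bullet> x" by (auto simp: D_def)
    show "u \<in> rev_radial_gauss K C"
      unfolding x(2) using mem_rev_radial_gauss[OF C(2), of x] D[OF x(1)] v by auto
  qed
  moreover have "continuous_on (fst ` D) (\<lambda>x. x /\<^sub>R norm x)" using D by (intro continuous_intros) auto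
  ultimately show ?thesis using B compact_continuous_image by metis
qed

lemma rev_radial_gauss_borel_closed:
  assumes "closed L" shows "rev_radial_gauss K (sphere 0 1 \<inter> L) \<in> sets borel"
proof -
  have "compact (sphere 0 1 \<inter> L)" using assms by (intro compact_Int_closed) auto
  then have "compact (rev_radial_gauss K (sphere 0 1 \<inter> L))" by (rule compact_rev_radial_gauss) auto
  then show ?thesis by (rule borel_compact)
qed

text \<open>An open set is a countable union of compact sets and the image commutes with unions.
  Complements are not accessible through images, since one boundary point may have several
  normals.\<close>

lemma rev_radial_gauss_borel_open:
  assumes "open U" shows "rev_radial_gauss K (sphere 0 1 \<inter> U) \<in> sets borel"
proof -
  obtain C :: "nat \<Rightarrow> 'a set" where C: "\<And>n. compact (C n)" "\<Union>(range C) = U"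
    using open_Union_compact_subsets[OF assms] by metis
  have "sphere 0 1 \<inter> U = (\<Union>n\<in>UNIV. sphere 0 1 \<inter> C n)" using C(2) by auto
  then have "rev_radial_gauss K (sphere 0 1 \<inter> U) = (\<Union>n\<in>UNIV. rev_radial_gauss K (sphere 0 1 \<inter> C n))"
    by (simp only: rev_radial_gauss_Union)
  also have "\<dots> \<in> sets borel"
    using C(1) by (intro sets.countable_UN) (auto intro: rev_radial_gauss_borel_closed compact_imp_closed)
  finally show ?thesis .
qed

lemma rev_radial_gauss_full: "rev_radial_gauss K (sphere 0 1) = sphere 0 1"
proof (intro equalityI rev_radial_gauss_sphere subsetI)
  fix u :: 'a assume u: "u \<in> sphere 0 1"
  then have n: "norm u = 1" and u0: "u \<noteq> 0" by auto
  let ?g = "gauge_fun K u" and ?b = "u /\<^sub>R gauge_fun K u"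
  have g: "?g > 0" using u0 by (rule gauge_K_pos)
  have bK: "?b \<in> K" using K.gauge_le_iff[OF g, of u] by simp
  have gb: "gauge_fun K ?b = 1" using K.gauge_scale[of "inverse ?g" u] g by simp
  have "?b \<notin> interior K"
  proof
    assume "?b \<in> interior K"
    then obtain e where e: "e > 0" "cball ?b e \<subseteq> K" using mem_interior_cball by blast
    have nb: "norm ?b > 0" using u0 g by simp
    \<comment> \<open>Pushed outward by \<open>e\<close> along its ray, the point would still belong
      to \<open>K\<close> but have gauge above 1.\<close>
    let ?c = "(1 + e / norm ?b) *\<^sub>R ?b"
    have "?b - ?c = - ((e / norm ?b) *\<^sub>R ?b)" by (simp only: scaleR_add_left scaleR_one) simp
    then have "norm (?b - ?c) = \<bar>e / norm ?b\<bar> * norm ?b" by (simp only: norm_minus_cancel norm_scaleR)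
    then have "norm (?b - ?c) = e" using e(1) nb u0 g by simp
    then have "?c \<in> K" using e(2) by (auto simp: subset_eq dist_norm)
    then have "gauge_fun K ?c \<le> 1" by (simp add: K.gauge_le_1_iff)
    moreover have "gauge_fun K ?c = (1 + e / norm ?b) * 1"
      using K.gauge_scale[of "1 + e / norm ?b" ?b] e(1) nb gb by (simp add: add_pos_pos)
    moreover have "e / norm ?b > 0" using e(1) nb by simp
    ultimately show False by simp
  qed
  then have "?b \<notin> rel_interior K" using rel_interior_nonempty_interior[OF interior_K] by simp
  moreover have "?b \<in> closure K" using bK closure_subset by blast
  ultimately obtain a where a: "a \<noteq> 0" "\<And>y. y \<in> closure K \<Longrightarrow> a \<bullet> ?b \<le> a \<bullet> y"
    using supporting_hyperplane_relative_frontier[OF convex_K] by metis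
  define v where "v = (- 1 / norm a) *\<^sub>R a"
  have "v \<in> sphere 0 1" using a(1) by (simp add: v_def)
  moreover have "\<forall>y\<in>K. v \<bullet> y \<le> v \<bullet> ?b"
  proof
    fix y assume "y \<in> K"
    then have "a \<bullet> ?b \<le> a \<bullet> y" using a(2) closure_subset by blast
    then have "(1 / norm a) * (a \<bullet> ?b) \<le> (1 / norm a) * (a \<bullet> y)" by (intro mult_left_mono) auto
    then show "v \<bullet> y \<le> v \<bullet> ?b" by (simp add: v_def)
  qed
  ultimately show "u \<in> rev_radial_gauss K (sphere 0 1)"
    using mem_rev_radial_gauss[OF order_refl u0] n by auto
qed

text \<open>Since \<open>\<rho>\<^sup>q / q\<close> is the integral of \<open>r\<^sup>q\<^sup>-\<^sup>1\<close> over \<open>[0, \<rho>]\<close>, the dual curvature measure is an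
  integral of this weight over a cone.\<close>

definition weight :: "real \<Rightarrow> 'a \<Rightarrow> ennreal" where
  "weight q x = indicator K x * ennreal (norm x powr (q - real DIM('a)))"

lemma weight_borel [measurable]: "weight q \<in> borel_measurable borel"
  unfolding weight_def by measurable

definition cone_weight :: "real \<Rightarrow> 'a set \<Rightarrow> ennreal" where
  "cone_weight q A = (\<integral>\<^sup>+x. indicator A (x /\<^sub>R norm x) * weight q x \<partial>lborel)"

text \<open>In polar coordinates for the norm the weight becomes the integral of n r^(n-1) r^(q-n) =
  n r^(q-1) up to the radial function, which is n/q times its q-th power.\<close>

lemma cone_weight_polar:
  assumes q: "q > 0" and [measurable]: "A \<in> sets borel" and A: "A \<subseteq> sphere 0 1"
  shows "cone_weight q A = ennreal (real DIM('a) / q) * (\<integral>\<^sup>+u. indicator A u * ennreal (radial_fun K u powr q) \<partial>cone_measure)"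
proof -
  let ?n = "DIM('a)"
  define F :: "'a \<times> real \<Rightarrow> ennreal" where
    "F p = indicator A (fst p) * (if snd p * gauge_fun K (fst p) \<le> 1 then 1 else 0) * ennreal (snd p powr (q - real ?n))" for p
  have [measurable]: "F \<in> borel_measurable (borel \<Otimes>\<^sub>M borel)" unfolding F_def by measurable
  have ae: "AE x in lborel. norm (x::'a) > 0"
    using AE_lborel_singleton[of "0::'a"] by eventually_elim simp
  have "cone_weight q A = (\<integral>\<^sup>+x. F (x /\<^sub>R norm x, norm x) \<partial>lborel)"
    unfolding cone_weight_def using ae
  proof (intro nn_integral_cong_AE, elim eventually_mono)
    fix x :: 'a assume x: "norm x > 0"
    have "norm x * gauge_fun K (x /\<^sub>R norm x) = gauge_fun K x"
      using K.gauge_scale[of "inverse (norm x)" x] x by simp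
    then show "indicator A (x /\<^sub>R norm x) * weight q x = F (x /\<^sub>R norm x, norm x)"
      by (simp add: F_def weight_def K.gauge_le_1_iff indicator_def)
  qed
  also have "\<dots> = (\<integral>\<^sup>+x. indicator {x. norm x \<le> 1} x *
        (\<integral>\<^sup>+r. indicator {0<..} r * ennreal (real ?n * r ^ (?n - 1)) * F (x /\<^sub>R norm x, r) \<partial>lborel) \<partial>lborel)"
  proof (rule nn_integral_polar)
    show "(\<integral>\<^sup>+x. f (s *\<^sub>R x) \<partial>lborel) = ennreal (1 / s ^ ?n) * (\<integral>\<^sup>+x. f x \<partial>lborel)"
      if "f \<in> borel_measurable borel" "s > 0" for f :: "'a \<Rightarrow> ennreal" and s
      using that by (rule nn_integral_lborel_scale)
  qed (use ae sigma_finite_lborel in auto)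
  also have "\<dots> = (\<integral>\<^sup>+x. indicator (cball 0 1) x * (ennreal (real ?n / q) * (indicator A (x /\<^sub>R norm x) * ennreal (radial_fun K (x /\<^sub>R norm x) powr q))) \<partial>lborel)"
  proof (intro nn_integral_cong arg_cong2[where f="(*)"])
    fix x :: 'a
    let ?u = "x /\<^sub>R norm x"
    show "indicator {x. norm x \<le> 1} x = (indicator (cball 0 1) x :: ennreal)" by (simp add: indicator_def)
    show "(\<integral>\<^sup>+r. indicator {0<..} r * ennreal (real ?n * r ^ (?n - 1)) * F (?u, r) \<partial>lborel)
        = ennreal (real ?n / q) * (indicator A ?u * ennreal (radial_fun K ?u powr q))"
    proof (cases "?u \<in> A")
      case True
      then have u0: "?u \<noteq> 0" using A by auto
      then have g: "gauge_fun K ?u > 0" by (rule gauge_K_pos)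
      let ?a = "radial_fun K ?u"
      have a: "?a = 1 / gauge_fun K ?u" "?a > 0" using radial_fun_eq[OF u0] g by auto
      have "(\<integral>\<^sup>+r. indicator {0<..} r * ennreal (real ?n * r ^ (?n - 1)) * F (?u, r) \<partial>lborel)
        = (\<integral>\<^sup>+r. ennreal (real ?n / q) * (ennreal (q * r powr (q - 1)) * indicator {0<..?a} r) \<partial>lborel)"
      proof (rule nn_integral_cong)
        fix r :: real
        show "indicator {0<..} r * ennreal (real ?n * r ^ (?n - 1)) * F (?u, r)
          = ennreal (real ?n / q) * (ennreal (q * r powr (q - 1)) * indicator {0<..?a} r)"
        proof (cases "r > 0")
          case r: True
          have in_iff: "r * gauge_fun K ?u \<le> 1 \<longleftrightarrow> r \<le> ?a" unfolding a(1) using pos_le_divide_eq[OF g, of r 1] by simp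
          have "r ^ (?n - 1) = r powr (real ?n - 1)" using r by (simp add: powr_realpow[symmetric] of_nat_diff)
          then have "real ?n * r ^ (?n - 1) * r powr (q - real ?n) = real ?n / q * (q * r powr (q - 1))"
            using q r by (simp add: powr_add[symmetric])
          then have "ennreal (real ?n * r ^ (?n - 1)) * ennreal (r powr (q - real ?n)) = ennreal (real ?n / q) * ennreal (q * r powr (q - 1))"
            using q r by (simp only: ennreal_mult'[symmetric] ennreal_mult''[symmetric] powr_ge_zero mult_nonneg_nonneg divide_nonneg_nonneg of_nat_0_le_iff less_imp_le)
          then show ?thesis using r True in_iff by (simp add: F_def indicator_def)
        qed simp
      qed
      also have "\<dots> = ennreal (real ?n / q) * ennreal (?a powr q)"
        using nn_integral_power_real[of ?a q] a(2) q by (subst nn_integral_cmult) auto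
      finally show ?thesis using True by simp
    qed (simp add: F_def)
  qed
  also have "\<dots> = (\<integral>\<^sup>+x. ennreal (real ?n / q) * (indicator (cball 0 1) x * (indicator A (x /\<^sub>R norm x) * ennreal (radial_fun K (x /\<^sub>R norm x) powr q))) \<partial>lborel)"
    by (simp only: mult.left_commute)
  also have "\<dots> = ennreal (real ?n / q) * (\<integral>\<^sup>+u. indicator A u * ennreal (radial_fun K u powr q) \<partial>cone_measure)"
    by (subst nn_integral_cone_measure, simp, subst nn_integral_cmult) auto
  finally show ?thesis .
qed

text \<open>For q < n the weight is singular at the origin. The polar form removes the singularity
  and leaves a power of the bounded radial function.\<close>

lemma cone_weight_finite:
  assumes q: "q > 0" and A: "A \<in> sets borel" "A \<subseteq> sphere 0 1" shows "cone_weight q A < \<infinity>"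
proof -
  obtain R where R: "\<And>x. x \<in> K \<Longrightarrow> norm x \<le> R" using bounded_K unfolding bounded_iff by auto
  have "(\<integral>\<^sup>+u. indicator A u * ennreal (radial_fun K u powr q) \<partial>cone_measure) \<le> (\<integral>\<^sup>+u. ennreal (R powr q) \<partial>(cone_measure :: 'a measure))"
  proof (rule nn_integral_mono)
    fix u :: 'a
    show "indicator A u * ennreal (radial_fun K u powr q) \<le> ennreal (R powr q)"
    proof (cases "u \<in> A")
      case True
      then have n: "norm u = 1" and u0: "u \<noteq> 0" using A(2) by auto
      have g: "gauge_fun K u > 0" using u0 by (rule gauge_K_pos)
      have "u /\<^sub>R gauge_fun K u \<in> K" using K.gauge_le_iff[OF g, of u] by simp
      then have "radial_fun K u \<le> R" using R[of "u /\<^sub>R gauge_fun K u"] n g by (simp add: radial_fun_eq[OF u0] inverse_eq_divide)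
      then have "radial_fun K u powr q \<le> R powr q" using g q by (intro powr_mono2) (auto simp: radial_fun_eq[OF u0])
      then show ?thesis using True by (simp add: ennreal_leI)
    qed simp
  qed
  also have "\<dots> < \<infinity>"
    using finite_measure.emeasure_finite[OF finite_cone_measure, of "UNIV :: 'a set"] by (simp add: ennreal_mult_less_top less_top)
  finally show ?thesis
    unfolding cone_weight_polar[OF q A] by (simp add: ennreal_mult_less_top less_top)
qed

text \<open>The constant \<open>c\<close> depends neither on \<open>q\<close> nor on the set of
  normals, so it disappears from quotients. The factor \<open>q\<close> undoes the 1/q of the polar
  integration.\<close>

lemma dual_curvature_measure_eq:
  assumes n: "DIM('a) \<ge> 2"
  shows "\<exists>c>0. \<forall>q>0. \<forall>\<eta>. rev_radial_gauss K \<eta> \<in> sets borel \<longrightarrow>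
    dual_curvature_measure q K \<eta> = c * q * enn2real (cone_weight q (rev_radial_gauss K \<eta>))"
proof -
  let ?n = "real DIM('a)"
  obtain \<kappa> where \<kappa>: "\<kappa> > 0" "\<And>f :: 'a \<Rightarrow> ennreal. f \<in> borel_measurable borel \<Longrightarrow>
    (\<integral>\<^sup>+u. indicator (sphere 0 1) u * f u \<partial>hausdorff_measure (?n - 1)) = ennreal \<kappa> * (\<integral>\<^sup>+u. f u \<partial>cone_measure)"
    using hausdorff_measure_sphere[OF n] by metis
  have "dual_curvature_measure q K \<eta> = \<kappa> / (?n * ?n) * q * enn2real (cone_weight q (rev_radial_gauss K \<eta>))"
    if q: "q > 0" and A[measurable]: "rev_radial_gauss K \<eta> \<in> sets borel" for q \<eta>
  proof -
    let ?A = "rev_radial_gauss K \<eta>"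
    let ?f = "\<lambda>u. indicator ?A u * ennreal (radial_fun K u powr q)"
    have "(\<integral>\<^sup>+u. ?f u \<partial>hausdorff_measure (?n - 1)) = (\<integral>\<^sup>+u. indicator (sphere 0 1) u * ?f u \<partial>hausdorff_measure (?n - 1))"
      using rev_radial_gauss_sphere[of \<eta>] by (intro nn_integral_cong) (auto simp: indicator_def)
    also have "\<dots> = ennreal \<kappa> * (\<integral>\<^sup>+u. ?f u \<partial>cone_measure)" by (rule \<kappa>(2)) measurable
    finally have 1: "dual_curvature_measure q K \<eta> = \<kappa> * enn2real (\<integral>\<^sup>+u. ?f u \<partial>cone_measure) / ?n"
      using \<kappa>(1) by (simp add: dual_curvature_measure_def enn2real_mult)
    have "enn2real (cone_weight q ?A) = ?n / q * enn2real (\<integral>\<^sup>+u. ?f u \<partial>cone_measure)"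
      unfolding cone_weight_polar[OF q A rev_radial_gauss_sphere] using q by (simp add: enn2real_mult)
    then show ?thesis unfolding 1 using q by (simp add: field_simps)
  qed
  moreover have "\<kappa> / (?n * ?n) > 0" using \<kappa>(1) by simp
  ultimately show ?thesis by blast
qed

end

section \<open>Sections of a symmetric convex body parallel to a subspace\<close>

lemma AE_lborel_open_obtains:
  fixes U :: "'a::euclidean_space set"
  assumes "AE x in lborel. Q x" "open U" "U \<noteq> {}"
  shows "\<exists>x\<in>U. Q x"
proof (rule ccontr)
  assume n: "\<not> ?thesis"
  have "AE x in lborel. x \<notin> U" using assms(1) by eventually_elim (use n in blast)
  then have "emeasure lborel U = 0" using assms(2) by (subst (asm) AE_iff_measurable[OF _ refl]) auto
  then show False using emeasure_lborel_open_pos[OF assms(2,3)] by simp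
qed

lemma AE_sub_measure_open_obtains:
  assumes P: "orth_proj P" and ae: "AE x in sub_measure P. Q x" and U: "open U" "p \<in> U" "P p = p"
  shows "\<exists>x\<in>U. P x = x \<and> Q x"
proof (rule ccontr)
  assume n: "\<not> ?thesis"
  have "AE x in sub_measure P. x \<notin> U"
    using ae AE_sub_measure_range[OF P] by eventually_elim (use n in blast)
  then have "emeasure (sub_measure P) U = 0" using U(1) by (subst (asm) AE_iff_measurable[OF _ refl]) auto
  then show False using emeasure_sub_measure_open_pos[OF P U(1,3,2)] by simp
qed

lemma dim_range_orth_proj_compl:
  fixes P :: "'a::euclidean_space \<Rightarrow> 'a"
  assumes P: "orth_proj P"
  shows "dim (range (\<lambda>x. x - P x)) + dim (range P) = DIM('a)"
proof -
  have "range (\<lambda>x. x - P x) = {y \<in> UNIV. \<forall>x\<in>range P. orthogonal x y}"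
  proof (intro set_eqI iffI)
    fix y assume "y \<in> range (\<lambda>x. x - P x)"
    then show "y \<in> {y \<in> UNIV. \<forall>x\<in>range P. orthogonal x y}"
      using orth_proj_orth[OF P] by (auto simp: orthogonal_def)
  next
    fix y assume "y \<in> {y \<in> UNIV. \<forall>x\<in>range P. orthogonal x y}"
    then have "P y \<bullet> y = 0" by (auto simp: orthogonal_def)
    then have "P y \<bullet> P y = 0" by (metis inner_commute orth_proj_idem[OF P] orth_proj_self_adjoint[OF P])
    then have "y = y - P y" by simp
    then show "y \<in> range (\<lambda>x. x - P x)" by (rule range_eqI)
  qed
  then show ?thesis
    using dim_subspace_orthogonal_to_vectors[OF orth_proj_subspace[OF P] subspace_UNIV] by (simp add: dim_UNIV)
qed

text \<open>Represents a negative power of a as a mixture of the indicators of r \<ge> a; for a =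
  \<open>norm x\<close> these are the centred balls containing \<open>x\<close>.\<close>

lemma nn_integral_power_tail:
  fixes a p :: real
  assumes a: "0 < a" and p: "p > 0"
  shows "(\<integral>\<^sup>+r. ennreal (p * r powr (- p - 1)) * indicator {a..} r \<partial>lborel) = ennreal (a powr (- p))"
proof -
  have "(\<integral>\<^sup>+r. ennreal (p * r powr (- p - 1)) * indicator {a..} r \<partial>lborel) = ennreal (0 - (- (a powr (- p))))"
  proof (rule nn_integral_FTC_atLeast[where F="\<lambda>r. - (r powr (- p))"])
    show "DERIV (\<lambda>r. - (r powr (- p))) r :> p * r powr (- p - 1)" if "a \<le> r" for r
      using that a by (auto intro!: derivative_eq_intros)
    have "((\<lambda>r::real. r powr (- p)) \<longlongrightarrow> 0) at_top"
      using p by (intro tendsto_neg_powr filterlim_ident) auto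
    then show "((\<lambda>r::real. - (r powr (- p))) \<longlongrightarrow> 0) at_top"
      using tendsto_minus by fastforce
  qed (use p in auto)
  then show ?thesis by simp
qed

section \<open>Sections parallel to the complement of a subspace\<close>

locale proj =
  fixes P :: "'a::euclidean_space \<Rightarrow> 'a"
  assumes P: "orth_proj P"
begin

abbreviation Q where "Q \<equiv> \<lambda>x. x - P x"

lemma Q: "orth_proj Q" using P by (rule orth_proj_compl)

sublocale linear P using P by (rule orth_proj_linear)

lemma PP [simp]: "P (P x) = P x" using P by (rule orth_proj_idem)

lemma P_borel [measurable]: "P \<in> borel_measurable borel" using P by (rule orth_proj_borel)

sublocale \<mu>P: sigma_finite_measure "sub_measure P" using P by (rule sigma_finite_sub_measure)
sublocale \<mu>Q: sigma_finite_measure "sub_measure Q" using Q by (rule sigma_finite_sub_measure)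

lemma AE_P: "AE y in sub_measure P. P y = y" using P by (rule AE_sub_measure_range)

lemma AE_Q: "AE z in sub_measure Q. P z = 0"
  using AE_sub_measure_range[OF Q] by eventually_elim simp

definition section_volume :: "'a set \<Rightarrow> 'a \<Rightarrow> ennreal" where
  "section_volume E y = (\<integral>\<^sup>+z. indicator E (y + z) \<partial>sub_measure Q)"

lemma section_volume_borel [measurable]:
  assumes [measurable]: "E \<in> sets borel" shows "section_volume E \<in> borel_measurable borel"
  unfolding section_volume_def by measurable

lemma section_volume_finite:
  assumes "bounded E" shows "section_volume E y < \<infinity>"
proof -
  have "section_volume E y \<le> (\<integral>\<^sup>+z. indicator (cball 0 (norm y + r)) z \<partial>sub_measure Q)" if r: "\<And>x. x \<in> E \<Longrightarrow> norm x \<le> r" for r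
    unfolding section_volume_def
  proof (rule nn_integral_mono)
    fix z
    show "indicator E (y + z) \<le> (indicator (cball 0 (norm y + r)) z :: ennreal)"
      using r[of "y + z"] norm_triangle_ineq4[of "y + z" y] by (auto simp: indicator_def)
  qed
  moreover obtain r where "\<And>x. x \<in> E \<Longrightarrow> norm x \<le> r" using assms unfolding bounded_iff by auto
  ultimately have "section_volume E y \<le> emeasure (sub_measure Q) (cball 0 (norm y + r))" by simp
  also have "\<dots> < \<infinity>" by (rule emeasure_sub_measure_bounded[OF Q]) simp
  finally show ?thesis .
qed

lemma section_volume_midpoint:
  assumes E[measurable]: "E \<in> sets borel" and cE: "convex E"
  shows "section_volume E x * section_volume E y \<le> (section_volume E ((1/2) *\<^sub>R (x + y)))\<^sup>2"
  unfolding section_volume_def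
proof (rule prekopa_leindler_sub_measure[OF Q])
  fix a b
  have "(1/2) *\<^sub>R (x + a) + (1/2) *\<^sub>R (y + b) \<in> E" if "x + a \<in> E" "y + b \<in> E"
    using convexD[OF cE that, of "1/2" "1/2"] by simp
  moreover have "(1/2) *\<^sub>R (x + a) + (1/2) *\<^sub>R (y + b) = (1/2) *\<^sub>R (x + y) + (1/2) *\<^sub>R (a + b)"
    by (simp add: scaleR_add_right)
  ultimately show "indicator E (x + a) * indicator E (y + b) \<le> ((indicator E ((1/2) *\<^sub>R (x + y) + (1/2) *\<^sub>R (a + b)))\<^sup>2 :: ennreal)"
    by (auto simp: indicator_def)
qed measurable

lemma section_volume_uminus:
  assumes [measurable]: "E \<in> sets borel" and sym: "\<And>x. x \<in> E \<Longrightarrow> - x \<in> E"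
  shows "section_volume E (- y) = section_volume E y"
proof -
  have "indicator E (- y + - z) = (indicator E (y + z) :: ennreal)" for z
    using sym[of "y + z"] sym[of "- y + - z"] by (auto simp: indicator_def add.commute)
  then show ?thesis
    unfolding section_volume_def
    using nn_integral_sub_measure_uminus[OF Q, of "\<lambda>z. indicator E (- y + z)"] by simp
qed

text \<open>Reverse Fatou: one ball dominates all the sections involved, and upper semicontinuity of
  the indicator at each point is closedness of \<open>E\<close>.\<close>

lemma section_volume_usc:
  assumes E: "compact E" and lim: "y \<longlonglongrightarrow> w"
  shows "limsup (\<lambda>j. section_volume E (y j)) \<le> section_volume E w"
proof -
  have [measurable]: "E \<in> sets borel" using E by (rule borel_compact)
  obtain r where r: "\<And>x. x \<in> E \<Longrightarrow> norm x \<le> r" using compact_imp_bounded[OF E] unfolding bounded_iff by auto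
  obtain s where s: "\<And>j. norm (y j) \<le> s" using convergent_imp_Bseq[OF convergentI[OF lim]] by (auto simp: Bseq_def)
  let ?B = "cball 0 (s + r) :: 'a set"
  have "limsup (\<lambda>j. section_volume E (y j)) \<le> (\<integral>\<^sup>+z. limsup (\<lambda>j. indicator E (y j + z)) \<partial>sub_measure Q)"
    unfolding section_volume_def
  proof (rule nn_integral_limsup[where w="indicator ?B"])
    show "AE z in sub_measure Q. indicator E (y j + z) \<le> (indicator ?B z :: ennreal)" for j
    proof (rule AE_I2)
      fix z
      show "indicator E (y j + z) \<le> (indicator ?B z :: ennreal)"
        using r[of "y j + z"] s[of j] norm_triangle_ineq4[of "y j + z" "y j"] by (auto simp: indicator_def)
    qed
    show "(\<integral>\<^sup>+z. indicator ?B z \<partial>sub_measure Q) < \<infinity>"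
      using emeasure_sub_measure_bounded[OF Q, of ?B] by simp
  qed measurable
  also have "\<dots> \<le> section_volume E w"
    unfolding section_volume_def
  proof (rule nn_integral_mono)
    fix z
    show "limsup (\<lambda>j. indicator E (y j + z)) \<le> (indicator E (w + z) :: ennreal)"
    proof (cases "w + z \<in> E")
      case True
      have "limsup (\<lambda>j. indicator E (y j + z)) \<le> (1 :: ennreal)"
        by (rule Limsup_bounded) (simp add: indicator_def)
      then show ?thesis using True by simp
    next
      case False
      have "(\<lambda>j. y j + z) \<longlonglongrightarrow> w + z" using lim by (intro tendsto_intros)
      moreover have "open (- E)" using compact_imp_closed[OF E] by auto
      ultimately have "eventually (\<lambda>j. y j + z \<in> - E) sequentially"
        using False by (auto dest: topological_tendstoD)
      then have "eventually (\<lambda>j. indicator E (y j + z) \<le> (0 :: ennreal)) sequentially"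
        by eventually_elim simp
      then have "limsup (\<lambda>j. indicator E (y j + z)) \<le> (0 :: ennreal)" by (rule Limsup_bounded)
      then show ?thesis by (rule order.trans) simp
    qed
  qed
  finally show ?thesis .
qed

text \<open>Anderson's inequality along a ray, from midpoint log-concavity and upper semicontinuity.\<close>

lemma section_volume_shrink:
  assumes E: "compact E" "convex E" and sym: "\<And>x. x \<in> E \<Longrightarrow> - x \<in> E" and s: "\<bar>s\<bar> \<le> 1"
  shows "section_volume E y \<le> section_volume E (s *\<^sub>R y)"
proof -
  have Eb: "E \<in> sets borel" using E(1) by (rule borel_compact)
  let ?v = "section_volume E"
  \<comment> \<open>The claim is that \<open>T\<close> is the whole interval: it is closed by
    semicontinuity, closed under midpoints by log-concavity, and contains both ends by
    symmetry.\<close>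
  define T where "T = {s \<in> {-1..1}. ?v y \<le> ?v (s *\<^sub>R y)}"
  have mid: "(a + b) / 2 \<in> T" if "a \<in> T" "b \<in> T" for a b
  proof -
    have "(?v y)\<^sup>2 \<le> ?v (a *\<^sub>R y) * ?v (b *\<^sub>R y)"
      using that unfolding power2_eq_square T_def by (intro mult_mono) auto
    also have "\<dots> \<le> (?v ((1/2) *\<^sub>R (a *\<^sub>R y + b *\<^sub>R y)))\<^sup>2" by (rule section_volume_midpoint[OF Eb E(2)])
    also have "(1/2) *\<^sub>R (a *\<^sub>R y + b *\<^sub>R y) = ((a + b) / 2) *\<^sub>R y" by (simp add: scaleR_add_left[symmetric])
    finally have "(?v y)\<^sup>2 \<le> (?v (((a + b) / 2) *\<^sub>R y))\<^sup>2" .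
    moreover have "?v y < top" "?v (((a + b) / 2) *\<^sub>R y) < top"
      using section_volume_finite[OF compact_imp_bounded[OF E(1)]] by simp_all
    ultimately have "?v y \<le> ?v (((a + b) / 2) *\<^sub>R y)"
      by (cases "?v y"; cases "?v (((a + b) / 2) *\<^sub>R y)") (auto simp: ennreal_power ennreal_le_iff power2_le_iff_abs_le)
    then show ?thesis using that by (auto simp: T_def)
  qed
  have cl: "closed T"
  proof (rule closed_sequential_limits[THEN iffD2], intro allI impI, elim conjE)
    fix a l assume a: "\<forall>n. a n \<in> T" "a \<longlonglongrightarrow> l"
    have "(\<lambda>n. a n *\<^sub>R y) \<longlonglongrightarrow> l *\<^sub>R y" using a(2) by (intro tendsto_intros)
    then have "limsup (\<lambda>n. ?v (a n *\<^sub>R y)) \<le> ?v (l *\<^sub>R y)" by (rule section_volume_usc[OF E(1)])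
    moreover have "?v y \<le> limsup (\<lambda>n. ?v (a n *\<^sub>R y))"
      using a(1) by (intro le_Limsup) (auto simp: T_def)
    moreover have "l \<in> {-1..1}"
      using a by (intro closed_sequentially[of "{-1..1::real}" a l]) (auto simp: T_def)
    ultimately show "l \<in> T" by (auto simp: T_def)
  qed
  have ends: "1 \<in> T" "-1 \<in> T" using section_volume_uminus[OF Eb sym, of y] by (auto simp: T_def)
  have "s \<in> T"
  proof (rule ccontr)
    \<comment> \<open>Then \<open>s\<close> lies in a gap of \<open>T\<close>, and the midpoint of
      the two ends of the gap is a member of \<open>T\<close> inside the gap.\<close>
    assume n: "s \<notin> T"
    define a where "a = Sup (T \<inter> {..s})"
    define b where "b = Inf (T \<inter> {s..})"
    have a: "a \<in> T \<inter> {..s}" unfolding a_def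
      using ends s cl by (intro closed_contains_Sup closed_Int) auto
    have b: "b \<in> T \<inter> {s..}" unfolding b_def
      using ends s cl by (intro closed_contains_Inf closed_Int) auto
    have ab: "a < s" "s < b" using a b n by (auto simp: order.order_iff_strict)
    have m: "(a + b) / 2 \<in> T" using mid a b by auto
    show False
    proof (cases "(a + b) / 2 \<le> s")
      case True
      then have "(a + b) / 2 \<le> a" unfolding a_def[symmetric] using m
        by (subst a_def, intro cSup_upper) auto
      then show False using ab by simp
    next
      case False
      then have "b \<le> (a + b) / 2" using m
        by (subst b_def, intro cInf_lower) auto
      then show False using ab by simp
    qed
  qed
  then show ?thesis by (simp add: T_def)
qed

end

section \<open>The projection of the body and the contact set\<close>

locale sym_body_proj = sym_body K + proj P
  for K :: "'a::euclidean_space set" and P :: "'a \<Rightarrow> 'a" +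
  assumes nontrivial: "range P \<noteq> {0}" and proper: "range P \<noteq> UNIV"
begin

abbreviation k where "k \<equiv> dim (range P)"

lemma dim_range_pos: "k > 0"
proof -
  have "0 \<in> range P" by (metis zero rangeI)
  then have "\<not> range P \<subseteq> {0}" using nontrivial by auto
  then obtain p where p: "p \<in> range P" "p \<noteq> 0" by auto
  have "dim {p} \<le> k" using p(1) by (intro dim_subset) simp
  then show ?thesis using p(2) by (simp add: dim_singleton)
qed

lemma dim_range_less: "k < DIM('a)"
  using proper dim_eq_full[of "range P"] dim_subset_UNIV[of "range P"] orth_proj_subspace[OF P]
  by (metis le_neq_implies_less span_eq_iff)

text \<open>The cylinder over the orthogonal projection of \<^term>\<open>K\<close>; its gauge is the gauge of the
  projection, evaluated at \<^term>\<open>P x\<close>.\<close>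

definition cyl :: "'a set" where "cyl = P -` (P ` K)"

sublocale C: gauge_set cyl \<rho>
proof
  have "compact (P ` K)" using compact_K orth_proj_continuous[OF P] by (rule compact_continuous_image[rotated])
  then show "closed cyl" unfolding cyl_def
    by (intro closed_vimage compact_imp_closed orth_proj_continuous[OF P])
  show "convex cyl" unfolding cyl_def
    by (intro convex_linear_vimage convex_linear_image linear_axioms convex_K)
  show "cball 0 \<rho> \<subseteq> cyl" using \<rho>(2) by (auto simp: cyl_def)
qed (rule \<rho>)

abbreviation N where "N \<equiv> gauge_fun cyl"

lemma N_P: "N (P x) = N x"
  unfolding gauge_fun_def cyl_def by (simp add: scale)

lemma N_add: "P z = 0 \<Longrightarrow> N (y + z) = N y"
  using N_P[of "y + z"] N_P[of y] by (simp add: add)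

lemma N_le: "N x \<le> gauge_fun K x"
proof (cases "x = 0")
  case False
  then have g: "gauge_fun K x > 0" by (rule gauge_K_pos)
  then have "x /\<^sub>R gauge_fun K x \<in> K" using K.gauge_le_iff[OF g, of x] by simp
  then have "x /\<^sub>R gauge_fun K x \<in> cyl" by (auto simp: cyl_def)
  then show ?thesis using C.gauge_le_iff[OF g] by blast
qed (simp add: C.gauge_zero K.gauge_zero)

lemma N_pos: assumes "P x \<noteq> 0" shows "N x > 0"
proof -
  obtain R where R: "\<And>a. a \<in> K \<Longrightarrow> norm a \<le> R" "R > 0" using bounded_K unfolding bounded_pos by auto
  have "norm (P x) / R \<le> t" if t: "t > 0" "x /\<^sub>R t \<in> cyl" for t
  proof -
    obtain z where z: "z \<in> K" "P (x /\<^sub>R t) = P z" using t(2) by (auto simp: cyl_def)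
    then have "norm (P x /\<^sub>R t) \<le> R" using R(1)[OF z(1)] orth_proj_norm_le[OF P, of z] by (simp add: scale)
    then have "norm (P x) / t \<le> R" using t(1) by (simp add: divide_inverse mult.commute)
    then show ?thesis using t(1) R(2) by (simp add: field_simps)
  qed
  then have "norm (P x) / R \<le> N x"
    unfolding gauge_fun_def by (intro cInf_greatest C.gauge_nonempty) auto
  moreover have "norm (P x) / R > 0" using assms R(2) by simp
  ultimately show ?thesis by simp
qed

text \<open>A normal v in the range of \<open>P\<close> does not distinguish points with the same
  projection. If the cylinder had a smaller gauge at x than \<open>K\<close>, some point of
  \<open>K\<close> would project to a longer multiple of \<open>P x\<close> than the boundary point
  on the ray of x does, and v would be larger there.\<close>

lemma gauge_eq_of_normal_in_range:
  assumes x: "x \<noteq> 0" "x /\<^sub>R norm x \<in> rev_radial_gauss K (sphere 0 1 \<inter> range P)"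
  shows "gauge_fun K x = N x"
proof (rule ccontr)
  let ?g = "gauge_fun K x"
  assume "?g \<noteq> N x"
  then have lt: "N x < ?g" using N_le[of x] by simp
  obtain v where v: "norm v = 1" "P v = v" "\<forall>y\<in>K. v \<bullet> y \<le> v \<bullet> (x /\<^sub>R ?g)"
    using x(2) mem_rev_radial_gauss[of "sphere 0 1 \<inter> range P", OF _ x(1)] orth_proj_range[OF P] by auto
  have "\<rho> *\<^sub>R v \<in> K" using \<rho> v(1) by (auto simp: subset_eq)
  then have "v \<bullet> (\<rho> *\<^sub>R v) \<le> v \<bullet> (x /\<^sub>R ?g)" using v(3) by blast
  moreover have "v \<bullet> (\<rho> *\<^sub>R v) > 0" using \<rho> v(1) by (auto simp: dot_square_norm)
  moreover have g: "?g > 0" using x(1) by (rule gauge_K_pos)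
  ultimately have "0 < v \<bullet> (x /\<^sub>R ?g)" by linarith
  then have vx: "v \<bullet> x > 0" using g by (simp add: zero_less_mult_iff)
  define t where "t = (N x + ?g) / 2"
  have t: "N x < t" "t < ?g" "t > 0" using lt g C.gauge_nonneg[of x] by (auto simp: t_def)
  have "x /\<^sub>R t \<in> cyl" using C.gauge_le_iff[OF t(3), of x] t by simp
  then obtain z where z: "z \<in> K" "P (x /\<^sub>R t) = P z" by (auto simp: cyl_def)
  have "v \<bullet> z = v \<bullet> P z" using orth_proj_self_adjoint[OF P, of v z] v(2) by simp
  also have "\<dots> = v \<bullet> (x /\<^sub>R t)" using orth_proj_self_adjoint[OF P, of v "x /\<^sub>R t"] v(2) z(2) by simp
  finally have "v \<bullet> (x /\<^sub>R t) \<le> v \<bullet> (x /\<^sub>R ?g)" using v(3) z(1) by metis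
  then have "?g \<le> t" using vx t(3) g by (simp add: field_simps)
  then show False using t by simp
qed

definition section_weight :: "real \<Rightarrow> 'a \<Rightarrow> ennreal" where
  "section_weight q y = (\<integral>\<^sup>+z. weight q (y + z) \<partial>sub_measure Q)"

lemma section_weight_borel [measurable]: "section_weight q \<in> borel_measurable borel"
  unfolding section_weight_def by measurable

definition total_weight :: "real \<Rightarrow> ennreal" where "total_weight q = (\<integral>\<^sup>+x. weight q x \<partial>lborel)"

lemma cone_weight_full: "cone_weight q (rev_radial_gauss K (sphere 0 1)) = total_weight q"
  unfolding cone_weight_def total_weight_def rev_radial_gauss_full
  using AE_lborel_singleton[of "0::'a"]
  by (intro nn_integral_cong_AE, elim eventually_mono) (simp add: indicator_def)

lemma total_weight_finite: "q > 0 \<Longrightarrow> total_weight q < \<infinity>"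
  unfolding cone_weight_full[symmetric] rev_radial_gauss_full by (rule cone_weight_finite) auto

lemma total_weight_fubini: "(\<integral>\<^sup>+y. section_weight q y \<partial>sub_measure P) = fubini_const P * total_weight q"
  unfolding section_weight_def total_weight_def by (rule nn_integral_sub_measure_fubini[OF P]) measurable

text \<open>Where \<^term>\<open>N y = 0\<close> the quotient is the junk value \<open>0\<close>; this happens on a null set only.\<close>

definition radial_weight :: "real \<Rightarrow> ennreal" where
  "radial_weight q = (\<integral>\<^sup>+y. indicator {y. N y \<le> 1} y * section_weight q (y /\<^sub>R N y) \<partial>sub_measure P)"

text \<open>The part of \<^term>\<open>K\<close> over its contact set with the boundary of the cylinder \<^term>\<open>cyl\<close>: a normal
  in \<^term>\<open>range P\<close> is a normal of the cylinder.\<close>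

definition contact_weight :: "real \<Rightarrow> ennreal" where
  "contact_weight q = (\<integral>\<^sup>+x. indicator {x. gauge_fun K x = N x} x * weight q x \<partial>lborel)"

lemma gauss_le_contact_weight: "cone_weight q (rev_radial_gauss K (sphere 0 1 \<inter> range P)) \<le> contact_weight q"
  unfolding cone_weight_def contact_weight_def
proof (rule nn_integral_mono_AE)
  show "AE x in lborel. indicator (rev_radial_gauss K (sphere 0 1 \<inter> range P)) (x /\<^sub>R norm x) * weight q x
      \<le> indicator {x. gauge_fun K x = N x} x * weight q x"
    using AE_lborel_singleton[of "0::'a"]
    by eventually_elim (use gauge_eq_of_normal_in_range in \<open>auto simp: indicator_def\<close>)
qed

text \<open>Dilation by 2 fixes the origin, while the scaling formula multiplies its finite mass by
  2^(-k) with k > 0; so the mass is 0.\<close>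

lemma AE_P_nonzero: "AE y in sub_measure P. y \<noteq> 0"
proof -
  let ?M = "sub_measure P"
  have fin: "emeasure ?M {0} < \<infinity>" by (rule emeasure_sub_measure_bounded[OF P]) simp
  have "(\<integral>\<^sup>+x. indicator {0} ((2::real) *\<^sub>R x) \<partial>?M) = ennreal (1 / 2 ^ k) * (\<integral>\<^sup>+x. indicator {0} x \<partial>?M)"
    by (rule nn_integral_sub_measure_scale[OF P]) simp_all
  also have "(\<integral>\<^sup>+x. indicator {0} ((2::real) *\<^sub>R x) \<partial>?M) = (\<integral>\<^sup>+x. indicator {0} x \<partial>?M)"
    by (intro nn_integral_cong) (simp add: indicator_def)
  finally have eq: "emeasure ?M {0} = ennreal (1 / 2 ^ k) * emeasure ?M {0}" by simp
  obtain r where r: "emeasure ?M {0} = ennreal r" "r \<ge> 0" using fin by (cases "emeasure ?M {0}") auto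
  have "r = (1 / 2 ^ k) * r" using eq r by (simp add: ennreal_mult[symmetric])
  moreover have "(1 / 2 ^ k :: real) < 1" using dim_range_pos by (simp add: one_less_power)
  ultimately have "r = 0" by (metis mult_cancel_right1 order_less_irrefl)
  then have "emeasure ?M {0} = 0" using r by simp
  then show ?thesis by (subst AE_iff_measurable[OF _ refl]) auto
qed

text \<open>The points of the contact cone over \<^term>\<open>y\<close> form the \<^term>\<open>N y\<close>-dilate of the section over
  \<^term>\<open>y /\<^sub>R N y\<close>, so polar coordinates in the range of \<^term>\<open>P\<close> separate the variables.\<close>

lemma contact_weight_eq:
  assumes q: "q > 0"
  shows "fubini_const P * contact_weight q = ennreal (real k / q) * radial_weight q"
proof -
  let ?n = "DIM('a)" and ?m = "dim (range Q)"
  have dims: "?m + k = ?n" using dim_range_orth_proj_compl[OF P] .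
  let ?f = "\<lambda>x. indicator {x. gauge_fun K x = N x} x * weight q x"
  \<comment> \<open>The exponent q - k is the homogeneity q - n of the weight plus the n - k
    dimensions in which the section is dilated.\<close>
  define F :: "'a \<times> real \<Rightarrow> ennreal" where
    "F p = indicator {..1} (snd p) * ennreal (snd p powr (q - real k)) * section_weight q (fst p)" for p
  have [measurable]: "F \<in> borel_measurable (borel \<Otimes>\<^sub>M borel)" unfolding F_def by measurable
  have "fubini_const P * contact_weight q = (\<integral>\<^sup>+y. \<integral>\<^sup>+z. ?f (y + z) \<partial>sub_measure Q \<partial>sub_measure P)"
    unfolding contact_weight_def by (rule nn_integral_sub_measure_fubini[OF P, symmetric]) measurable
  also have "\<dots> = (\<integral>\<^sup>+y. F (y /\<^sub>R N y, N y) \<partial>sub_measure P)"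
    using AE_P AE_P_nonzero
  proof (intro nn_integral_cong_AE, eventually_elim)
    fix y assume Py: "P y = y" and y0: "y \<noteq> 0"
    define t where "t = N y"
    have t: "t > 0" unfolding t_def using Py y0 by (intro N_pos) simp
    define g where "g z = weight q (y /\<^sub>R t + z)" for z
    have [measurable]: "g \<in> borel_measurable borel" unfolding g_def by measurable
    let ?c = "indicator {..1} t * ennreal (t powr (q - real ?n))"
    have "(\<integral>\<^sup>+z. ?f (y + z) \<partial>sub_measure Q) = (\<integral>\<^sup>+z. ?c * g ((1 / t) *\<^sub>R z) \<partial>sub_measure Q)"
      using AE_Q
    proof (intro nn_integral_cong_AE, eventually_elim)
      fix z assume Pz: "P z = 0"
      have Nyz: "N (y + z) = t" using N_add[OF Pz] by (simp add: t_def)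
      have arg: "y /\<^sub>R t + (1 / t) *\<^sub>R z = (y + z) /\<^sub>R t" by (simp add: scaleR_add_right inverse_eq_divide)
      \<comment> \<open>The gauge of \<open>K\<close> is never below that of the cylinder, so
        equality just says that the rescaled point lies in \<open>K\<close>; membership of
        \<open>y + z\<close> itself then reduces to \<open>t \<le> 1\<close>.\<close>
      have "gauge_fun K (y + z) = t \<longleftrightarrow> (y + z) /\<^sub>R t \<in> K"
        using K.gauge_le_iff[OF t, of "y + z"] N_le[of "y + z"] Nyz by auto
      moreover have "gauge_fun K (y + z) = t \<Longrightarrow> y + z \<in> K \<longleftrightarrow> t \<le> 1" using K.gauge_le_1_iff[of "y + z"] by simp
      moreover have "norm (y + z) powr (q - real ?n) = t powr (q - real ?n) * norm ((y + z) /\<^sub>R t) powr (q - real ?n)"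
      proof -
        have "norm ((y + z) /\<^sub>R t) = norm (y + z) / t" using t by (simp add: divide_inverse mult.commute)
        then show ?thesis using t by (simp add: powr_mult[symmetric])
      qed
      then have "ennreal (norm (y + z) powr (q - real ?n)) = ennreal (t powr (q - real ?n)) * ennreal (norm ((y + z) /\<^sub>R t) powr (q - real ?n))"
        by (simp only: ennreal_mult'[OF powr_ge_zero])
      ultimately show "?f (y + z) = ?c * g ((1 / t) *\<^sub>R z)"
        unfolding g_def arg weight_def by (auto simp: indicator_def Nyz mult.assoc)
    qed
    also have "\<dots> = ?c * (\<integral>\<^sup>+z. g ((1 / t) *\<^sub>R z) \<partial>sub_measure Q)" by (rule nn_integral_cmult) measurable
    also have "(\<integral>\<^sup>+z. g ((1 / t) *\<^sub>R z) \<partial>sub_measure Q) = ennreal (t ^ ?m) * section_weight q (y /\<^sub>R t)"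
      using nn_integral_sub_measure_scale[OF Q, of g "1/t"] t by (simp add: power_one_over g_def section_weight_def)
    also have "?c * (ennreal (t ^ ?m) * section_weight q (y /\<^sub>R t)) = indicator {..1} t * (ennreal (t powr (q - real ?n)) * ennreal (t ^ ?m)) * section_weight q (y /\<^sub>R t)"
      by (simp only: mult.assoc)
    also have "ennreal (t powr (q - real ?n)) * ennreal (t ^ ?m) = ennreal (t powr (q - real k))"
    proof -
      have "t powr (q - real ?n) * t ^ ?m = t powr (q - real ?n + real ?m)"
        using t by (simp add: powr_add powr_realpow)
      also have "q - real ?n + real ?m = q - real k" using dims by linarith
      finally show ?thesis using t by (simp add: ennreal_mult[symmetric])
    qed
    finally show "(\<integral>\<^sup>+z. ?f (y + z) \<partial>sub_measure Q) = F (y /\<^sub>R N y, N y)" by (simp add: F_def t_def)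
  qed
  also have "\<dots> = (\<integral>\<^sup>+x. indicator {x. N x \<le> 1} x *
        (\<integral>\<^sup>+r. indicator {0<..} r * ennreal (real k * r ^ (k - 1)) * F (x /\<^sub>R N x, r) \<partial>lborel) \<partial>sub_measure P)"
  proof (rule nn_integral_polar)
    show "AE x in sub_measure P. 0 < N x" using AE_P AE_P_nonzero by eventually_elim (use N_pos in force)
    show "(\<integral>\<^sup>+x. f (s *\<^sub>R x) \<partial>sub_measure P) = ennreal (1 / s ^ k) * (\<integral>\<^sup>+x. f x \<partial>sub_measure P)"
      if "f \<in> borel_measurable borel" "s > 0" for f :: "'a \<Rightarrow> ennreal" and s
      using that by (rule nn_integral_sub_measure_scale[OF P])
  qed (use dim_range_pos C.gauge_scale \<mu>P.sigma_finite_measure_axioms in auto)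
  also have "\<dots> = (\<integral>\<^sup>+x. ennreal (real k / q) * (indicator {x. N x \<le> 1} x * section_weight q (x /\<^sub>R N x)) \<partial>sub_measure P)"
  proof (rule nn_integral_cong)
    fix x
    have "(\<integral>\<^sup>+r. indicator {0<..} r * ennreal (real k * r ^ (k - 1)) * F (x /\<^sub>R N x, r) \<partial>lborel)
        = (\<integral>\<^sup>+r. (ennreal (q * r powr (q - 1)) * indicator {0<..1} r) * (ennreal (real k / q) * section_weight q (x /\<^sub>R N x)) \<partial>lborel)"
    proof (rule nn_integral_cong)
      fix r :: real
      show "indicator {0<..} r * ennreal (real k * r ^ (k - 1)) * F (x /\<^sub>R N x, r)
        = (ennreal (q * r powr (q - 1)) * indicator {0<..1} r) * (ennreal (real k / q) * section_weight q (x /\<^sub>R N x))"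
      proof (cases "0 < r \<and> r \<le> 1")
        case True
        then have r: "r > 0" by simp
        have "r ^ (k - 1) = r powr (real k - 1)" using r dim_range_pos by (simp add: powr_realpow[symmetric] of_nat_diff)
        then have "real k * r ^ (k - 1) * r powr (q - real k) = (q * r powr (q - 1)) * (real k / q)"
          using q r by (simp add: powr_add[symmetric])
        then have "ennreal (real k * r ^ (k - 1)) * ennreal (r powr (q - real k)) = ennreal (q * r powr (q - 1)) * ennreal (real k / q)"
          using q r by (simp only: ennreal_mult'[symmetric] ennreal_mult''[symmetric] powr_ge_zero mult_nonneg_nonneg divide_nonneg_nonneg of_nat_0_le_iff less_imp_le)
        then show ?thesis using True by (simp add: F_def indicator_def mult.assoc[symmetric])
      qed (auto simp: F_def indicator_def)
    qed
    also have "\<dots> = ennreal (1 powr q) * (ennreal (real k / q) * section_weight q (x /\<^sub>R N x))"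
      using nn_integral_power_real[of 1 q] q by (subst nn_integral_multc) auto
    finally show "indicator {x. N x \<le> 1} x * (\<integral>\<^sup>+r. indicator {0<..} r * ennreal (real k * r ^ (k - 1)) * F (x /\<^sub>R N x, r) \<partial>lborel)
      = ennreal (real k / q) * (indicator {x. N x \<le> 1} x * section_weight q (x /\<^sub>R N x))" by (simp add: mult.left_commute)
  qed
  also have "\<dots> = ennreal (real k / q) * radial_weight q" unfolding radial_weight_def by (rule nn_integral_cmult) measurable
  finally show ?thesis .
qed

section \<open>Weighted sections decrease along rays\<close>

lemma sym_convex_part: "compact (K \<inter> cball 0 r)" "convex (K \<inter> cball 0 r)" "x \<in> K \<inter> cball 0 r \<Longrightarrow> - x \<in> K \<inter> cball 0 r"
  using compact_K convex_K sym_K by (auto intro: convex_Int)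

lemma norm_add_ge: "P y = y \<Longrightarrow> P z = 0 \<Longrightarrow> norm y \<le> norm (y + z)"
  using orth_proj_norm_le[OF P, of "y + z"] by (simp add: add)

text \<open>The mixture formula for a negative power, used under the integral over the section;
  \<open>y \<noteq> 0\<close> keeps the section away from the singularity at the origin.\<close>

lemma section_weight_layers:
  assumes q: "q < real DIM('a)" and y: "P y = y" "y \<noteq> 0"
  shows "section_weight q y = (\<integral>\<^sup>+r. indicator {0<..} r * ennreal ((real DIM('a) - q) * r powr (q - real DIM('a) - 1)) * section_volume (K \<inter> cball 0 r) y \<partial>lborel)"
proof -
  let ?p = "real DIM('a) - q"
  interpret pair_sigma_finite "sub_measure Q" "lborel :: real measure" ..
  define w where "w r = indicator {0<..} r * ennreal (?p * r powr (- ?p - 1))" for r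
  have [measurable]: "w \<in> borel_measurable borel" unfolding w_def by measurable
  have "section_weight q y = (\<integral>\<^sup>+z. (\<integral>\<^sup>+r. w r * (indicator K (y + z) * (if norm (y + z) \<le> r then 1 else 0)) \<partial>lborel) \<partial>sub_measure Q)"
    unfolding section_weight_def using AE_Q
  proof (intro nn_integral_cong_AE, eventually_elim)
    fix z assume "P z = 0"
    then have a: "norm (y + z) > 0" using norm_add_ge[OF y(1)] y(2) by (metis norm_eq_zero norm_le_zero_iff not_less zero_less_norm_iff)
    have "(\<integral>\<^sup>+r. w r * (indicator K (y + z) * (if norm (y + z) \<le> r then 1 else 0)) \<partial>lborel)
      = (\<integral>\<^sup>+r. (ennreal (?p * r powr (- ?p - 1)) * indicator {norm (y + z)..} r) * indicator K (y + z) \<partial>lborel)"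
    proof (rule nn_integral_cong)
      fix r :: real
      have "r > 0" if "norm (y + z) \<le> r" using a that by linarith
      then show "w r * (indicator K (y + z) * (if norm (y + z) \<le> r then 1 else 0))
        = ennreal (?p * r powr (- ?p - 1)) * indicator {norm (y + z)..} r * indicator K (y + z)"
        by (auto simp: w_def indicator_def)
    qed
    also have "\<dots> = ennreal (norm (y + z) powr (- ?p)) * indicator K (y + z)"
      using nn_integral_power_tail[OF a, of ?p] q by (subst nn_integral_multc) auto
    finally show "weight q (y + z) = (\<integral>\<^sup>+r. w r * (indicator K (y + z) * (if norm (y + z) \<le> r then 1 else 0)) \<partial>lborel)"
      by (simp add: weight_def mult.commute)
  qed
  also have "\<dots> = (\<integral>\<^sup>+r. (\<integral>\<^sup>+z. w r * (indicator K (y + z) * (if norm (y + z) \<le> r then 1 else 0)) \<partial>sub_measure Q) \<partial>lborel)"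
    by (rule Fubini'[symmetric]) measurable
  also have "\<dots> = (\<integral>\<^sup>+r. w r * section_volume (K \<inter> cball 0 r) y \<partial>lborel)"
  proof (rule nn_integral_cong)
    fix r :: real
    have "(\<integral>\<^sup>+z. indicator K (y + z) * (if norm (y + z) \<le> r then 1 else 0) \<partial>sub_measure Q) = section_volume (K \<inter> cball 0 r) y"
      unfolding section_volume_def by (intro nn_integral_cong) (auto simp: indicator_def)
    moreover have "(\<integral>\<^sup>+z. w r * (indicator K (y + z) * (if norm (y + z) \<le> r then 1 else 0)) \<partial>sub_measure Q)
      = w r * (\<integral>\<^sup>+z. indicator K (y + z) * (if norm (y + z) \<le> r then 1 else 0) \<partial>sub_measure Q)"
      by (rule nn_integral_cmult) measurable
    ultimately show "(\<integral>\<^sup>+z. w r * (indicator K (y + z) * (if norm (y + z) \<le> r then 1 else 0)) \<partial>sub_measure Q)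
      = w r * section_volume (K \<inter> cball 0 r) y" by simp
  qed
  finally show ?thesis by (simp add: w_def)
qed

lemma section_weight_top_exponent:
  assumes y: "P y = y" "y \<noteq> 0"
  shows "section_weight (real DIM('a)) y = section_volume K y"
  unfolding section_weight_def section_volume_def using AE_Q
proof (intro nn_integral_cong_AE, eventually_elim)
  fix z assume "P z = 0"
  then have "y + z \<noteq> 0" using norm_add_ge[OF y(1)] y(2) by fastforce
  then show "weight (real DIM('a)) (y + z) = indicator K (y + z)" by (simp add: weight_def)
qed

text \<open>Anderson's inequality holds for each layer \<open>K \<inter> cball 0 r\<close> and
  survives the mixture. At q = n the density of the mixture is 0 while the weight is plain volume,
  whence the case split.\<close>

lemma section_weight_mono:
  assumes q: "q \<le> real DIM('a)" and y: "P y = y" "y \<noteq> 0" and t: "0 < t" "t \<le> 1"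
  shows "section_weight q (y /\<^sub>R t) \<le> section_weight q y"
proof -
  have y': "P (y /\<^sub>R t) = y /\<^sub>R t" "y /\<^sub>R t \<noteq> 0" using y t by (auto simp: scale)
  have eq: "t *\<^sub>R (y /\<^sub>R t) = y" using t by simp
  show ?thesis
  proof (cases "q = real DIM('a)")
    case True
    show ?thesis
      unfolding True section_weight_top_exponent[OF y] section_weight_top_exponent[OF y']
      using section_volume_shrink[OF compact_K convex_K sym_K, of t "y /\<^sub>R t"] t eq by simp
  next
    case False
    then have q': "q < real DIM('a)" using q by simp
    show ?thesis
      unfolding section_weight_layers[OF q' y] section_weight_layers[OF q' y']
    proof (intro nn_integral_mono mult_left_mono)
      fix r :: real
      show "section_volume (K \<inter> cball 0 r) (y /\<^sub>R t) \<le> section_volume (K \<inter> cball 0 r) y"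
        using section_volume_shrink[OF sym_convex_part, of r t "y /\<^sub>R t"] t eq by simp
    qed simp
  qed
qed

lemma section_weight_finite:
  assumes q: "q \<le> real DIM('a)" and y: "P y = y" "y \<noteq> 0"
  shows "section_weight q y < \<infinity>"
proof -
  have "section_weight q y \<le> (\<integral>\<^sup>+z. ennreal (norm y powr (q - real DIM('a))) * indicator K (y + z) \<partial>sub_measure Q)"
    unfolding section_weight_def using AE_Q
  proof (intro nn_integral_mono_AE, eventually_elim)
    fix z assume "P z = 0"
    then have "norm y \<le> norm (y + z)" by (rule norm_add_ge[OF y(1)])
    then have "norm (y + z) powr (q - real DIM('a)) \<le> norm y powr (q - real DIM('a))"
      using q y(2) by (intro powr_mono2') auto
    then show "weight q (y + z) \<le> ennreal (norm y powr (q - real DIM('a))) * indicator K (y + z)"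
      by (auto simp: weight_def indicator_def ennreal_leI)
  qed
  also have "\<dots> = ennreal (norm y powr (q - real DIM('a))) * section_volume K y"
    unfolding section_volume_def by (rule nn_integral_cmult) measurable
  also have "\<dots> < \<infinity>" using section_volume_finite[OF bounded_K] by (simp add: ennreal_mult_less_top)
  finally show ?thesis .
qed

text \<open>For small \<^term>\<open>y\<close> the layers of radius between \<open>\<bar>y\<bar>\<close> and \<open>\<bar>y\<bar> / t\<close> contribute to the right-hand
  side only.\<close>

lemma section_weight_strict:
  assumes q: "q < real DIM('a)" and y: "P y = y" "y \<noteq> 0" "norm y < \<rho>" and t: "0 < t" "t < 1"
  shows "section_weight q (y /\<^sub>R t) < section_weight q y"
proof -
  have y': "P (y /\<^sub>R t) = y /\<^sub>R t" "y /\<^sub>R t \<noteq> 0" using y t by (auto simp: scale)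
  have eq: "t *\<^sub>R (y /\<^sub>R t) = y" using t by simp
  define w where "w r = indicator {0<..} r * ennreal ((real DIM('a) - q) * r powr (q - real DIM('a) - 1))" for r
  have [measurable]: "w \<in> borel_measurable borel" unfolding w_def by measurable
  have sm: "(\<lambda>r. section_volume (K \<inter> cball 0 r) v) \<in> borel_measurable borel" for v
  proof -
    have "section_volume (K \<inter> cball 0 r) v = (\<integral>\<^sup>+z. indicator K (v + z) * (if norm (v + z) \<le> r then 1 else 0) \<partial>sub_measure Q)" for r
      unfolding section_volume_def by (intro nn_integral_cong) (auto simp: indicator_def)
    then show ?thesis by simp
  qed
  show ?thesis
    unfolding section_weight_layers[OF q y(1,2)] section_weight_layers[OF q y'] w_def[symmetric]
  proof (rule nn_integral_less)
    show "(\<lambda>r. w r * section_volume (K \<inter> cball 0 r) (y /\<^sub>R t)) \<in> borel_measurable lborel"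
      "(\<lambda>r. w r * section_volume (K \<inter> cball 0 r) y) \<in> borel_measurable lborel"
      using sm by simp_all
    show "(\<integral>\<^sup>+r. w r * section_volume (K \<inter> cball 0 r) (y /\<^sub>R t) \<partial>lborel) \<noteq> \<infinity>"
      using section_weight_finite[OF less_imp_le[OF q] y'] unfolding section_weight_layers[OF q y'] w_def by simp
    show "AE r in lborel. w r * section_volume (K \<inter> cball 0 r) (y /\<^sub>R t) \<le> w r * section_volume (K \<inter> cball 0 r) y"
    proof (intro AE_I2 mult_left_mono)
      fix r :: real
      show "section_volume (K \<inter> cball 0 r) (y /\<^sub>R t) \<le> section_volume (K \<inter> cball 0 r) y"
        using section_volume_shrink[OF sym_convex_part, of r t "y /\<^sub>R t"] t eq by simp
    qed simp
    show "\<not> (AE r in lborel. w r * section_volume (K \<inter> cball 0 r) y \<le> w r * section_volume (K \<inter> cball 0 r) (y /\<^sub>R t))"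
    proof
      assume ae: "AE r in lborel. w r * section_volume (K \<inter> cball 0 r) y \<le> w r * section_volume (K \<inter> cball 0 r) (y /\<^sub>R t)"
      \<comment> \<open>The bound by \<rho> puts the ball of radius r inside \<open>K\<close>, so
        its layer has positive volume over \<open>y\<close>.\<close>
      let ?U = "{norm y<..<min \<rho> (norm y / t)}"
      have "norm y < norm y / t" using y(2) t by (simp add: field_simps)
      then have "?U \<noteq> {}" using y(3) by (simp add: dense)
      then obtain r where r: "r \<in> ?U" "w r * section_volume (K \<inter> cball 0 r) y \<le> w r * section_volume (K \<inter> cball 0 r) (y /\<^sub>R t)"
        using AE_lborel_open_obtains[OF ae open_greaterThanLessThan] by blast
      have r0: "r > 0" using r(1) y(2) by (auto intro: le_less_trans[OF norm_ge_zero])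
      have "section_volume (K \<inter> cball 0 r) (y /\<^sub>R t) = 0"
      proof -
        have "section_volume (K \<inter> cball 0 r) (y /\<^sub>R t) = (\<integral>\<^sup>+z. 0 \<partial>sub_measure Q)"
          unfolding section_volume_def using AE_Q
        proof (intro nn_integral_cong_AE, eventually_elim)
          fix z assume "P z = 0"
          then have "norm (y /\<^sub>R t) \<le> norm (y /\<^sub>R t + z)" by (rule norm_add_ge[OF y'(1)])
          moreover have "norm (y /\<^sub>R t) = norm y / t" using t by (simp add: divide_inverse mult.commute)
          ultimately show "indicator (K \<inter> cball 0 r) (y /\<^sub>R t + z) = 0" using r(1) by (simp add: indicator_def)
        qed
        then show ?thesis by simp
      qed
      moreover have "section_volume (K \<inter> cball 0 r) y > 0"
      proof -
        let ?V = "{z. norm (y + z) < r}"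
        have "open ?V" by (intro open_Collect_less continuous_intros)
        then have "0 < emeasure (sub_measure Q) ?V"
          using r(1) by (intro emeasure_sub_measure_open_pos[OF Q, of _ 0]) (auto simp: zero)
        also have "\<dots> = (\<integral>\<^sup>+z. indicator ?V z \<partial>sub_measure Q)"
          using \<open>open ?V\<close> by (subst nn_integral_indicator) auto
        also have "\<dots> \<le> section_volume (K \<inter> cball 0 r) y"
          unfolding section_volume_def
        proof (rule nn_integral_mono)
          fix z
          have "y + z \<in> K" if "norm (y + z) < r" using that r(1) \<rho>(2) by (auto simp: subset_eq)
          then show "indicator ?V z \<le> (indicator (K \<inter> cball 0 r) (y + z) :: ennreal)" by (auto simp: indicator_def)
        qed
        finally show ?thesis .
      qed
      moreover have "w r > 0" using r0 q by (simp add: w_def)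
      ultimately show False using r(2) by auto
    qed
  qed
qed

lemma radial_weight_AE_le:
  assumes q: "q \<le> real DIM('a)"
  shows "AE y in sub_measure P. indicator {y. N y \<le> 1} y * section_weight q (y /\<^sub>R N y) \<le> section_weight q y"
  using AE_P AE_P_nonzero
proof eventually_elim
  fix y assume y: "P y = y" "y \<noteq> 0"
  have "N y > 0" using y by (intro N_pos) simp
  then show "indicator {y. N y \<le> 1} y * section_weight q (y /\<^sub>R N y) \<le> section_weight q y"
    using section_weight_mono[OF q y, of "N y"] by (simp add: indicator_def)
qed

lemma radial_weight_le: "q \<le> real DIM('a) \<Longrightarrow> radial_weight q \<le> fubini_const P * total_weight q"
  unfolding radial_weight_def total_weight_fubini[symmetric] by (intro nn_integral_mono_AE radial_weight_AE_le)

lemma radial_weight_finite: "0 < q \<Longrightarrow> q \<le> real DIM('a) \<Longrightarrow> radial_weight q < \<infinity>"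
  using radial_weight_le[of q] total_weight_finite[of q] fubini_const_pos_finite(2)[OF P]
  by (auto intro: le_less_trans simp: ennreal_mult_less_top)

text \<open>\<open>section_weight_strict\<close> applies at nonzero y of norm below \<rho>, where
  also \<open>N y < 1\<close>. Such y fill a relatively open set in the range, which has positive
  measure.\<close>

lemma radial_weight_less:
  assumes q: "0 < q" "q < real DIM('a)"
  shows "radial_weight q < fubini_const P * total_weight q"
  unfolding radial_weight_def total_weight_fubini[symmetric]
proof (rule nn_integral_less)
  show "(\<integral>\<^sup>+y. indicator {y. N y \<le> 1} y * section_weight q (y /\<^sub>R N y) \<partial>sub_measure P) \<noteq> \<infinity>"
    using radial_weight_finite[of q] q by (simp add: radial_weight_def)
  show "AE y in sub_measure P. indicator {y. N y \<le> 1} y * section_weight q (y /\<^sub>R N y) \<le> section_weight q y"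
    using q by (intro radial_weight_AE_le) simp
  show "\<not> (AE y in sub_measure P. section_weight q y \<le> indicator {y. N y \<le> 1} y * section_weight q (y /\<^sub>R N y))"
  proof
    assume ae: "AE y in sub_measure P. section_weight q y \<le> indicator {y. N y \<le> 1} y * section_weight q (y /\<^sub>R N y)"
    have "0 \<in> range P" by (metis zero rangeI)
    then have "\<not> range P \<subseteq> {0}" using nontrivial by auto
    then obtain p where p: "p \<in> range P" "p \<noteq> 0" by auto
    let ?p = "(\<rho> / 2 / norm p) *\<^sub>R p"
    have "open (ball 0 \<rho> - {0::'a})" by (intro open_Diff) auto
    moreover have "?p \<in> ball 0 \<rho> - {0}" using p(2) \<rho>(1) by simp
    moreover have "P ?p = ?p" using p(1) by (auto simp: scale)
    ultimately obtain y where y: "y \<in> ball 0 \<rho> - {0}" "P y = y" "section_weight q y \<le> indicator {y. N y \<le> 1} y * section_weight q (y /\<^sub>R N y)"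
      using AE_sub_measure_open_obtains[OF P ae] by blast
    have Ny: "N y > 0" using y by (intro N_pos) simp
    have "norm y / \<rho> < 1" using y(1) \<rho>(1) by simp
    then have "N y < 1" using C.gauge_le_norm[of y] by linarith
    then have "section_weight q (y /\<^sub>R N y) < section_weight q y" using Ny y q by (intro section_weight_strict) auto
    then show False using y(3) \<open>N y < 1\<close> by (simp add: indicator_def)
  qed
qed measurable

text \<open>With c the Fubini constant, z, j and T the contact, radial and total weights, c w \<le>
  c z = (k/q) j \<le> (k/q) c T. Equality of the ends forces j = c T.\<close>

lemma cone_weight_range_le:
  assumes q: "0 < q" "q \<le> real DIM('a)"
  defines "w \<equiv> enn2real (cone_weight q (rev_radial_gauss K (sphere 0 1 \<inter> range P)))"
  shows "w \<le> real k / q * enn2real (total_weight q)"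
    and "q < real DIM('a) \<Longrightarrow> w < real k / q * enn2real (total_weight q)"
    and "w = real k / q * enn2real (total_weight q) \<Longrightarrow> radial_weight q = fubini_const P * total_weight q"
proof -
  obtain c where c: "fubini_const P = ennreal c" "c > 0"
    using fubini_const_pos_finite[OF P] by (cases "fubini_const P") auto
  obtain T where T: "total_weight q = ennreal T" "T \<ge> 0"
    using total_weight_finite[OF q(1)] by (cases "total_weight q") auto
  obtain j where j: "radial_weight q = ennreal j" "j \<ge> 0" using radial_weight_finite[OF q] by (cases "radial_weight q") auto
  have ZT: "contact_weight q \<le> total_weight q" unfolding contact_weight_def total_weight_def by (intro nn_integral_mono) (auto simp: indicator_def)
  obtain z where z: "contact_weight q = ennreal z" "z \<ge> 0" using ZT T by (cases "contact_weight q") (auto simp: top_unique)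
  have w: "w \<le> z"
    unfolding w_def using gauss_le_contact_weight[of q] z by (metis enn2real_ennreal enn2real_mono ennreal_less_top)
  have cz: "c * z = real k / q * j"
    using contact_weight_eq[OF q(1)] q unfolding c(1) z(1) j(1) by (simp add: ennreal_mult[symmetric] c z j less_imp_le)
  have jT: "j \<le> c * T" using radial_weight_le[OF q(2)] unfolding j(1) c(1) T(1) using c T by (simp add: ennreal_mult[symmetric])
  have kq: "real k / q > 0" using dim_range_pos q by simp
  have "real k / q * j \<le> real k / q * (c * T)" using jT kq by (intro mult_left_mono) auto
  then have "c * z \<le> c * (real k / q * T)" unfolding cz by (simp only: mult.left_commute)
  then have "z \<le> real k / q * T" using c(2) by (rule mult_left_le_imp_le)
  then show "w \<le> real k / q * enn2real (total_weight q)" using w T by simp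
  show "w < real k / q * enn2real (total_weight q)" if q': "q < real DIM('a)"
  proof -
    have "j < c * T" using radial_weight_less[OF q(1) q'] unfolding j(1) c(1) T(1) using c T j by (simp add: ennreal_mult[symmetric] ennreal_less_iff)
    then have "real k / q * j < real k / q * (c * T)" using kq by (rule mult_strict_left_mono)
    then have "c * z < c * (real k / q * T)" unfolding cz by (simp only: mult.left_commute)
    then have "z < real k / q * T" using c(2) by (rule mult_left_less_imp_less[OF _ less_imp_le])
    then show ?thesis using w T by simp
  qed
  show "radial_weight q = fubini_const P * total_weight q" if e: "w = real k / q * enn2real (total_weight q)"
  proof -
    have "real k / q * T \<le> z" using e w T by simp
    then have "c * (real k / q * T) \<le> c * z" using c(2) by (intro mult_left_mono) auto
    then have "real k / q * (c * T) \<le> real k / q * j" unfolding cz by (simp only: mult.left_commute)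
    then have "c * T \<le> j" using kq by (rule mult_left_le_imp_le)
    then have "j = c * T" using jT by simp
    then show ?thesis unfolding j(1) c(1) T(1) using c(2) T(2) by (simp add: ennreal_mult)
  qed
qed

text \<open>Supplies the bound by 1, which \<open>dim L / q\<close> does not give when q < dim L.
  Near a direction orthogonal to the range the gauge of the cylinder is small and that of
  \<open>K\<close> is not, so the contact set misses a nonempty open subset of
  \<open>K\<close>.\<close>

lemma cone_weight_range_less:
  assumes q: "0 < q"
  shows "enn2real (cone_weight q (rev_radial_gauss K (sphere 0 1 \<inter> range P))) < enn2real (total_weight q)"
proof -
  have "contact_weight q < total_weight q"
    unfolding contact_weight_def total_weight_def
  proof (rule nn_integral_less)
    have "contact_weight q \<le> total_weight q" unfolding contact_weight_def total_weight_def by (intro nn_integral_mono) (auto simp: indicator_def)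
    then show "(\<integral>\<^sup>+x. indicator {x. gauge_fun K x = N x} x * weight q x \<partial>lborel) \<noteq> \<infinity>"
      using total_weight_finite[OF q] by (auto simp: contact_weight_def)
    show "AE x in lborel. indicator {x. gauge_fun K x = N x} x * weight q x \<le> weight q x"
      by (rule AE_I2) (simp add: indicator_def)
    show "\<not> (AE x in lborel. weight q x \<le> indicator {x. gauge_fun K x = N x} x * weight q x)"
    proof
      assume ae: "AE x in lborel. weight q x \<le> indicator {x. gauge_fun K x = N x} x * weight q x"
      obtain R where R: "\<And>a. a \<in> K \<Longrightarrow> norm a \<le> R" "R > 0" using bounded_K unfolding bounded_pos by auto
      obtain x0 where x0: "x0 \<notin> range P" using proper by auto
      then have Q0: "Q x0 \<noteq> 0" using orth_proj_range[OF P] by auto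
      \<comment> \<open>On this set \<open>N x \<le> norm (P x) / \<rho> < norm x / R \<le>
        gauge_fun K x\<close>.\<close>
      let ?U = "ball 0 \<rho> \<inter> {x. R * norm (P x) < \<rho> * norm x}"
      have "open ?U" by (intro open_Int open_Collect_less continuous_intros orth_proj_continuous[OF P] open_ball)
      moreover have "(\<rho> / 2 / norm (Q x0)) *\<^sub>R Q x0 \<in> ?U"
        using Q0 \<rho>(1) by (auto simp: scale diff)
      ultimately obtain x where x: "x \<in> ?U" "weight q x \<le> indicator {x. gauge_fun K x = N x} x * weight q x"
        using AE_lborel_open_obtains[OF ae] by blast
      have x0: "x \<noteq> 0" using x(1) by (auto simp: zero)
      have "N x \<le> norm (P x) / \<rho>" using C.gauge_le_norm[of "P x"] by (simp add: N_P)
      also have "\<dots> < norm x / R" using x(1) R(2) \<rho>(1) by (simp add: field_simps)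
      also have "\<dots> \<le> gauge_fun K x"
      proof -
        have g: "gauge_fun K x > 0" using x0 by (rule gauge_K_pos)
        then have "x /\<^sub>R gauge_fun K x \<in> K" using K.gauge_le_iff[OF g, of x] by simp
        then have "norm (x /\<^sub>R gauge_fun K x) \<le> R" by (rule R(1))
        then have "norm x / gauge_fun K x \<le> R" using g by (simp add: divide_inverse mult.commute)
        then show ?thesis using g R(2) by (simp add: field_simps)
      qed
      finally have "weight q x \<le> 0" using x(2) by simp
      moreover have "x \<in> K" using x(1) \<rho>(2) by (auto simp: subset_eq)
      ultimately show False using x0 by (simp add: weight_def)
    qed
  qed measurable
  then have "cone_weight q (rev_radial_gauss K (sphere 0 1 \<inter> range P)) < total_weight q" using gauss_le_contact_weight le_less_trans by blast
  then show ?thesis using total_weight_finite[OF q]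
    by (cases "cone_weight q (rev_radial_gauss K (sphere 0 1 \<inter> range P))"; cases "total_weight q") (auto simp: ennreal_less_iff)
qed

end

section \<open>The equality case\<close>

context sym_body_proj
begin

lemma radial_weight_eq_AE:
  assumes q: "0 < q" "q \<le> real DIM('a)" and eq: "radial_weight q = fubini_const P * total_weight q"
  shows "AE y in sub_measure P. section_weight q y \<le> indicator {y. N y \<le> 1} y * section_weight q (y /\<^sub>R N y)"
proof (rule ccontr)
  assume n: "\<not> ?thesis"
  have "radial_weight q < fubini_const P * total_weight q"
    unfolding radial_weight_def total_weight_fubini[symmetric]
  proof (rule nn_integral_less)
    show "(\<integral>\<^sup>+y. indicator {y. N y \<le> 1} y * section_weight q (y /\<^sub>R N y) \<partial>sub_measure P) \<noteq> \<infinity>"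
      using radial_weight_finite[OF q] by (simp add: radial_weight_def)
    show "AE y in sub_measure P. indicator {y. N y \<le> 1} y * section_weight q (y /\<^sub>R N y) \<le> section_weight q y"
      using q(2) by (rule radial_weight_AE_le)
    show "\<not> (AE y in sub_measure P. section_weight q y \<le> indicator {y. N y \<le> 1} y * section_weight q (y /\<^sub>R N y))" by (rule n)
  qed measurable
  then show False using eq by simp
qed

lemma section_volume_le_center: "section_volume K y \<le> section_volume K 0"
  using section_volume_shrink[OF compact_K convex_K sym_K, of 0 y] by simp

text \<open>With t = \<open>N y\<close> and x a point of \<open>K\<close> over y / t, convexity puts
  (1 - t) times the central section, translated by t x, into the section over y.\<close>

lemma section_volume_near_center:
  assumes y: "P y = y" "0 < N y" "N y < 1"
  shows "ennreal ((1 - N y) ^ dim (range Q)) * section_volume K 0 \<le> section_volume K y"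
proof -
  define t where "t = N y"
  have t: "0 < t" "t < 1" using y by (auto simp: t_def)
  define s where "s = 1 - t"
  have s: "0 < s" using t by (simp add: s_def)
  have "y /\<^sub>R t \<in> cyl" using C.gauge_le_iff[OF t(1), of y] by (simp add: t_def)
  then obtain x where x: "x \<in> K" "P (y /\<^sub>R t) = P x" by (auto simp: cyl_def)
  have tx: "t *\<^sub>R x = y + t *\<^sub>R Q x" using x(2) t y(1) by (simp add: scale algebra_simps flip: x(2))
  define f :: "'a \<Rightarrow> ennreal" where "f z = indicator K ((1 / s) *\<^sub>R (z - t *\<^sub>R Q x))" for z
  have [measurable]: "f \<in> borel_measurable borel" unfolding f_def by measurable
  have "(\<integral>\<^sup>+z. f z \<partial>sub_measure Q) = (\<integral>\<^sup>+z. f (z + t *\<^sub>R Q x) \<partial>sub_measure Q)"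
    by (rule nn_integral_sub_measure_translate[OF Q, symmetric]) (simp_all add: scale diff)
  also have "\<dots> = (\<integral>\<^sup>+z. indicator K ((1 / s) *\<^sub>R z) \<partial>sub_measure Q)" by (simp add: f_def)
  also have "\<dots> = ennreal (s ^ dim (range Q)) * (\<integral>\<^sup>+z. indicator K z \<partial>sub_measure Q)"
    using nn_integral_sub_measure_scale[OF Q, of "indicator K" "1 / s"] s by (simp add: power_one_over)
  finally have "ennreal (s ^ dim (range Q)) * section_volume K 0 = (\<integral>\<^sup>+z. f z \<partial>sub_measure Q)"
    by (simp add: section_volume_def)
  also have "\<dots> \<le> section_volume K y"
    unfolding section_volume_def
  proof (rule nn_integral_mono)
    fix z
    show "f z \<le> indicator K (y + z)"
    proof (cases "(1 / s) *\<^sub>R (z - t *\<^sub>R Q x) \<in> K")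
      case True
      have "s *\<^sub>R ((1 / s) *\<^sub>R (z - t *\<^sub>R Q x)) + t *\<^sub>R x \<in> K"
        using True x(1) s t by (intro convexD[OF convex_K]) (auto simp: s_def)
      also have "s *\<^sub>R ((1 / s) *\<^sub>R (z - t *\<^sub>R Q x)) + t *\<^sub>R x = y + z" using s by (simp add: tx)
      finally show ?thesis by (simp add: f_def indicator_def)
    qed (simp add: f_def)
  qed
  finally show ?thesis by (simp add: s_def t_def)
qed

text \<open>Equality relates y to \<open>y /\<^sub>R N y\<close> only for almost every y, so nothing
  is known at a prescribed w. For \<open>N w = 1\<close>, good points y_j are taken close to the ray
  of w and tending to the origin. The volumes over y_j approach the central one and bound from below
  those over y_j / N(y_j), which tends to w; upper semicontinuity finishes. Shorter w follow by
  shrinking.\<close>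

lemma section_volume_constant:
  assumes eq: "radial_weight (real DIM('a)) = fubini_const P * total_weight (real DIM('a))"
    and w: "P w = w" "N w \<le> 1"
  shows "section_volume K w = section_volume K 0"
proof (rule antisym[OF section_volume_le_center])
  let ?V = "section_volume K" and ?m = "dim (range Q)"
  have unit: "?V 0 \<le> ?V w" if w: "P w = w" "N w = 1" for w
  proof -
    define a where "a j = 1 / real (Suc (Suc j))" for j
    have a: "0 < a j" "a j < 1" for j by (simp_all add: a_def)
    have a0: "a \<longlonglongrightarrow> 0" unfolding a_def
      using LIMSEQ_Suc[OF LIMSEQ_inverse_real_of_nat] by (simp add: inverse_eq_divide)
    have AE: "AE y in sub_measure P. y \<noteq> 0 \<and> section_weight (real DIM('a)) y \<le> indicator {y. N y \<le> 1} y * section_weight (real DIM('a)) (y /\<^sub>R N y)"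
      using radial_weight_eq_AE[OF _ order_refl eq] AE_P_nonzero by (simp add: eventually_conj_iff)
    \<comment> \<open>The radius is the square of \<open>a j\<close>, so that the error still tends
      to 0 after division by \<open>a j\<close>.\<close>
    have "\<exists>y. y \<in> ball (a j *\<^sub>R w) ((a j)\<^sup>2) \<and> P y = y \<and> y \<noteq> 0 \<and> section_weight (real DIM('a)) y \<le> indicator {y. N y \<le> 1} y * section_weight (real DIM('a)) (y /\<^sub>R N y)" for j
      using AE_sub_measure_open_obtains[OF P AE open_ball, of "a j *\<^sub>R w" "a j *\<^sub>R w" "(a j)\<^sup>2"] a[of j] w(1)
      by (auto simp: scale)
    then obtain y where y: "\<And>j. y j \<in> ball (a j *\<^sub>R w) ((a j)\<^sup>2)" "\<And>j. P (y j) = y j" "\<And>j. y j \<noteq> 0"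
      "\<And>j. section_weight (real DIM('a)) (y j) \<le> indicator {y. N y \<le> 1} (y j) * section_weight (real DIM('a)) (y j /\<^sub>R N (y j))"
      by metis
    define t where "t j = N (y j)" for j
    have t0: "t j > 0" for j unfolding t_def using y(2,3) by (intro N_pos) auto
    have near: "norm (y j /\<^sub>R a j - w) \<le> a j" for j
    proof -
      have "y j /\<^sub>R a j - w = (y j - a j *\<^sub>R w) /\<^sub>R a j" using a[of j] by (simp add: scaleR_diff_right)
      then have "norm (y j /\<^sub>R a j - w) = norm (y j - a j *\<^sub>R w) / a j"
        using a[of j] by (simp add: divide_inverse mult.commute)
      also have "\<dots> \<le> (a j)\<^sup>2 / a j" using y(1)[of j] a[of j]
        by (intro divide_right_mono) (auto simp: dist_norm norm_minus_commute)
      also have "\<dots> = a j" using a[of j] by (simp add: power2_eq_square)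
      finally show ?thesis .
    qed
    have ya: "(\<lambda>j. y j /\<^sub>R a j) \<longlonglongrightarrow> w"
      by (rule LIM_zero_cancel, rule Lim_null_comparison[OF _ a0]) (use near in \<open>simp add: always_eventually\<close>)
    have "(\<lambda>j. N (y j /\<^sub>R a j)) \<longlonglongrightarrow> N w"
      using C.gauge_continuous ya by (intro continuous_on_tendsto_compose[OF C.gauge_continuous ya]) auto
    moreover have "N (y j /\<^sub>R a j) = t j / a j" for j
      using C.gauge_scale[of "inverse (a j)" "y j"] a[of j] by (simp add: t_def divide_inverse mult.commute)
    ultimately have ta: "(\<lambda>j. t j / a j) \<longlonglongrightarrow> 1" using w(2) by simp
    then have "(\<lambda>j. a j * (t j / a j)) \<longlonglongrightarrow> 0 * 1" by (intro tendsto_mult a0)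
    moreover have "a j * (t j / a j) = t j" for j using a[of j] by simp
    ultimately have tlim: "t \<longlonglongrightarrow> 0" by simp
    have "(\<lambda>j. (y j /\<^sub>R a j) /\<^sub>R (t j / a j)) \<longlonglongrightarrow> w /\<^sub>R 1" by (intro tendsto_intros ya ta) simp
    moreover have "(y j /\<^sub>R a j) /\<^sub>R (t j / a j) = y j /\<^sub>R t j" for j
      using a[of j] t0[of j] by (simp add: inverse_eq_divide)
    ultimately have wlim: "(\<lambda>j. y j /\<^sub>R t j) \<longlonglongrightarrow> w" by (simp only: inverse_1 scaleR_one)
    obtain v where v: "?V 0 = ennreal v" "v \<ge> 0"
      using section_volume_finite[OF bounded_K, of 0] by (cases "?V 0") auto
    have "(\<lambda>j. ennreal ((1 - t j) ^ ?m * v)) \<longlonglongrightarrow> ennreal ((1 - 0) ^ ?m * v)"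
      by (intro tendsto_ennrealI tendsto_intros tlim)
    then have "?V 0 = limsup (\<lambda>j. ennreal ((1 - t j) ^ ?m * v))" using v by (simp add: lim_imp_Limsup)
    also have "\<dots> \<le> limsup (\<lambda>j. ?V (y j /\<^sub>R t j))"
    proof (rule Limsup_mono)
      have "eventually (\<lambda>j. t j < 1) sequentially" using tlim by (rule order_tendstoD) simp
      then show "eventually (\<lambda>j. ennreal ((1 - t j) ^ ?m * v) \<le> ?V (y j /\<^sub>R t j)) sequentially"
      proof eventually_elim
        case (elim j)
        have Py: "P (y j /\<^sub>R t j) = y j /\<^sub>R t j" "y j /\<^sub>R t j \<noteq> 0" using y(2,3)[of j] t0[of j] by (auto simp: scale)
        have "ennreal ((1 - t j) ^ ?m * v) = ennreal ((1 - t j) ^ ?m) * ?V 0"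
          unfolding v(1) using elim v(2) by (simp add: ennreal_mult)
        also have "\<dots> \<le> ?V (y j)"
          using section_volume_near_center[of "y j"] y(2)[of j] t0[of j] elim by (simp add: t_def)
        also have "?V (y j) \<le> indicator {y. N y \<le> 1} (y j) * ?V (y j /\<^sub>R t j)"
          using y(4)[of j] unfolding t_def[symmetric] section_weight_top_exponent[OF y(2,3)] section_weight_top_exponent[OF Py] .
        also have "\<dots> \<le> ?V (y j /\<^sub>R t j)" by (simp add: indicator_def)
        finally show ?case .
      qed
    qed
    also have "\<dots> \<le> ?V w" by (rule section_volume_usc[OF compact_K wlim])
    finally show ?thesis .
  qed
  show "?V 0 \<le> ?V w"
  proof (cases "w = 0")
    case False
    then have t: "N w > 0" using w(1) by (intro N_pos) simp
    have "N (w /\<^sub>R N w) = 1" using C.gauge_scale[of "inverse (N w)" w] t by simp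
    moreover have "P (w /\<^sub>R N w) = w /\<^sub>R N w" using w(1) by (simp add: scale)
    ultimately have "?V 0 \<le> ?V (w /\<^sub>R N w)" by (intro unit)
    also have "\<dots> \<le> ?V (N w *\<^sub>R (w /\<^sub>R N w))"
      using w(2) t by (intro section_volume_shrink compact_K convex_K sym_K) auto
    finally show ?thesis using t by simp
  qed simp
qed

text \<open>The section is thickened by the unit ball of the range of \<open>P\<close>, so that the
  equality case of Brunn--Minkowski in the whole space applies; the Lebesgue measure of the result
  is the section volume.\<close>

definition fat_section :: "'a \<Rightarrow> 'a set" where
  "fat_section y = {x. y + Q x \<in> K \<and> norm (P x) \<le> 1}"

lemma fat_section_compact: "compact (fat_section y)"
proof -
  have contQ: "continuous_on UNIV Q" using Q by (rule orth_proj_continuous)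
  have "closed ((\<lambda>x. y + Q x) -` K)" by (intro closed_vimage closed_K continuous_intros contQ)
  moreover have "closed {x. norm (P x) \<le> 1}"
    by (intro closed_Collect_le continuous_intros orth_proj_continuous[OF P])
  ultimately have "closed ((\<lambda>x. y + Q x) -` K \<inter> {x. norm (P x) \<le> 1})" by (rule closed_Int)
  moreover have "(\<lambda>x. y + Q x) -` K \<inter> {x. norm (P x) \<le> 1} = fat_section y" by (auto simp: fat_section_def)
  moreover have "bounded (fat_section y)"
  proof -
    obtain R where R: "\<And>a. a \<in> K \<Longrightarrow> norm a \<le> R" using bounded_K unfolding bounded_iff by auto
    have "norm x \<le> 1 + (R + norm y)" if "x \<in> fat_section y" for x
      using that R[of "y + Q x"] norm_triangle_ineq[of "P x" "Q x"] norm_triangle_ineq4[of "y + Q x" y]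
      by (simp add: fat_section_def)
    then show ?thesis unfolding bounded_iff by blast
  qed
  ultimately show ?thesis by (simp add: compact_eq_bounded_closed)
qed

lemma fat_section_convex: "convex (fat_section y)"
proof (rule convexI)
  fix a b :: 'a and u v :: real
  assume ab: "a \<in> fat_section y" "b \<in> fat_section y" and uv: "0 \<le> u" "0 \<le> v" "u + v = 1"
  have "u *\<^sub>R (y + Q a) + v *\<^sub>R (y + Q b) \<in> K"
    using ab uv by (intro convexD[OF convex_K]) (auto simp: fat_section_def)
  moreover have "u *\<^sub>R (y + Q a) + v *\<^sub>R (y + Q b) = (u + v) *\<^sub>R y + Q (u *\<^sub>R a + v *\<^sub>R b)"
    by (simp add: add scale algebra_simps)
  moreover have "norm (P (u *\<^sub>R a + v *\<^sub>R b)) \<le> 1"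
  proof -
    have "norm (u *\<^sub>R P a + v *\<^sub>R P b) \<le> u * norm (P a) + v * norm (P b)"
      using norm_triangle_ineq[of "u *\<^sub>R P a" "v *\<^sub>R P b"] uv by simp
    also have "\<dots> \<le> u * 1 + v * 1" using ab uv by (intro add_mono mult_left_mono) (auto simp: fat_section_def)
    finally show ?thesis using uv by (simp add: add scale)
  qed
  ultimately show "u *\<^sub>R a + v *\<^sub>R b \<in> fat_section y" using uv by (simp add: fat_section_def)
qed

lemma emeasure_fat_section: "emeasure lborel (fat_section y) = section_volume K y"
proof -
  have "section_volume K y = (\<integral>\<^sup>+x. indicator K (y + Q x) * indicator {x. norm (x - Q x) \<le> 1} x \<partial>lborel)"
    unfolding section_volume_def by (rule nn_integral_sub_measure[OF Q]) measurable
  also have "\<dots> = (\<integral>\<^sup>+x. indicator (fat_section y) x \<partial>lborel)"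
    by (intro nn_integral_cong) (auto simp: indicator_def fat_section_def)
  also have "\<dots> = emeasure lborel (fat_section y)"
    using borel_compact[OF fat_section_compact] by (intro nn_integral_indicator) simp
  finally show ?thesis by simp
qed

lemma section_volume_center_pos: "section_volume K 0 > 0"
proof -
  have "ball 0 (min 1 \<rho>) \<subseteq> fat_section 0"
  proof
    fix x :: 'a assume "x \<in> ball 0 (min 1 \<rho>)"
    then have "norm x < 1" "norm x < \<rho>" by auto
    then show "x \<in> fat_section 0"
      using orth_proj_norm_le[OF P, of x] orth_proj_norm_le[OF Q, of x] \<rho>(2) by (auto simp: fat_section_def subset_eq)
  qed
  then have "emeasure lborel (ball (0::'a) (min 1 \<rho>)) \<le> emeasure lborel (fat_section 0)"
    using borel_compact[OF fat_section_compact] by (intro emeasure_mono) auto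
  moreover have "0 < emeasure lborel (ball (0::'a) (min 1 \<rho>))" using \<rho>(1) by (intro emeasure_lborel_open_pos) auto
  ultimately show ?thesis by (simp add: emeasure_fat_section)
qed

text \<open>Half differences of points over y lie over 0 because \<open>K\<close> is symmetric, so
  the central section takes the part of the difference body and has no larger volume. Hence the
  section over y has a centre of symmetry, which gives c. Moved back by c it lies in the central
  section, and a proper inclusion would cost volume.\<close>

lemma sections_are_translates:
  assumes V: "section_volume K y = section_volume K 0" and y: "P y = y"
  shows "\<exists>c. P c = 0 \<and> (\<forall>z. P z = 0 \<longrightarrow> (z \<in> K \<longleftrightarrow> y + c + z \<in> K))"
proof -
  have fin: "section_volume K 0 < \<infinity>" by (rule section_volume_finite[OF bounded_K])
  interpret Y: convex_volume "fat_section y"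
  proof
    show "measure lborel (fat_section y) > 0"
      using section_volume_center_pos fin by (simp add: measure_def emeasure_fat_section V enn2real_positive_iff)
  qed (rule fat_section_compact fat_section_convex)+
  have mid: "(1/2) *\<^sub>R (a - b) \<in> fat_section 0" if "a \<in> fat_section y" "b \<in> fat_section y" for a b
  proof -
    have "(1/2) *\<^sub>R (y + Q a) + (1/2) *\<^sub>R (- (y + Q b)) \<in> K"
      using that by (intro convexD[OF convex_K] sym_K) (auto simp: fat_section_def)
    moreover have "(1/2) *\<^sub>R (y + Q a) + (1/2) *\<^sub>R (- (y + Q b)) = 0 + Q ((1/2) *\<^sub>R (a - b))"
      by (simp add: diff scale algebra_simps)
    moreover have "norm (P ((1/2) *\<^sub>R (a - b))) \<le> 1"
      using that norm_triangle_ineq4[of "P a" "P b"] by (simp add: diff scale fat_section_def)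
    ultimately show ?thesis by (simp add: fat_section_def)
  qed
  have "measure lborel (fat_section 0) \<le> measure lborel (fat_section y)"
    by (simp add: measure_def emeasure_fat_section V)
  from Y.centrally_symmetric[OF fat_section_compact fat_section_convex this mid]
  obtain g where g: "\<And>x. x \<in> fat_section y \<Longrightarrow> 2 *\<^sub>R g - x \<in> fat_section y" by blast
  define c where "c = Q g"
  have Pc: "P c = 0" by (simp add: c_def diff)
  let ?T = "(\<lambda>x. x + c) -` fat_section y"
  \<comment> \<open>\<open>x + c\<close> and its reflection in the centre both come from the section
    over \<open>y\<close>; half their difference is a point over 0 with the component
    \<open>Q x\<close>.\<close>
  have sub: "?T \<subseteq> fat_section 0"
  proof
    fix x assume "x \<in> ?T"
    then have x: "x + c \<in> fat_section y" by simp
    then have "2 *\<^sub>R g - (x + c) \<in> fat_section y" by (rule g)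
    then have "y + Q (2 *\<^sub>R g - (x + c)) \<in> K" "y + Q (x + c) \<in> K" "norm (P x) \<le> 1"
      using x Pc by (auto simp: fat_section_def add)
    then have "(1/2) *\<^sub>R (y + Q (x + c)) + (1/2) *\<^sub>R (- (y + Q (2 *\<^sub>R g - (x + c)))) \<in> K"
      by (intro convexD[OF convex_K] sym_K) auto
    moreover have "(1/2) *\<^sub>R (y + Q (x + c)) + (1/2) *\<^sub>R (- (y + Q (2 *\<^sub>R g - (x + c)))) = Q x"
    proof -
      have "Q (2 *\<^sub>R g - (x + c)) = c + c - (Q x + c)" using Pc by (simp add: c_def add diff scale scaleR_2)
      moreover have "Q (x + c) = Q x + c" using Pc by (simp add: add)
      ultimately have "(1/2) *\<^sub>R (y + Q (x + c)) + (1/2) *\<^sub>R (- (y + Q (2 *\<^sub>R g - (x + c)))) = (1/2) *\<^sub>R (Q x + Q x)"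
        by (simp only: scaleR_add_right[symmetric]) (simp add: algebra_simps)
      then show ?thesis by (simp add: scaleR_2[symmetric])
    qed
    ultimately show "x \<in> fat_section 0" using \<open>norm (P x) \<le> 1\<close> by (simp add: fat_section_def)
  qed
  have cl: "closed ?T" by (intro closed_vimage compact_imp_closed fat_section_compact continuous_intros)
  have eT: "emeasure lborel ?T = section_volume K 0"
  proof -
    have "emeasure lborel ?T = (\<integral>\<^sup>+x. indicator (fat_section y) (x + c) \<partial>lborel)"
      using cl by (intro nn_integral_indicator_comp[symmetric]) simp
    also have "\<dots> = (\<integral>\<^sup>+x. indicator (fat_section y) x \<partial>lborel)"
      by (rule nn_integral_lborel_translate) simp
    finally show ?thesis using emeasure_fat_section[of y] V by simp
  qed
  have eq: "fat_section 0 = ?T"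
  proof (rule ccontr)
    assume "fat_section 0 \<noteq> ?T"
    then obtain p where "p \<in> fat_section 0" "p \<notin> ?T" using sub by blast
    then have ne: "(- ?T) \<inter> fat_section 0 \<noteq> {}" by blast
    have "open (- ?T)" using cl by (rule open_Compl)
    then have "0 < emeasure lborel (fat_section 0 \<inter> - ?T)"
      using section_volume_center_pos ne
      by (intro emeasure_compact_Int_open_pos fat_section_compact fat_section_convex) (simp_all add: emeasure_fat_section)
    moreover have "emeasure lborel (fat_section 0) = emeasure lborel ?T + emeasure lborel (fat_section 0 \<inter> - ?T)"
    proof -
      have "fat_section 0 = ?T \<union> (fat_section 0 \<inter> - ?T)" using sub by blast
      moreover have "emeasure lborel (?T \<union> (fat_section 0 \<inter> - ?T)) = emeasure lborel ?T + emeasure lborel (fat_section 0 \<inter> - ?T)"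
        using cl borel_compact[OF fat_section_compact] by (intro plus_emeasure[symmetric]) (auto intro!: sets.Int)
      ultimately show ?thesis by metis
    qed
    then have "section_volume K 0 + emeasure lborel (fat_section 0 \<inter> - ?T) = section_volume K 0 + 0"
      by (simp add: emeasure_fat_section eT)
    ultimately show False using fin by (auto simp: ennreal_add_left_cancel)
  qed
  have "z \<in> K \<longleftrightarrow> y + c + z \<in> K" if z: "P z = 0" for z
  proof -
    have "z \<in> K \<longleftrightarrow> z \<in> fat_section 0" using z by (simp add: fat_section_def)
    also have "\<dots> \<longleftrightarrow> z + c \<in> fat_section y" by (subst eq) simp
    also have "\<dots> \<longleftrightarrow> y + c + z \<in> K" using z Pc by (simp add: fat_section_def add ac_simps)
    finally show ?thesis .
  qed
  then show ?thesis using Pc by blast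
qed

text \<open>Iterating the translation would move 0 arbitrarily far inside the bounded
  \<open>K\<close>. This makes the translation vector of each section unique.\<close>

lemma translation_invariant_zero:
  assumes "\<And>z. P z = 0 \<Longrightarrow> z \<in> K \<Longrightarrow> z + d \<in> K" "P d = 0"
  shows "d = 0"
proof (rule ccontr)
  assume d: "d \<noteq> 0"
  have "real n *\<^sub>R d \<in> K" for n
  proof (induction n)
    case (Suc n)
    have "P (real n *\<^sub>R d) = 0" using assms(2) by (simp add: scale)
    then show ?case using assms(1)[OF _ Suc] by (simp add: scaleR_add_left add.commute)
  qed (simp add: K.zero_in)
  moreover obtain R where R: "\<And>a. a \<in> K \<Longrightarrow> norm a \<le> R" using bounded_K unfolding bounded_iff by auto
  ultimately have le: "real n * norm d \<le> R" for n using R[of "real n *\<^sub>R d"] by simp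
  obtain n :: nat where "R / norm d < real n" using reals_Archimedean2 by blast
  then have "R < real n * norm d" using d by (simp add: pos_divide_less_eq)
  then show False using le[of n] by simp
qed

text \<open>In the equality case \<^term>\<open>K\<close> is the sum of its section with \<open>ker P\<close> and a convex set \<open>G\<close>
  projecting bijectively onto \<^term>\<open>P ` K\<close>; the orthogonal complement of the span of \<open>G\<close> is the
  complementary subspace.\<close>

lemma equality_structure:
  assumes eq: "radial_weight (real DIM('a)) = fubini_const P * total_weight (real DIM('a))"
  obtains U where "subspace U" "\<And>u. u \<in> U \<Longrightarrow> P u = 0 \<Longrightarrow> u = 0" "\<And>v. \<exists>u\<in>U. P u = P v"
    "\<And>x. x \<in> K \<Longrightarrow> \<exists>a\<in>U. P a = P x \<and> (\<forall>z. P z = 0 \<longrightarrow> (z \<in> K \<longleftrightarrow> a + z \<in> K))"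
proof -
  \<comment> \<open>The vectors that carry the central section onto a parallel one.\<close>
  define G where "G = {x. \<forall>z. P z = 0 \<longrightarrow> (z \<in> K \<longleftrightarrow> x + z \<in> K)}"
  have G0: "0 \<in> G" by (simp add: G_def)
  have GK: "x \<in> K" if "x \<in> G" for x
  proof -
    have "0 \<in> K \<longleftrightarrow> x + 0 \<in> K" using that zero unfolding G_def by blast
    then show ?thesis using K.zero_in by simp
  qed
  have ex: "\<exists>a\<in>G. P a = y" if y: "P y = y" "N y \<le> 1" for y
  proof -
    obtain c where c: "P c = 0" "\<forall>z. P z = 0 \<longrightarrow> (z \<in> K \<longleftrightarrow> y + c + z \<in> K)"
      using sections_are_translates[OF section_volume_constant[OF eq y] y(1)] by blast
    then have "y + c \<in> G" by (simp add: G_def)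
    moreover have "P (y + c) = y" using c(1) y(1) by (simp add: add)
    ultimately show ?thesis by blast
  qed
  have Gsym: "- x \<in> G" if x: "x \<in> G" for x
    unfolding G_def
  proof (intro CollectI allI impI)
    fix z assume z: "P z = 0"
    then have "P (- z) = 0" by (simp add: neg)
    then have "- z \<in> K \<longleftrightarrow> x + - z \<in> K" using x by (simp add: G_def)
    moreover have "- z \<in> K \<longleftrightarrow> z \<in> K" using sym_K[of z] sym_K[of "- z"] by auto
    moreover have "x + - z = - (- x + z)" by simp
    then have "x + - z \<in> K \<longleftrightarrow> - x + z \<in> K" using sym_K[of "x + - z"] sym_K[of "- x + z"] by (simp only: minus_minus) blast
    ultimately show "z \<in> K \<longleftrightarrow> - x + z \<in> K" by (simp only:)
  qed
  have Gker: "x = 0" if x: "x \<in> G" "P x = 0" for x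
  proof (rule translation_invariant_zero)
    show "z + x \<in> K" if "P z = 0" "z \<in> K" for z using x(1) that by (simp add: G_def add.commute)
  qed (rule x(2))
  \<comment> \<open>Let \<open>a\<close> be the member of \<open>G\<close> with the same projection
    as the combination \<open>?w\<close>. Translation by \<open>?w - a\<close> maps the central
    section into itself, so \<open>?w\<close> equals \<open>a\<close>.\<close>
  have Gconv: "u *\<^sub>R x + v *\<^sub>R y \<in> G" if xy: "x \<in> G" "y \<in> G" and uv: "0 \<le> u" "0 \<le> v" "u + v = 1" for x y u v
  proof -
    let ?w = "u *\<^sub>R x + v *\<^sub>R y"
    have wK: "?w \<in> K" using GK xy uv by (intro convexD[OF convex_K]) auto
    have "N (P ?w) \<le> 1" using N_le[of ?w] wK K.gauge_le_1_iff[of ?w] by (simp add: N_P)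
    then obtain a where a: "a \<in> G" "P a = P ?w" using ex[of "P ?w"] by auto
    have d: "P (?w - a) = 0" using a(2) by (simp add: diff)
    have "?w - a = 0"
    proof (rule translation_invariant_zero[OF _ d])
      fix z assume z: "P z = 0" "z \<in> K"
      have "u *\<^sub>R (x + z) + v *\<^sub>R (y + z) \<in> K"
        using xy z uv by (intro convexD[OF convex_K]) (auto simp: G_def)
      moreover have "u *\<^sub>R (x + z) + v *\<^sub>R (y + z) = ?w + (u + v) *\<^sub>R z" by (simp add: algebra_simps)
      moreover have "?w + (u + v) *\<^sub>R z = a + (z + (?w - a))" using uv(3) by simp
      ultimately have "a + (z + (?w - a)) \<in> K" by (simp only:)
      moreover have "P (z + (?w - a)) = 0" using z(1) d by (simp only: add) simp
      ultimately show "z + (?w - a) \<in> K" using a(1) by (simp add: G_def)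
    qed
    then show ?thesis using a(1) by simp
  qed
  \<comment> \<open>The cone over the symmetric convex set \<open>G\<close> is already its linear
    span.\<close>
  define U where "U = {s *\<^sub>R x | s x. s \<ge> 0 \<and> x \<in> G}"
  have "subspace U"
    unfolding subspace_def
  proof (intro conjI ballI allI)
    show "0 \<in> U" unfolding U_def using G0 by force
    fix a b assume "a \<in> U" "b \<in> U"
    then obtain s x t y where st: "a = s *\<^sub>R x" "b = t *\<^sub>R y" "s \<ge> 0" "t \<ge> 0" "x \<in> G" "y \<in> G" unfolding U_def by blast
    show "a + b \<in> U"
    proof (cases "s + t = 0")
      case True
      then have "s = 0" "t = 0" using st by auto
      then show ?thesis using st \<open>0 \<in> U\<close> by simp
    next
      case False
      then have p: "s + t > 0" using st by simp
      have "(s / (s + t)) *\<^sub>R x + (t / (s + t)) *\<^sub>R y \<in> G"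
        using st p by (intro Gconv) (auto simp: add_divide_distrib[symmetric])
      moreover have "a + b = (s + t) *\<^sub>R ((s / (s + t)) *\<^sub>R x + (t / (s + t)) *\<^sub>R y)"
        using p st by (simp add: scaleR_add_right)
      ultimately show ?thesis unfolding U_def using p by (auto intro!: exI[of _ "s + t"])
    qed
  next
    fix r :: real and a assume "a \<in> U"
    then obtain s x where sx: "a = s *\<^sub>R x" "s \<ge> 0" "x \<in> G" unfolding U_def by blast
    show "r *\<^sub>R a \<in> U"
    proof (cases "r \<ge> 0")
      case True
      then have "r *\<^sub>R a = (r * s) *\<^sub>R x" "r * s \<ge> 0" using sx by auto
      then show ?thesis unfolding U_def using sx(3) by blast
    next
      case False
      then have "r *\<^sub>R a = (- r * s) *\<^sub>R (- x)" "- r * s \<ge> 0" using sx by (auto simp: mult_nonpos_nonneg)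
      then show ?thesis unfolding U_def using Gsym[OF sx(3)] by blast
    qed
  qed
  moreover have "u = 0" if u: "u \<in> U" "P u = 0" for u
  proof -
    obtain s x where sx: "u = s *\<^sub>R x" "x \<in> G" using u(1) unfolding U_def by blast
    then have "s = 0 \<or> P x = 0" using u(2) by (simp add: scale)
    then show ?thesis using Gker sx by auto
  qed
  moreover have GU: "x \<in> U" if "x \<in> G" for x unfolding U_def using that by (auto intro!: exI[of _ 1])
  moreover have "\<exists>u\<in>U. P u = P v" for v
  proof (cases "P v = 0")
    case True
    then show ?thesis using GU[OF G0] zero by (intro bexI[of _ 0]) simp_all
  next
    case False
    then have t: "N v > 0" by (rule N_pos)
    let ?y = "P v /\<^sub>R N v"
    have "N ?y = 1" using C.gauge_scale[of "inverse (N v)" "P v"] t by (simp add: N_P)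
    then obtain a where a: "a \<in> G" "P a = ?y" using ex[of ?y] by (auto simp: scale)
    have "N v *\<^sub>R a \<in> U" unfolding U_def using a(1) t less_imp_le by blast
    moreover have "P (N v *\<^sub>R a) = P v" using a(2) t by (simp add: scale)
    ultimately show ?thesis by blast
  qed
  moreover have "\<exists>a\<in>U. P a = P x \<and> (\<forall>z. P z = 0 \<longrightarrow> (z \<in> K \<longleftrightarrow> a + z \<in> K))" if x: "x \<in> K" for x
  proof -
    have "N (P x) \<le> 1" using N_le[of x] x K.gauge_le_1_iff[of x] by (simp add: N_P)
    then obtain a where "a \<in> G" "P a = P x" using ex[of "P x"] by auto
    then show ?thesis using GU by (auto simp: G_def)
  qed
  ultimately show ?thesis using that[of U] by blast
qed

text \<open>The range of \<open>P\<close> is orthogonal to the kernel of \<open>P\<close>, and L' to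
  \<open>U\<close>. A functional v1 + v2 therefore splits over the direct sum: v1 sees only the
  component in \<open>U\<close>, v2 only the one in the kernel, and both are maximized separately.
  So a boundary point with normal v1 + v2 also has the directions of the nonzero ones among v1 and
  v2 as normals.\<close>

lemma equality_normals:
  assumes eq: "radial_weight (real DIM('a)) = fubini_const P * total_weight (real DIM('a))"
  obtains L' where "subspace L'" "range P \<inter> L' = {0}" "{x + y | x y. x \<in> range P \<and> y \<in> L'} = UNIV"
    "rev_radial_gauss K (sphere 0 1 - (range P \<union> L'))
      \<subseteq> rev_radial_gauss K (sphere 0 1 \<inter> range P) \<inter> rev_radial_gauss K (sphere 0 1 \<inter> L')"
    "sphere 0 1 \<subseteq> rev_radial_gauss K (sphere 0 1 \<inter> range P) \<union> rev_radial_gauss K (sphere 0 1 \<inter> L')"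
proof -
  obtain U where U: "subspace U" "\<And>u. u \<in> U \<Longrightarrow> P u = 0 \<Longrightarrow> u = 0" "\<And>v. \<exists>u\<in>U. P u = P v"
    "\<And>x. x \<in> K \<Longrightarrow> \<exists>a\<in>U. P a = P x \<and> (\<forall>z. P z = 0 \<longrightarrow> (z \<in> K \<longleftrightarrow> a + z \<in> K))"
    using equality_structure[OF eq] by blast
  define L' where "L' = {y \<in> UNIV. \<forall>x\<in>U. orthogonal x y}"
  have sL: "subspace (range P)" using P by (rule orth_proj_subspace)
  have sL': "subspace L'" unfolding L'_def using subspace_orthogonal_to_vectors[of U] by simp
  have inL: "P v = v" if "v \<in> range P" for v using that by auto
  \<comment> \<open>On a vector of the range the inner product with u equals that with
    \<open>P u\<close>, and \<open>P\<close> maps \<open>U\<close> onto the range; so orthogonality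
    to \<open>U\<close> makes the vector orthogonal to itself.\<close>
  have int: "range P \<inter> L' = {0}"
  proof -
    have "v = 0" if v: "v \<in> range P" "v \<in> L'" for v
    proof -
      obtain u where u: "u \<in> U" "P u = P v" using U(3) by blast
      have "v \<bullet> v = v \<bullet> P u" using u(2) inL[OF v(1)] by simp
      also have "\<dots> = v \<bullet> u" using orth_proj_self_adjoint[OF P, of v u] inL[OF v(1)] by simp
      also have "\<dots> = 0" using v(2) u(1) by (auto simp: L'_def orthogonal_def inner_commute)
      finally show ?thesis by simp
    qed
    then show ?thesis using subspace_0[OF sL] subspace_0[OF sL'] by blast
  qed
  have PU: "P ` U = range P"
  proof
    show "range P \<subseteq> P ` U"
    proof
      fix w assume "w \<in> range P"
      then obtain v where w: "w = P v" by (rule rangeE)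
      obtain u where "u \<in> U" "P u = P v" using U(3) by blast
      then show "w \<in> P ` U" unfolding w by (intro image_eqI[of _ _ u]) simp_all
    qed
  qed (rule image_mono, rule subset_UNIV)
  have "inj_on P U"
  proof (rule inj_onI)
    fix a b assume ab: "a \<in> U" "b \<in> U" "P a = P b"
    have "a - b \<in> U" using subspace_diff[OF U(1) ab(1,2)] .
    moreover have "P (a - b) = 0" using ab(3) by (simp add: diff)
    ultimately have "a - b = 0" by (rule U(2))
    then show "a = b" by simp
  qed
  then have "inj_on P (span U)" unfolding span_eq_iff[THEN iffD2, OF U(1)] .
  then have "dim (P ` U) = dim U" by (rule dim_image_eq[OF linear_axioms])
  then have dU: "dim U = k" using PU by simp
  have dL': "dim L' + k = DIM('a)"
    using dim_subspace_orthogonal_to_vectors[OF U(1) subspace_UNIV] dU by (simp add: L'_def)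
  let ?S = "{x + y | x y. x \<in> range P \<and> y \<in> L'}"
  have "dim ?S + dim (range P \<inter> L') = dim (range P) + dim L'" by (rule dim_sums_Int[OF sL sL'])
  then have "dim ?S = DIM('a)" using dL' int by simp
  moreover have "subspace ?S" using subspace_sums[OF sL sL'] by simp
  ultimately have sum: "?S = UNIV" using dim_eq_full[of ?S] span_eq_iff[of ?S] by metis
  have LK: "v \<bullet> b = 0" if "v \<in> range P" "P b = 0" for v b
    using orth_proj_self_adjoint[OF P, of v b] inL[OF that(1)] that(2) by simp
  have L'U: "v \<bullet> a = 0" if "v \<in> L'" "a \<in> U" for v a
    using that by (auto simp: L'_def orthogonal_def inner_commute)
  have dec: "\<exists>a b. x = a + b \<and> a \<in> U \<and> P b = 0 \<and> b \<in> K \<and> (\<forall>z. P z = 0 \<longrightarrow> z \<in> K \<longrightarrow> a + z \<in> K)" if x: "x \<in> K" for x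
  proof -
    obtain a where a: "a \<in> U" "P a = P x" "\<forall>z. P z = 0 \<longrightarrow> (z \<in> K \<longleftrightarrow> a + z \<in> K)" using U(4)[OF x] by blast
    have "P (x - a) = 0" using a(2) by (simp add: diff)
    moreover from this have "x - a \<in> K" using a(3) x by simp
    ultimately show ?thesis using a by (intro exI[of _ a] exI[of _ "x - a"]) auto
  qed
  have main: "(v1 \<noteq> 0 \<longrightarrow> u \<in> rev_radial_gauss K (sphere 0 1 \<inter> range P)) \<and> (v2 \<noteq> 0 \<longrightarrow> u \<in> rev_radial_gauss K (sphere 0 1 \<inter> L'))"
    if u: "norm u = 1" and v: "\<forall>y\<in>K. (v1 + v2) \<bullet> y \<le> (v1 + v2) \<bullet> (u /\<^sub>R gauge_fun K u)"
      and v12: "v1 \<in> range P" "v2 \<in> L'" for u v1 v2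
  proof -
    have u0: "u \<noteq> 0" using u by auto
    let ?x = "u /\<^sub>R gauge_fun K u"
    have g: "gauge_fun K u > 0" using u0 by (rule gauge_K_pos)
    have xK: "?x \<in> K" using K.gauge_le_iff[OF g, of u] by simp
    obtain a b where ab: "?x = a + b" "a \<in> U" "P b = 0" "b \<in> K" "\<forall>z. P z = 0 \<longrightarrow> z \<in> K \<longrightarrow> a + z \<in> K"
      using dec[OF xK] by blast
    \<comment> \<open>Replacing one component at a time stays in \<open>K\<close>, which separates
      the two maximizations.\<close>
    have sup: "v1 \<bullet> y \<le> v1 \<bullet> ?x \<and> v2 \<bullet> y \<le> v2 \<bullet> ?x" if y: "y \<in> K" for y
    proof -
      obtain a' b' where ab': "y = a' + b'" "a' \<in> U" "P b' = 0" "b' \<in> K" "\<forall>z. P z = 0 \<longrightarrow> z \<in> K \<longrightarrow> a' + z \<in> K"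
        using dec[OF y] by blast
      have "a' + b \<in> K" "a + b' \<in> K" using ab ab' by auto
      then have "(v1 + v2) \<bullet> (a' + b) \<le> (v1 + v2) \<bullet> (a + b)" "(v1 + v2) \<bullet> (a + b') \<le> (v1 + v2) \<bullet> (a + b)"
        using v unfolding ab(1) by blast+
      then have "v1 \<bullet> a' \<le> v1 \<bullet> a" "v2 \<bullet> b' \<le> v2 \<bullet> b"
        using LK[OF v12(1) ab(3)] LK[OF v12(1) ab'(3)] L'U[OF v12(2) ab(2)] L'U[OF v12(2) ab'(2)]
        by (simp_all add: inner_add_left inner_add_right)
      then show ?thesis unfolding ab(1) ab'(1)
        using LK[OF v12(1) ab(3)] LK[OF v12(1) ab'(3)] L'U[OF v12(2) ab(2)] L'U[OF v12(2) ab'(2)]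
        by (simp add: inner_add_right)
    qed
    have unit: "u \<in> rev_radial_gauss K (sphere 0 1 \<inter> M)" if "subspace M" "w \<in> M" "w \<noteq> 0" "\<And>y. y \<in> K \<Longrightarrow> w \<bullet> y \<le> w \<bullet> ?x" for M w
    proof -
      have "w /\<^sub>R norm w \<in> sphere 0 1 \<inter> M" using that by (simp add: subspace_scale)
      moreover have "\<forall>y\<in>K. (w /\<^sub>R norm w) \<bullet> y \<le> (w /\<^sub>R norm w) \<bullet> ?x"
        unfolding inner_scaleR_left using that(4) by (intro ballI mult_left_mono) auto
      moreover have "sphere 0 1 \<inter> M \<subseteq> sphere (0::'a) 1" by simp
      ultimately have "u /\<^sub>R norm u \<in> rev_radial_gauss K (sphere 0 1 \<inter> M)"
        using mem_rev_radial_gauss[OF _ u0] by blast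
      then show ?thesis using u by simp
    qed
    show ?thesis using unit[OF sL v12(1)] unit[OF sL' v12(2)] sup by blast
  qed
  have ex: "\<exists>v1 v2. v1 \<in> range P \<and> v2 \<in> L' \<and> v1 + v2 \<in> \<eta> \<and> (\<forall>y\<in>K. (v1 + v2) \<bullet> y \<le> (v1 + v2) \<bullet> (u /\<^sub>R gauge_fun K u))"
    if \<eta>: "\<eta> \<subseteq> sphere 0 1" and u: "u \<in> rev_radial_gauss K \<eta>" for u \<eta>
  proof -
    have n: "norm u = 1" using u rev_radial_gauss_sphere[of \<eta>] by (auto simp: subset_eq)
    then have "u \<noteq> 0" by auto
    then obtain v where v: "v \<in> \<eta>" "\<forall>y\<in>K. v \<bullet> y \<le> v \<bullet> (u /\<^sub>R gauge_fun K u)"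
      using mem_rev_radial_gauss[OF \<eta>, of u] u n by auto
    have "v \<in> ?S" using sum by simp
    then obtain v1 v2 where "v = v1 + v2" "v1 \<in> range P" "v2 \<in> L'" by blast
    then show ?thesis using v by blast
  qed
  show ?thesis
  proof (rule that[OF sL' int sum])
    show "rev_radial_gauss K (sphere 0 1 - (range P \<union> L'))
      \<subseteq> rev_radial_gauss K (sphere 0 1 \<inter> range P) \<inter> rev_radial_gauss K (sphere 0 1 \<inter> L')"
    proof
      fix u assume u: "u \<in> rev_radial_gauss K (sphere 0 1 - (range P \<union> L'))"
      then have n: "norm u = 1" using rev_radial_gauss_sphere[of "sphere 0 1 - (range P \<union> L')"] by (auto simp: subset_eq)
      obtain v1 v2 where v: "v1 \<in> range P" "v2 \<in> L'" "v1 + v2 \<in> sphere 0 1 - (range P \<union> L')"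
        "\<forall>y\<in>K. (v1 + v2) \<bullet> y \<le> (v1 + v2) \<bullet> (u /\<^sub>R gauge_fun K u)"
        using ex[OF _ u] by blast
      then have "v1 \<noteq> 0" "v2 \<noteq> 0" by auto
      then show "u \<in> rev_radial_gauss K (sphere 0 1 \<inter> range P) \<inter> rev_radial_gauss K (sphere 0 1 \<inter> L')"
        using main[OF n v(4,1,2)] by blast
    qed
    show "sphere 0 1 \<subseteq> rev_radial_gauss K (sphere 0 1 \<inter> range P) \<union> rev_radial_gauss K (sphere 0 1 \<inter> L')"
    proof
      fix u :: 'a assume u: "u \<in> sphere 0 1"
      then have n: "norm u = 1" and u': "u \<in> rev_radial_gauss K (sphere 0 1)" by (simp_all add: rev_radial_gauss_full)
      obtain v1 v2 where v: "v1 \<in> range P" "v2 \<in> L'" "v1 + v2 \<in> sphere 0 1"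
        "\<forall>y\<in>K. (v1 + v2) \<bullet> y \<le> (v1 + v2) \<bullet> (u /\<^sub>R gauge_fun K u)"
        using ex[OF order_refl u'] by blast
      then have "v1 \<noteq> 0 \<or> v2 \<noteq> 0" by auto
      then show "u \<in> rev_radial_gauss K (sphere 0 1 \<inter> range P) \<union> rev_radial_gauss K (sphere 0 1 \<inter> L')"
        using main[OF n v(4,1,2)] by blast
    qed
  qed
qed

end

section \<open>Subspace concentration\<close>

context sym_body
begin

abbreviation gauss_weight :: "real \<Rightarrow> 'a set \<Rightarrow> real" where
  "gauss_weight q \<eta> \<equiv> enn2real (cone_weight q (rev_radial_gauss K \<eta>))"

lemma subspace_concentration:
  assumes L: "subspace L" "L \<noteq> {0}" "L \<noteq> UNIV" and q: "0 < q" "q \<le> real DIM('a)"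
  shows "gauss_weight q (sphere 0 1 \<inter> L) \<le> real (dim L) / q * gauss_weight q (sphere 0 1)"
    and "q < real DIM('a) \<Longrightarrow> gauss_weight q (sphere 0 1 \<inter> L) < real (dim L) / q * gauss_weight q (sphere 0 1)"
    and "gauss_weight q (sphere 0 1 \<inter> L) < gauss_weight q (sphere 0 1)"
    and "dim L < DIM('a)"
proof -
  obtain P where oP: "orth_proj P" "range P = L" using subspace_orth_proj[OF L(1)] by blast
  interpret sym_body_proj K P by unfold_locales (use oP L in simp_all)
  show "gauss_weight q (sphere 0 1 \<inter> L) \<le> real (dim L) / q * gauss_weight q (sphere 0 1)"
    using cone_weight_range_le(1)[OF q] unfolding cone_weight_full oP(2) .
  show "gauss_weight q (sphere 0 1 \<inter> L) < real (dim L) / q * gauss_weight q (sphere 0 1)" if "q < real DIM('a)"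
    using cone_weight_range_le(2)[OF q that] unfolding cone_weight_full oP(2) .
  show "gauss_weight q (sphere 0 1 \<inter> L) < gauss_weight q (sphere 0 1)"
    using cone_weight_range_less[OF q(1)] unfolding cone_weight_full oP(2) .
  show "dim L < DIM('a)" using dim_range_less unfolding oP(2) .
qed

lemma cone_weight_modular:
  assumes [measurable]: "A \<in> sets borel" "B \<in> sets borel"
  shows "cone_weight q A + cone_weight q B = cone_weight q (A \<union> B) + cone_weight q (A \<inter> B)"
proof -
  have "cone_weight q A + cone_weight q B = (\<integral>\<^sup>+x. indicator A (x /\<^sub>R norm x) * weight q x + indicator B (x /\<^sub>R norm x) * weight q x \<partial>lborel)"
    unfolding cone_weight_def by (rule nn_integral_add[symmetric]) measurable
  also have "\<dots> = (\<integral>\<^sup>+x. indicator (A \<union> B) (x /\<^sub>R norm x) * weight q x + indicator (A \<inter> B) (x /\<^sub>R norm x) * weight q x \<partial>lborel)"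
    by (intro nn_integral_cong) (auto simp: indicator_def)
  also have "\<dots> = cone_weight q (A \<union> B) + cone_weight q (A \<inter> B)"
    unfolding cone_weight_def by (rule nn_integral_add) measurable
  finally show ?thesis .
qed

lemma cone_weight_mono: "A \<subseteq> B \<Longrightarrow> cone_weight q A \<le> cone_weight q B"
  unfolding cone_weight_def by (intro nn_integral_mono mult_right_mono) (auto simp: indicator_def)

text \<open>In the forward direction the images of the normals in L and in L' cover the sphere. The
  two bounds add up to the total weight, so the overlap of the images has weight 0, and all normals
  outside both subspaces lead into this overlap.\<close>

lemma equality_iff:
  assumes L: "subspace L" "L \<noteq> {0}" "L \<noteq> UNIV"
  defines "n \<equiv> real DIM('a)"
  shows "gauss_weight n (sphere 0 1 \<inter> L) = real (dim L) / n * gauss_weight n (sphere 0 1) \<longleftrightarrow>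
    (\<exists>L'. subspace L' \<and> L \<inter> L' = {0} \<and> {x + y | x y. x \<in> L \<and> y \<in> L'} = UNIV \<and>
      gauss_weight n (sphere 0 1 - (L \<union> L')) = 0)"
proof -
  let ?S = "sphere (0::'a) 1" and ?\<alpha> = "rev_radial_gauss K"
  have n: "0 < n" "n \<le> real DIM('a)" by (simp_all add: n_def)
  note finite = cone_weight_finite[OF n(1) _ rev_radial_gauss_sphere]
  have bL: "?\<alpha> (?S \<inter> M) \<in> sets borel" if "subspace M" for M
    using that by (intro rev_radial_gauss_borel_closed closed_subspace)
  have bO: "?\<alpha> (?S - (L \<union> M)) \<in> sets borel" if "subspace M" for M
  proof -
    have "open (- (L \<union> M))" using L(1) that by (intro open_Compl closed_Un closed_subspace)
    moreover have "?S - (L \<union> M) = ?S \<inter> - (L \<union> M)" by blast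
    ultimately show ?thesis using rev_radial_gauss_borel_open by metis
  qed
  have bS: "?\<alpha> ?S \<in> sets borel" by (simp add: rev_radial_gauss_full)
  have compl: "subspace L' \<and> L' \<noteq> {0} \<and> L' \<noteq> UNIV \<and> real (dim L) / n + real (dim L') / n = 1"
    if L': "subspace L'" "L \<inter> L' = {0}" "{x + y | x y. x \<in> L \<and> y \<in> L'} = UNIV" for L'
  proof -
    have "L' \<noteq> {0}"
    proof
      assume "L' = {0}"
      then have "{x + y | x y. x \<in> L \<and> y \<in> L'} = L" by auto
      then show False using L' L(3) by simp
    qed
    moreover have "L' \<noteq> UNIV" using L'(2) L(2) by auto
    moreover have "dim L + dim L' = DIM('a)"
      using dim_sums_Int[OF L(1) L'(1)] unfolding L'(2,3) by (simp add: dim_UNIV)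
    then have "real (dim L) + real (dim L') = n" unfolding n_def by linarith
    then have "real (dim L) / n + real (dim L') / n = 1" using n(1) by (simp add: add_divide_distrib[symmetric])
    ultimately show ?thesis using L'(1) by blast
  qed
  show ?thesis
  proof
    assume eq: "gauss_weight n (?S \<inter> L) = real (dim L) / n * gauss_weight n ?S"
    obtain P where oP: "orth_proj P" "range P = L" using subspace_orth_proj[OF L(1)] by blast
    interpret sym_body_proj K P by unfold_locales (use oP L in simp_all)
    have "radial_weight n = fubini_const P * total_weight n"
      using cone_weight_range_le(3)[OF n] eq unfolding cone_weight_full oP(2) by blast
    then obtain L' where L': "subspace L'" "L \<inter> L' = {0}" "{x + y | x y. x \<in> L \<and> y \<in> L'} = UNIV"
      "?\<alpha> (?S - (L \<union> L')) \<subseteq> ?\<alpha> (?S \<inter> L) \<inter> ?\<alpha> (?S \<inter> L')" "?S \<subseteq> ?\<alpha> (?S \<inter> L) \<union> ?\<alpha> (?S \<inter> L')"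
      using equality_normals unfolding n_def oP(2) by blast
    have c: "L' \<noteq> {0}" "L' \<noteq> UNIV" "real (dim L) / n + real (dim L') / n = 1" using compl[OF L'(1-3)] by auto
    let ?A = "?\<alpha> (?S \<inter> L)" and ?B = "?\<alpha> (?S \<inter> L')"
    have un: "?A \<union> ?B = ?\<alpha> ?S"
      using L'(5) rev_radial_gauss_sphere unfolding rev_radial_gauss_full by blast
    have bI: "?A \<inter> ?B \<in> sets borel" "?A \<inter> ?B \<subseteq> ?S"
      using bL[OF L(1)] bL[OF L'(1)] rev_radial_gauss_sphere by blast+
    have fin: "cone_weight n ?A < \<infinity>" "cone_weight n ?B < \<infinity>" "cone_weight n (?\<alpha> ?S) < \<infinity>" "cone_weight n (?A \<inter> ?B) < \<infinity>"
      using finite[OF bL[OF L(1)]] finite[OF bL[OF L'(1)]] finite[OF bS] cone_weight_finite[OF n(1) bI] by auto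
    have "enn2real (cone_weight n ?A + cone_weight n ?B) = enn2real (cone_weight n (?\<alpha> ?S) + cone_weight n (?A \<inter> ?B))"
      using cone_weight_modular[OF bL[OF L(1)] bL[OF L'(1)], of n] unfolding un by simp
    then have "gauss_weight n (?S \<inter> L) + gauss_weight n (?S \<inter> L') = gauss_weight n ?S + enn2real (cone_weight n (?A \<inter> ?B))"
      using fin by (simp add: enn2real_plus)
    moreover have "gauss_weight n (?S \<inter> L) \<le> real (dim L) / n * gauss_weight n ?S"
      "gauss_weight n (?S \<inter> L') \<le> real (dim L') / n * gauss_weight n ?S"
      using subspace_concentration(1)[OF L n] subspace_concentration(1)[OF L'(1) c(1,2) n] by auto
    moreover have "real (dim L) / n * gauss_weight n ?S + real (dim L') / n * gauss_weight n ?S = gauss_weight n ?S"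
      by (simp only: distrib_right[symmetric] c(3) mult_1)
    ultimately have "enn2real (cone_weight n (?A \<inter> ?B)) \<le> 0" by linarith
    moreover have "gauss_weight n (?S - (L \<union> L')) \<le> enn2real (cone_weight n (?A \<inter> ?B))"
      using fin(4) by (intro enn2real_mono cone_weight_mono L'(4)) simp
    moreover have "0 \<le> gauss_weight n (?S - (L \<union> L'))" by simp
    ultimately have "gauss_weight n (?S - (L \<union> L')) = 0" by linarith
    then show "\<exists>L'. subspace L' \<and> L \<inter> L' = {0} \<and> {x + y | x y. x \<in> L \<and> y \<in> L'} = UNIV \<and>
      gauss_weight n (?S - (L \<union> L')) = 0" using L'(1-3) by blast
  next
    assume "\<exists>L'. subspace L' \<and> L \<inter> L' = {0} \<and> {x + y | x y. x \<in> L \<and> y \<in> L'} = UNIV \<and>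
      gauss_weight n (?S - (L \<union> L')) = 0"
    then obtain L' where L': "subspace L'" "L \<inter> L' = {0}" "{x + y | x y. x \<in> L \<and> y \<in> L'} = UNIV"
      and zero: "gauss_weight n (?S - (L \<union> L')) = 0" by blast
    have c: "L' \<noteq> {0}" "L' \<noteq> UNIV" "real (dim L) / n + real (dim L') / n = 1" using compl[OF L'(1-3)] by auto
    let ?A = "?\<alpha> (?S \<inter> L)" and ?B = "?\<alpha> (?S \<inter> L')" and ?R = "?\<alpha> (?S - (L \<union> L'))"
    note b = bL[OF L(1)] bL[OF L'(1)] bO[OF L'(1)]
    have fin: "cone_weight n ?A < \<infinity>" "cone_weight n ?B < \<infinity>" "cone_weight n ?R < \<infinity>" "cone_weight n (?\<alpha> ?S) < \<infinity>"
      using finite[OF b(1)] finite[OF b(2)] finite[OF b(3)] finite[OF bS] by auto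
    have "?\<alpha> ?S \<subseteq> (?A \<union> ?B) \<union> ?R" by (auto simp: rev_radial_gauss_def)
    then have "cone_weight n (?\<alpha> ?S) \<le> cone_weight n ((?A \<union> ?B) \<union> ?R)" by (rule cone_weight_mono)
    also have "\<dots> \<le> cone_weight n (?A \<union> ?B) + cone_weight n ?R"
      using cone_weight_modular[OF sets.Un[OF b(1,2)] b(3), of n] by (metis add_increasing2 order_refl zero_le)
    also have "\<dots> \<le> (cone_weight n ?A + cone_weight n ?B) + cone_weight n ?R"
      using cone_weight_modular[OF b(1,2), of n] by (intro add_right_mono) (metis add_increasing2 order_refl zero_le)
    finally have "gauss_weight n ?S \<le> enn2real ((cone_weight n ?A + cone_weight n ?B) + cone_weight n ?R)"
      using fin by (intro enn2real_mono) (auto simp: less_top)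
    also have "\<dots> = gauss_weight n (?S \<inter> L) + gauss_weight n (?S \<inter> L')"
      using fin zero by (simp add: enn2real_plus)
    finally have "gauss_weight n ?S \<le> gauss_weight n (?S \<inter> L) + gauss_weight n (?S \<inter> L')" .
    moreover have "gauss_weight n (?S \<inter> L) \<le> real (dim L) / n * gauss_weight n ?S"
      "gauss_weight n (?S \<inter> L') \<le> real (dim L') / n * gauss_weight n ?S"
      using subspace_concentration(1)[OF L n] subspace_concentration(1)[OF L'(1) c(1,2) n] by auto
    moreover have "real (dim L) / n * gauss_weight n ?S + real (dim L') / n * gauss_weight n ?S = gauss_weight n ?S"
      by (simp only: distrib_right[symmetric] c(3) mult_1)
    ultimately show "gauss_weight n (?S \<inter> L) = real (dim L) / n * gauss_weight n ?S" by linarith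
  qed
qed

end

text \<open>For L = {0} both sides are 0 for every q, so equality would occur also for q < n; the
  equality clause is therefore stated for nonzero subspaces.\<close>

theorem mainTheorem1:
  fixes K L :: "'a::euclidean_space set" and q :: real
  assumes "DIM('a) \<ge> 2"
    and "convex_body K" and "origin_symmetric K"
    and "1 \<le> q" and "q \<le> real DIM('a)"
    and "subspace L" and "L \<noteq> UNIV" and "L \<noteq> {0}"
  shows "dual_curvature_measure q K (sphere 0 1 \<inter> L) / dual_curvature_measure q K (sphere 0 1)
           \<le> min (real (dim L) / q) 1
     \<and> (dual_curvature_measure q K (sphere 0 1 \<inter> L) / dual_curvature_measure q K (sphere 0 1)
           = min (real (dim L) / q) 1
        \<longleftrightarrow> q = real DIM('a) \<and>
            dual_curvature_measure (real DIM('a)) K (sphere 0 1 \<inter> L)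
              / dual_curvature_measure (real DIM('a)) K (sphere 0 1) = real (dim L) / real DIM('a))
     \<and> (dual_curvature_measure (real DIM('a)) K (sphere 0 1 \<inter> L)
              / dual_curvature_measure (real DIM('a)) K (sphere 0 1) = real (dim L) / real DIM('a)
        \<longleftrightarrow> (\<exists>L'. subspace L' \<and> L \<inter> L' = {0} \<and> {x + y | x y. x \<in> L \<and> y \<in> L'} = UNIV \<and>
               dual_curvature_measure (real DIM('a)) K (sphere 0 1 - (L \<union> L')) = 0))"
proof -
  interpret sym_body K
    using assms(2,3) by unfold_locales (auto simp: convex_body_def origin_symmetric_def)
  let ?n = "real DIM('a)" and ?S = "sphere (0::'a) 1"
  have q0: "0 < q" using assms(4) by simp
  note L = assms(6,8,7)
  note q = q0 assms(5)
  have n: "0 < ?n" "?n \<le> ?n" by simp_all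
  obtain c where c: "c > 0" "\<And>q \<eta>. q > 0 \<Longrightarrow> rev_radial_gauss K \<eta> \<in> sets borel \<Longrightarrow>
      dual_curvature_measure q K \<eta> = c * q * gauss_weight q \<eta>"
    using dual_curvature_measure_eq[OF assms(1)] by blast
  have bL: "rev_radial_gauss K (?S \<inter> L) \<in> sets borel"
    using L(1) by (intro rev_radial_gauss_borel_closed closed_subspace)
  have bS: "rev_radial_gauss K ?S \<in> sets borel" by (simp add: rev_radial_gauss_full)
  have pos: "gauss_weight p ?S > 0" if "0 < p" "p \<le> ?n" for p
    using subspace_concentration(3)[OF L that] by (rule le_less_trans[rotated]) simp
  have ratio: "dual_curvature_measure p K (?S \<inter> L) / dual_curvature_measure p K ?S = gauss_weight p (?S \<inter> L) / gauss_weight p ?S"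
    if "0 < p" for p
    unfolding c(2)[OF that bL] c(2)[OF that bS] using c(1) that by simp
  have zero: "dual_curvature_measure ?n K (?S - (L \<union> L')) = 0 \<longleftrightarrow> gauss_weight ?n (?S - (L \<union> L')) = 0" if "subspace L'" for L'
  proof -
    have "open (- (L \<union> L'))" using L(1) that by (intro open_Compl closed_Un closed_subspace)
    moreover have "?S - (L \<union> L') = ?S \<inter> - (L \<union> L')" by blast
    ultimately have "rev_radial_gauss K (?S - (L \<union> L')) \<in> sets borel" using rev_radial_gauss_borel_open by metis
    then show ?thesis using c by simp
  qed
  let ?r = "gauss_weight q (?S \<inter> L) / gauss_weight q ?S"
  have le1: "?r \<le> real (dim L) / q"
    using subspace_concentration(1)[OF L q] pos[OF q] by (simp only: pos_divide_le_eq)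
  have less1: "?r < 1" using subspace_concentration(3)[OF L q] pos[OF q] by (simp only: pos_divide_less_eq mult_1)
  have strict: "?r < real (dim L) / q" if "q < ?n"
    using subspace_concentration(2)[OF L q that] pos[OF q] by (simp only: pos_divide_less_eq)
  have dimL: "dim L < DIM('a)" by (rule subspace_concentration(4)[OF L q])
  have "?r \<le> min (real (dim L) / q) 1" using le1 less1 by simp
  moreover have "?r = min (real (dim L) / q) 1 \<longleftrightarrow>
      q = ?n \<and> gauss_weight ?n (?S \<inter> L) / gauss_weight ?n ?S = real (dim L) / ?n"
  proof (cases "q = ?n")
    case True
    \<comment> \<open>At q = n the minimum is attained by the dimension quotient, since
      \<open>L\<close> is proper.\<close>
    have "real (dim L) / ?n < 1" using dimL by simp
    then show ?thesis unfolding True by (simp add: min_def)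
  next
    case False
    then have "?r < real (dim L) / q" using strict q(2) by simp
    then have "?r < min (real (dim L) / q) 1" using less1 by (simp only: min_less_iff_conj)
    then show ?thesis using False by (simp only: less_irrefl simp_thms)
  qed
  moreover have "gauss_weight ?n (?S \<inter> L) / gauss_weight ?n ?S = real (dim L) / ?n \<longleftrightarrow>
      (\<exists>L'. subspace L' \<and> L \<inter> L' = {0} \<and> {x + y | x y. x \<in> L \<and> y \<in> L'} = UNIV \<and>
        gauss_weight ?n (?S - (L \<union> L')) = 0)"
  proof -
    have "gauss_weight ?n (?S \<inter> L) / gauss_weight ?n ?S = real (dim L) / ?n \<longleftrightarrow>
        gauss_weight ?n (?S \<inter> L) = real (dim L) / ?n * gauss_weight ?n ?S"
      using pos[OF n] by (intro nonzero_divide_eq_eq) simp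
    then show ?thesis using equality_iff[OF L] by simp
  qed
  ultimately show ?thesis
    unfolding ratio[OF q(1)] ratio[OF n(1)] using zero by (simp only: conj_assoc cong: conj_cong)
qed

end
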